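(* Let $\mathscr{D}$ be a nonnegative integer-valued random variable with $\mathbb{P}(\mathscr{D}>t)=\mathcal{L}(t)t^{-\gamma}$, where $\mathcal{L}$ is slowly varying at infinity and $1<\gamma<2$, and let $\mu=\mathbb{E}[\mathscr{D}]$. Let $\mathbf{D}_n=(D_1,\dots,D_n)$ be i.i.d. copies of $\mathscr{D}$ and let $\widehat{G}_n$ be the erased configuration model with degree sequence $\mathbf{D}_n$, with Pearson correlation coefficient $\widehat{r}_n$. Then there exists a slowly-varying function $\mathcal{L}_1$ such that, as $n\to\infty$, \[ \mu\,\mathcal{L}_1(n)\,n^{1-\frac{1}{\gamma}}\,\widehat{r}_n \xrightarrow{d} -\frac{\mathcal{S}_{\gamma/2}^2}{\mathcal{S}_{\gamma/3}}. \]
   Context: Configuration model (CM) with degree sequence $\mathbf{D}_n$: vertex $i\in\{1,\dots,n\}$ receives $D_i$ half-edges (if $L_n=\sum_i D_i$ is odd, one half-edge is added to one vertex; this correction is ignored), and all half-edges are paired uniformly at random, giving a multigraph $G_n$. The erased configuration model (ECM) $\widehat G_n$ is obtained from $G_n$ by removing all self-loops and replacing multiple edges between two vertices by a single edge. For a multigraph with degrees $d_i$, $\ell=\sum_i d_i$ and $x_{ij}$ the number of edges between $i$ and $j$ (self-loops counted twice), Pearson's correlation coefficient is \[ r=\frac{\sum_{i,j} x_{ij}d_id_j-\frac{1}{\ell}\big(\sum_i d_i^2\big)^2}{\sum_i d_i^3-\frac1\ell\big(\sum_i d_i^2\big)^2}; \] $\widehat r_n$ is this quantity computed on $\widehat G_n$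 (with its degrees $\widehat D_i$, edge indicators $\widehat X_{ij}$ and $\widehat L_n=\sum_i\widehat D_i$). Stable limits: let $\xi_1,\xi_2,\dots$ be i.i.d. exponential with mean 1, $\Gamma_i=\sum_{j=1}^i\xi_j$, and for integer $p\ge2$, $\mathcal{S}_{\gamma/p}=\sum_{i=1}^\infty\Gamma_i^{-p/\gamma}$, all defined from the same sequence $(\Gamma_i)$. *)

theory Defs
  imports "HOL-Probability.Probability"
begin

definition slowly_varying :: "(real \<Rightarrow> real) \<Rightarrow> bool" where
  "slowly_varying L \<longleftrightarrow> L \<in> borel_measurable borel \<and> (\<forall>\<^sub>F t in at_top. 0 < L t) \<and>
     (\<forall>c>0. ((\<lambda>t. L (c * t) / L t) \<longlongrightarrow> 1) at_top)"

definition cm_degrees :: "nat \<Rightarrow> (nat \<Rightarrow> nat) \<Rightarrow> nat \<Rightarrow> nat" where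
  "cm_degrees n d = (if odd (\<Sum>i<n. d i) then d(n - 1 := d (n - 1) + 1) else d)"

text \<open>Half-edges: (i,k) is the k-th half-edge of vertex i.\<close>
definition half_edges :: "nat \<Rightarrow> (nat \<Rightarrow> nat) \<Rightarrow> (nat \<times> nat) set" where
  "half_edges n d = {(i, k). i < n \<and> k < cm_degrees n d i}"

text \<open>Perfect matchings of the half-edges: fixed-point-free involutions of the half-edge set,
  equal to the identity outside it.\<close>
definition cm_matchings :: "nat \<Rightarrow> (nat \<Rightarrow> nat) \<Rightarrow> ((nat \<times> nat) \<Rightarrow> (nat \<times> nat)) set" where
  "cm_matchings n d = {m. (\<forall>h\<in>half_edges n d. m h \<in> half_edges n d \<and> m h \<noteq> h \<and> m (m h) = h)
                          \<and> (\<forall>h. h \<notin> half_edges n d \<longrightarrow> m h = h)}"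

text \<open>Number of edges between i and j in the multigraph (self-loops counted twice).\<close>
definition cm_edges :: "nat \<Rightarrow> (nat \<Rightarrow> nat) \<Rightarrow> ((nat \<times> nat) \<Rightarrow> (nat \<times> nat)) \<Rightarrow> nat \<Rightarrow> nat \<Rightarrow> nat" where
  "cm_edges n d m i j = card {h \<in> half_edges n d. fst h = i \<and> fst (m h) = j}"

definition ecm_edges :: "nat \<Rightarrow> (nat \<Rightarrow> nat) \<Rightarrow> ((nat \<times> nat) \<Rightarrow> (nat \<times> nat)) \<Rightarrow> nat \<Rightarrow> nat \<Rightarrow> nat" where
  "ecm_edges n d m i j = (if i \<noteq> j \<and> 0 < cm_edges n d m i j then 1 else 0)"

definition ecm_degree :: "nat \<Rightarrow> (nat \<Rightarrow> nat) \<Rightarrow> ((nat \<times> nat) \<Rightarrow> (nat \<times> nat)) \<Rightarrow> nat \<Rightarrow> nat" where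
  "ecm_degree n d m i = (\<Sum>j<n. ecm_edges n d m i j)"

definition pearson :: "nat \<Rightarrow> (nat \<Rightarrow> nat \<Rightarrow> nat) \<Rightarrow> (nat \<Rightarrow> nat) \<Rightarrow> real" where
  "pearson n x dg = (let l = (\<Sum>i<n. real (dg i)); s2 = (\<Sum>i<n. real (dg i) ^ 2) in
     ((\<Sum>i<n. \<Sum>j<n. real (x i j) * real (dg i) * real (dg j)) - s2 ^ 2 / l) /
     ((\<Sum>i<n. real (dg i) ^ 3) - s2 ^ 2 / l))"

definition ecm_pearson :: "nat \<Rightarrow> (nat \<Rightarrow> nat) \<Rightarrow> ((nat \<times> nat) \<Rightarrow> (nat \<times> nat)) \<Rightarrow> real" where
  "ecm_pearson n d m = pearson n (ecm_edges n d m) (ecm_degree n d m)"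

definition ecm_law :: "nat pmf \<Rightarrow> nat \<Rightarrow> ((nat \<Rightarrow> nat) \<Rightarrow> ((nat \<times> nat) \<Rightarrow> (nat \<times> nat)) \<Rightarrow> real) \<Rightarrow> real pmf" where
  "ecm_law p n F = Pi_pmf {..<n} 0 (\<lambda>_. p) \<bind>
      (\<lambda>d. map_pmf (F d) (pmf_of_set (cm_matchings n d)))"

text \<open>i.i.d. Exp(1) sequence xi_0, xi_1, ... ; Gamma_{i+1} = xi_0 + ... + xi_i.\<close>
definition exp_seq_space :: "(nat \<Rightarrow> real) measure" where
  "exp_seq_space = PiM UNIV (\<lambda>_. density lborel (exponential_density 1))"

definition Gamma_seq :: "(nat \<Rightarrow> real) \<Rightarrow> nat \<Rightarrow> real" where
  "Gamma_seq \<omega> i = (\<Sum>j\<le>i. \<omega> j)"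

definition stable_S :: "real \<Rightarrow> nat \<Rightarrow> (nat \<Rightarrow> real) \<Rightarrow> real" where
  "stable_S \<gamma> p \<omega> = (\<Sum>i. Gamma_seq \<omega> i powr (- real p / \<gamma>))"

end

theory Submission
  imports Defs
begin

text \<open>
  Let \<open>a\<^sub>n\<close> be the \<open>1/n\<close>-quantile of the degree tail. Up to negligible terms, Pearson's coefficient is
  \<open>- (\<Sum> D\<^sub>i\<^sup>2)\<^sup>2 / (\<mu> n \<Sum> D\<^sub>i\<^sup>3)\<close>: erasing edges changes the power sums of the degrees only by a factor
  \<open>1 + o(1)\<close>, because \<open>a\<^sub>n = o(n)\<close>; the edge sum \<open>\<Sum> X\<^sub>i\<^sub>j D\<^sub>i D\<^sub>j\<close> is \<open>o(a\<^sub>n\<^sup>4 / n)\<close>, because an edge between two hubs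
  counts only once and \<open>n = o(a\<^sub>n\<^sup>2)\<close>; and \<open>(\<Sum> D\<^sub>i\<^sup>2)\<^sup>2 / n = o(\<Sum> D\<^sub>i\<^sup>3)\<close>.
  The pair of sums scaled by \<open>a\<^sub>n\<^sup>2\<close> and \<open>a\<^sub>n\<^sup>3\<close> converges jointly: its Laplace transform at natural arguments is
  \<open>(1 - c\<^sub>n / n)\<^sup>n\<close> with \<open>c\<^sub>n\<close> converging by regular variation, the limit is the Laplace functional of the Poisson
  process \<open>(\<Gamma>\<^sub>i)\<close>, and by the Stone--Weierstrass theorem the mixed moments of \<open>(exp (- X), exp (- Y))\<close> determine
  convergence in distribution.
\<close>

section \<open>Regular variation of the tail\<close>

text \<open>Scaling: the numerator has order \<open>an ^ 4 / n\<close> and the denominator order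
  \<open>an ^ 3\<close>, so the coefficient has order \<open>an / n\<close>. This is the origin of
  the witness \<open>t powr (1 / \<gamma>) / \<a> t\<close>, which turns the prefactor into
  \<open>\<mu> * (n / an)\<close>. The comparisons \<open>n = o(an ^ 2)\<close> and
  \<open>an = o(n)\<close> are where \<gamma> < 2 and \<gamma> > 1 enter. The sums of squares and
  cubes have infinite mean, so they cannot be treated by moments. The degrees are frozen at a
  typical sequence instead, and the randomness of the graph is treated by first moments under the
  uniform matching. One parameter \<open>w\<close> with \<open>\<delta> = w ^ 2\<close> governs
  this: expected relative errors are O(\<delta>), so by Markov's inequality an error of order
  \<open>w\<close> is exceeded with probability O(\<open>w\<close>). The limiting ratio degenerates
  when a sum approaches 0 or infinity. A cutoff in the coordinates (exp (- X), exp (- Y)) confines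
  both sums to a compact interval of positive numbers, where all continuity is uniform; the limit
  law has almost all of its mass there.\<close>

definition tail_prob :: "nat pmf \<Rightarrow> real \<Rightarrow> real" where
  "tail_prob p x = measure_pmf.prob p {k. x < real k}"

text \<open>The value \<open>0\<close> for \<open>t \<le> 0\<close> makes the function monotone, hence measurable, on all of \<open>\<real>\<close>.\<close>
definition tail_quantile :: "nat pmf \<Rightarrow> real \<Rightarrow> real" where
  "tail_quantile p t = (if t \<le> 0 then 0 else real (LEAST k. tail_prob p (real k) \<le> 1 / t))"

lemma tail_prob_nonneg: "0 \<le> tail_prob p x"
  by (simp add: tail_prob_def)

lemma tail_prob_le_1: "tail_prob p x \<le> 1"
  by (simp add: tail_prob_def)

lemma tail_prob_antimono: "x \<le> y \<Longrightarrow> tail_prob p y \<le> tail_prob p x"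
  unfolding tail_prob_def by (intro measure_pmf.finite_measure_mono) auto

lemma borel_measurable_tail_prob [measurable]: "tail_prob p \<in> borel_measurable borel"
proof -
  have "mono (\<lambda>x. - tail_prob p x)"
    by (simp add: monoI tail_prob_antimono)
  then have "(\<lambda>x. - (- tail_prob p x)) \<in> borel_measurable borel"
    by (intro borel_measurable_uminus borel_measurable_mono)
  then show ?thesis by simp
qed

lemma tail_prob_floor:
  assumes "0 \<le> x" shows "tail_prob p x = tail_prob p (real (nat \<lfloor>x\<rfloor>))"
proof -
  have "x < real k \<longleftrightarrow> nat \<lfloor>x\<rfloor> < k" for k
    using assms by linarith
  then have "{k. x < real k} = {k. real (nat \<lfloor>x\<rfloor>) < real k}"
    by auto
  then show ?thesis by (simp add: tail_prob_def)
qed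

lemma tail_prob_tendsto_0: "(tail_prob p \<longlongrightarrow> 0) at_top"
proof -
  have "(\<lambda>n. measure_pmf.prob p {k. real n < real k}) \<longlonglongrightarrow> measure_pmf.prob p (\<Inter>n. {k. real n < real k})"
    by (intro measure_pmf.finite_Lim_measure_decseq) (auto simp: decseq_def)
  moreover have "(\<Inter>n. {k. real n < real k}) = {}"
    by auto
  ultimately have lim: "(\<lambda>n. tail_prob p (real n)) \<longlonglongrightarrow> 0"
    by (simp add: tail_prob_def)
  show ?thesis
  proof (rule order_tendstoI)
    fix e :: real assume "e < 0"
    then show "\<forall>\<^sub>F x in at_top. e < tail_prob p x"
      by (intro always_eventually allI less_le_trans[OF _ tail_prob_nonneg])
  next
    fix e :: real assume "0 < e"
    with lim have "\<forall>\<^sub>F n in sequentially. tail_prob p (real n) < e"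
      by (rule order_tendstoD)
    then obtain n where "tail_prob p (real n) < e"
      by (auto simp: eventually_sequentially)
    then show "\<forall>\<^sub>F x in at_top. tail_prob p x < e"
      by (intro eventually_mono[OF eventually_ge_at_top[of "real n"]])
        (meson order.strict_trans1 tail_prob_antimono)
  qed
qed

section \<open>The quantile as generalised inverse of the tail\<close>

lemma tail_quantile_nonneg: "0 \<le> tail_quantile p t"
  by (simp add: tail_quantile_def)

text \<open>The Galois connection through which bounds on the tail become bounds on the quantile.
  The least integer exists because the tail tends to 0, and integers suffice because the tail is
  constant between them.\<close>

lemma tail_quantile_le_iff:
  assumes "0 < t" "0 \<le> x"
  shows "tail_quantile p t \<le> x \<longleftrightarrow> tail_prob p x \<le> 1 / t"
proof -
  let ?P = "\<lambda>k. tail_prob p (real k) \<le> 1 / t"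
  have "\<forall>\<^sub>F x in at_top. tail_prob p x < 1 / t"
    by (rule order_tendstoD[OF tail_prob_tendsto_0]) (use assms in auto)
  then obtain N where N: "\<And>x. x \<ge> N \<Longrightarrow> tail_prob p x < 1 / t"
    by (auto simp: eventually_at_top_linorder)
  have "?P (nat \<lceil>N\<rceil>)"
    by (intro less_imp_le N real_nat_ceiling_ge)
  then have least: "?P (Least ?P)" by (rule LeastI)
  show ?thesis
  proof
    assume "tail_quantile p t \<le> x"
    then have "real (Least ?P) \<le> x" using assms by (simp add: tail_quantile_def)
    then show "tail_prob p x \<le> 1 / t"
      using least tail_prob_antimono order_trans by blast
  next
    assume "tail_prob p x \<le> 1 / t"
    then have "?P (nat \<lfloor>x\<rfloor>)" using tail_prob_floor[OF assms(2), of p] by simp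
    then have "Least ?P \<le> nat \<lfloor>x\<rfloor>" by (rule Least_le)
    then show "tail_quantile p t \<le> x" using assms by (simp add: tail_quantile_def) linarith
  qed
qed

lemma tail_prob_quantile_le: "0 < t \<Longrightarrow> tail_prob p (tail_quantile p t) \<le> 1 / t"
  using tail_quantile_le_iff[of t "tail_quantile p t" p] tail_quantile_nonneg by auto

lemma mono_tail_quantile: "mono (tail_quantile p)"
proof
  fix s t :: real assume "s \<le> t"
  show "tail_quantile p s \<le> tail_quantile p t"
  proof (cases "s \<le> 0")
    case True then show ?thesis by (simp add: tail_quantile_def)
  next
    case False
    then have "tail_prob p (tail_quantile p t) \<le> 1 / t" using \<open>s \<le> t\<close> by (intro tail_prob_quantile_le) auto
    also have "\<dots> \<le> 1 / s" using False \<open>s \<le> t\<close> by (simp add: frac_le)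
    finally show ?thesis using False tail_quantile_nonneg by (subst tail_quantile_le_iff) auto
  qed
qed

lemma dyadic_between:
  fixes r :: real assumes "1 \<le> r"
  obtains k :: nat where "2 ^ k \<le> r" "r < 2 ^ Suc k"
proof -
  obtain n where n: "r < 2 ^ n" using real_arch_pow[of 2 r] by auto
  define m where "m = (LEAST n. r < (2::real) ^ n)"
  have m: "r < 2 ^ m" unfolding m_def using n by (rule LeastI)
  then have "m \<noteq> 0" using assms by (cases m) auto
  then obtain k where k: "m = Suc k" by (cases m) auto
  have "\<not> r < 2 ^ k" using not_less_Least[of k "\<lambda>n. r < (2::real) ^ n"] k by (simp add: m_def)
  then show ?thesis using that m k by force
qed

locale heavy_tail =
  fixes p :: "nat pmf" and L :: "real \<Rightarrow> real" and \<gamma> :: real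
  assumes gamma_gt_1: "1 < \<gamma>" and gamma_less_2: "\<gamma> < 2"
    and slow: "slowly_varying L"
    and tail_eq: "\<And>t. 0 < t \<Longrightarrow> tail_prob p t = L t * t powr (- \<gamma>)"
begin

abbreviation "\<T> \<equiv> tail_prob p"
abbreviation "\<a> \<equiv> tail_quantile p"

text \<open>\<open>L\<close> is positive only eventually; monotonicity of the tail carries
  positivity down to every argument.\<close>

lemma tail_pos: "0 < \<T> x"
proof -
  have "\<forall>\<^sub>F t in at_top. 0 < L t" using slow by (simp add: slowly_varying_def)
  then have "\<forall>\<^sub>F t in at_top. 0 < L t \<and> 0 < t \<and> x \<le> t"
    using eventually_gt_at_top[of 0] eventually_ge_at_top[of x] by eventually_elim auto
  then obtain t where "0 < L t" "0 < t" "x \<le> t"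
    by (auto simp: eventually_at_top_linorder)
  then have "0 < \<T> t" by (simp add: tail_eq)
  then show ?thesis using tail_prob_antimono[OF \<open>x \<le> t\<close>, of p] by simp
qed

lemma tail_ratio:
  assumes "0 < c"
  shows "((\<lambda>x. \<T> (c * x) / \<T> x) \<longlongrightarrow> c powr (- \<gamma>)) at_top"
proof -
  have "((\<lambda>t. L (c * t) / L t * c powr (- \<gamma>)) \<longlongrightarrow> 1 * c powr (- \<gamma>)) at_top"
    using slow assms by (intro tendsto_mult tendsto_const) (auto simp: slowly_varying_def)
  moreover have "\<forall>\<^sub>F t in at_top. L (c * t) / L t * c powr (- \<gamma>) = \<T> (c * t) / \<T> t"
    using eventually_gt_at_top[of 0]
    by eventually_elim (use assms in \<open>simp add: tail_eq powr_mult field_simps\<close>)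
  ultimately show ?thesis
    by (simp add: tendsto_cong)
qed

lemma quantile_at_top: "filterlim \<a> at_top at_top"
  unfolding filterlim_at_top
proof
  fix Z :: real
  have "Z \<le> \<a> t" if "t > 1 / \<T> (max 0 Z)" for t
  proof -
    have t: "0 < t" using that tail_pos[of "max 0 Z"] by (smt (verit) zero_less_divide_1_iff)
    have "1 / t < \<T> (max 0 Z)"
      using that t tail_pos[of "max 0 Z"] by (simp add: field_simps)
    then have "\<not> \<a> t \<le> max 0 Z"
      using t by (subst tail_quantile_le_iff) auto
    then show ?thesis by simp
  qed
  then show "\<forall>\<^sub>F t in at_top. Z \<le> \<a> t"
    using eventually_gt_at_top[of "1 / \<T> (max 0 Z)"] by (rule eventually_mono[rotated])
qed

text \<open>The tail may jump at its quantile, so there \<open>1 / t\<close> is only an upper bound.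
  Slightly below, at \<open>\<theta> * \<a> t\<close>, the tail exceeds \<open>1 / t\<close>, and
  regular variation keeps the quotient of the two tails close to 1.\<close>

lemma tail_at_quantile: "((\<lambda>t. t * \<T> (\<a> t)) \<longlongrightarrow> 1) at_top"
proof (rule order_tendstoI)
  fix e :: real assume e: "e < 1"
  \<comment> \<open>With this choice \<open>\<theta> powr \<gamma>\<close> is the midpoint of
    \<open>max 0 e\<close> and 1, hence above \<open>e\<close>.\<close>
  define \<theta> where "\<theta> = ((max 0 e + 1) / 2) powr (1 / \<gamma>)"
  have th: "0 < \<theta>" "\<theta> < 1" "\<theta> powr \<gamma> > e"
    using e gamma_gt_1 powr_less_mono2[of "1 / \<gamma>" "(max 0 e + 1) / 2" 1]
    by (auto simp: \<theta>_def powr_powr)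
  have "((\<lambda>x. \<T> (1 / \<theta> * x) / \<T> x) \<longlongrightarrow> (1 / \<theta>) powr (- \<gamma>)) at_top"
    by (rule tail_ratio) (use th in auto)
  moreover have "filterlim (\<lambda>t. \<theta> * \<a> t) at_top at_top"
    using th by (intro filterlim_tendsto_pos_mult_at_top[OF tendsto_const _ quantile_at_top]) auto
  ultimately have "((\<lambda>t. \<T> (1 / \<theta> * (\<theta> * \<a> t)) / \<T> (\<theta> * \<a> t)) \<longlongrightarrow> (1 / \<theta>) powr (- \<gamma>)) at_top"
    by (rule filterlim_compose)
  moreover have "(1 / \<theta>) powr (- \<gamma>) = \<theta> powr \<gamma>"
    using th by (simp add: powr_divide powr_minus)
  ultimately have "((\<lambda>t. \<T> (\<a> t) / \<T> (\<theta> * \<a> t)) \<longlongrightarrow> \<theta> powr \<gamma>) at_top"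
    using th by simp
  then have "\<forall>\<^sub>F t in at_top. e < \<T> (\<a> t) / \<T> (\<theta> * \<a> t)"
    using th(3) by (rule order_tendstoD)
  moreover have "\<forall>\<^sub>F t in at_top. 0 < \<a> t"
    using quantile_at_top by (simp add: filterlim_at_top_dense)
  ultimately show "\<forall>\<^sub>F t in at_top. e < t * \<T> (\<a> t)"
    using eventually_gt_at_top[of 0]
  proof eventually_elim
    case (elim t)
    have "\<not> \<a> t \<le> \<theta> * \<a> t" using elim th by simp
    then have "1 / t < \<T> (\<theta> * \<a> t)" using elim th tail_quantile_le_iff[of t "\<theta> * \<a> t" p] by auto
    then have "1 \<le> t * \<T> (\<theta> * \<a> t)" using elim by (simp add: field_simps)
    then have "\<T> (\<a> t) / \<T> (\<theta> * \<a> t) * 1 \<le> \<T> (\<a> t) / \<T> (\<theta> * \<a> t) * (t * \<T> (\<theta> * \<a> t))"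
      by (intro mult_left_mono) (auto simp: tail_prob_nonneg)
    also have "\<dots> = t * \<T> (\<a> t)" using tail_pos[of "\<theta> * \<a> t"] by simp
    finally show ?case using elim by simp
  qed
next
  fix e :: real assume e: "1 < e"
  show "\<forall>\<^sub>F t in at_top. t * \<T> (\<a> t) < e"
    using eventually_gt_at_top[of 0]
  proof eventually_elim
    case (elim t)
    then show ?case using tail_prob_quantile_le[of t p] e by (simp add: field_simps)
  qed
qed

lemma tail_scaled:
  assumes "0 < y"
  shows "((\<lambda>t. t * \<T> (\<a> t * y)) \<longlongrightarrow> y powr (- \<gamma>)) at_top"
proof -
  have "((\<lambda>t. \<T> (y * \<a> t) / \<T> (\<a> t)) \<longlongrightarrow> y powr (- \<gamma>)) at_top"
    using tail_ratio[OF assms] quantile_at_top by (rule filterlim_compose)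
  from tendsto_mult[OF this tail_at_quantile]
  show ?thesis using tail_pos by (simp add: mult.commute less_imp_neq[THEN not_sym])
qed

text \<open>Inversion of regular variation: by \<open>tail_quantile_le_iff\<close>, comparing
  \<open>\<a> (c * t)\<close> with \<open>\<a> t * y\<close> means comparing
  \<open>t * \<T> (\<a> t * y)\<close>, whose limit is \<open>y powr (- \<gamma>)\<close>, with
  \<open>1 / c\<close>.\<close>

lemma quantile_ratio:
  assumes c: "0 < c"
  shows "((\<lambda>t. \<a> (c * t) / \<a> t) \<longlongrightarrow> c powr (1 / \<gamma>)) at_top"
proof (rule order_tendstoI)
  have pos: "\<forall>\<^sub>F t in at_top. 0 < \<a> t"
    using quantile_at_top by (simp add: filterlim_at_top_dense)
  {
    fix y assume y: "y < c powr (1 / \<gamma>)"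
    show "\<forall>\<^sub>F t in at_top. y < \<a> (c * t) / \<a> t"
    proof (cases "y > 0")
      case False
      \<comment> \<open>For \<open>y \<le> 0\<close> it is enough that the quotient is positive,
        which any level strictly between 0 and the limit shows.\<close>
      define z where "z = c powr (1 / \<gamma>) / 2"
      have z: "0 < z" "z < c powr (1 / \<gamma>)" using c by (auto simp: z_def)
      have "z powr \<gamma> < (c powr (1 / \<gamma>)) powr \<gamma>" using z gamma_gt_1 by (intro powr_less_mono2) auto
      then have "1 / c < z powr (- \<gamma>)" using c z gamma_gt_1 by (simp add: powr_powr powr_minus field_simps)
      from order_tendstoD(1)[OF tail_scaled[OF z(1)] this]
      show ?thesis using pos eventually_gt_at_top[of 0]
      proof eventually_elim
        case (elim t)
        then have "1 / (c * t) < \<T> (\<a> t * z)" using c by (simp add: field_simps)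
        then have "\<not> \<a> (c * t) \<le> \<a> t * z" using elim c z by (subst tail_quantile_le_iff) auto
        then have "0 < \<a> (c * t)" using elim z by (smt (verit) mult_pos_pos)
        then have "0 < \<a> (c * t) / \<a> t" using elim by simp
        then show ?case using False by linarith
      qed
    next
      case True
      have "y powr \<gamma> < (c powr (1 / \<gamma>)) powr \<gamma>" using True y gamma_gt_1 by (intro powr_less_mono2) auto
      then have "1 / c < y powr (- \<gamma>)" using c True gamma_gt_1 by (simp add: powr_powr powr_minus field_simps)
      from order_tendstoD(1)[OF tail_scaled[OF True] this]
      show ?thesis using pos eventually_gt_at_top[of 0]
      proof eventually_elim
        case (elim t)
        then have "1 / (c * t) < \<T> (\<a> t * y)" using c by (simp add: field_simps)
        then have "\<not> \<a> (c * t) \<le> \<a> t * y" using elim c True by (subst tail_quantile_le_iff) auto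
        then show ?case using elim by (simp add: field_simps)
      qed
    qed
  }
  {
    fix y assume y: "c powr (1 / \<gamma>) < y"
    have y0: "0 < y" using y by (smt (verit) powr_ge_zero)
    \<comment> \<open>From above the quantile equivalence gives only a weak inequality; the midpoint
      below \<open>y\<close> restores strictness.\<close>
    define z where "z = (c powr (1 / \<gamma>) + y) / 2"
    have z: "z < y" "c powr (1 / \<gamma>) < z" using y by (auto simp: z_def)
    have z0: "0 < z" using z by (smt (verit) powr_ge_zero)
    have "(c powr (1 / \<gamma>)) powr \<gamma> < z powr \<gamma>" using z gamma_gt_1 by (intro powr_less_mono2) auto
    then have "z powr (- \<gamma>) < 1 / c" using c z0 gamma_gt_1 by (simp add: powr_powr powr_minus field_simps)
    from order_tendstoD(2)[OF tail_scaled[OF z0] this]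
    show "\<forall>\<^sub>F t in at_top. \<a> (c * t) / \<a> t < y" using pos eventually_gt_at_top[of 0]
    proof eventually_elim
      case (elim t)
      then have "\<T> (\<a> t * z) \<le> 1 / (c * t)" using c by (simp add: field_simps)
      then have "\<a> (c * t) \<le> \<a> t * z" using elim c z0 by (subst tail_quantile_le_iff) auto
      then have "\<a> (c * t) / \<a> t \<le> z" using elim by (simp add: field_simps)
      then show ?case using z by simp
    qed
  }
qed

lemma slowly_varying_normalizer:
  "slowly_varying (\<lambda>t. t powr (1 / \<gamma>) / \<a> t)"
proof -
  have pos: "\<forall>\<^sub>F t in at_top. 0 < \<a> t"
    using quantile_at_top by (simp add: filterlim_at_top_dense)
  have "\<a> \<in> borel_measurable borel"
    by (rule borel_measurable_mono[OF mono_tail_quantile])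
  then have "(\<lambda>t. t powr (1 / \<gamma>) / \<a> t) \<in> borel_measurable borel"
    by measurable
  moreover have "\<forall>\<^sub>F t in at_top. 0 < t powr (1 / \<gamma>) / \<a> t"
    using pos eventually_gt_at_top[of 0] by eventually_elim auto
  moreover have "((\<lambda>t. ((c * t) powr (1 / \<gamma>) / \<a> (c * t)) / (t powr (1 / \<gamma>) / \<a> t)) \<longlongrightarrow> 1) at_top"
    if c: "0 < c" for c
  proof -
    have "((\<lambda>t. c powr (1 / \<gamma>) / (\<a> (c * t) / \<a> t)) \<longlongrightarrow> c powr (1 / \<gamma>) / c powr (1 / \<gamma>)) at_top"
      using c by (intro tendsto_divide tendsto_const quantile_ratio) auto
    moreover have "\<forall>\<^sub>F t in at_top. c powr (1 / \<gamma>) / (\<a> (c * t) / \<a> t)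
        = ((c * t) powr (1 / \<gamma>) / \<a> (c * t)) / (t powr (1 / \<gamma>) / \<a> t)"
      using eventually_gt_at_top[of 0] by eventually_elim (use c in \<open>simp add: powr_mult\<close>)
    ultimately show ?thesis using c by (simp add: tendsto_cong)
  qed
  ultimately show ?thesis by (simp add: slowly_varying_def)
qed

section \<open>Power bounds for the tail and the quantile\<close>

text \<open>Exponents slightly above and below \<open>\<gamma>\<close> absorb the slowly varying factor.\<close>
definition "gp = (\<gamma> + 2) / 2"
definition "gm = (\<gamma> + 1) / 2"

lemma gp_gm: "\<gamma> < gp" "gp < 2" "1 < gm" "gm < \<gamma>" "1 < gp"
  using gamma_gt_1 gamma_less_2 by (auto simp: gp_def gm_def)

text \<open>As \<open>\<gamma> < gp\<close>, doubling a large argument costs the tail a factor of at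
  most \<open>2 powr gp\<close>. Iterating over the dyadic scales from \<open>y\<close> to
  \<open>x\<close> produces the power of \<open>x / y\<close>; rounding \<open>x / y\<close> up to a
  power of two produces the additional factor.\<close>

lemma potter_bound:
  obtains x0 where "1 \<le> x0" "\<And>x y. x0 \<le> y \<Longrightarrow> y \<le> x \<Longrightarrow> \<T> y \<le> 2 powr gp * (x / y) powr gp * \<T> x"
proof -
  have "(2::real) powr (- gp) < 2 powr (- \<gamma>)" using gp_gm by (intro powr_less_mono) auto
  from order_tendstoD(1)[OF tail_ratio this]
  have "\<forall>\<^sub>F x in at_top. 2 powr (- gp) < \<T> (2 * x) / \<T> x" by simp
  then obtain x1 where x1: "\<And>x. x \<ge> x1 \<Longrightarrow> 2 powr (- gp) < \<T> (2 * x) / \<T> x"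
    by (auto simp: eventually_at_top_linorder)
  define x0 where "x0 = max 1 x1"
  have step: "\<T> y \<le> 2 powr gp * \<T> (2 * y)" if "y \<ge> x0" for y
    using x1[of y] that tail_pos[of y] by (auto simp: x0_def powr_minus field_simps)
  have iter: "\<T> y \<le> (2 powr gp) ^ k * \<T> (2 ^ k * y)" if y: "y \<ge> x0" for y k
  proof (induction k)
    case (Suc k)
    have "y \<le> 2 ^ k * y" using y by (simp add: x0_def)
    then have "\<T> (2 ^ k * y) \<le> 2 powr gp * \<T> (2 * (2 ^ k * y))" using y by (intro step) linarith
    then have "(2 powr gp) ^ k * \<T> (2 ^ k * y) \<le> (2 powr gp) ^ k * (2 powr gp * \<T> (2 * (2 ^ k * y)))"
      by (intro mult_left_mono) auto
    with Suc show ?case by (auto simp: mult_ac intro: order_trans)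
  qed simp
  have "\<T> y \<le> 2 powr gp * (x / y) powr gp * \<T> x" if y: "x0 \<le> y" and x: "y \<le> x" for x y
  proof -
    have y0: "0 < y" using y by (simp add: x0_def)
    obtain k where k: "2 ^ k \<le> x / y" "x / y < 2 ^ Suc k"
      using dyadic_between[of "x / y"] x y0 by auto
    have "\<T> y \<le> (2 powr gp) ^ Suc k * \<T> (2 ^ Suc k * y)" by (rule iter[OF y])
    also have "\<dots> \<le> (2 powr gp) ^ Suc k * \<T> x"
      using k y0 by (intro mult_left_mono tail_prob_antimono) (auto simp: field_simps)
    also have "(2 powr gp) ^ Suc k = 2 powr gp * (2 ^ k) powr gp"
      by (simp add: powr_realpow[symmetric] powr_powr mult.commute)
    also have "\<dots> * \<T> x \<le> 2 powr gp * (x / y) powr gp * \<T> x"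
      using k gp_gm by (intro mult_right_mono mult_left_mono powr_mono2) (auto simp: tail_prob_nonneg)
    finally show ?thesis .
  qed
  moreover have "1 \<le> x0" by (simp add: x0_def)
  ultimately show ?thesis using that by blast
qed

text \<open>As \<open>gm < \<gamma>\<close>, the function \<open>x powr gm * \<T> x\<close> does not
  increase under doubling beyond \<open>x0\<close>. Repeated halving brings every large
  \<open>x\<close> back to a bounded window, where the trivial bound 1 on the tail suffices.\<close>

lemma tail_upper_bound:
  obtains C where "0 < C" "\<And>x. 0 < x \<Longrightarrow> \<T> x \<le> C * x powr (- gm)"
proof -
  have "(2::real) powr (- \<gamma>) < 2 powr (- gm)" using gp_gm by (intro powr_less_mono) auto
  from order_tendstoD(2)[OF tail_ratio this]
  have "\<forall>\<^sub>F x in at_top. \<T> (2 * x) / \<T> x < 2 powr (- gm)" by simp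
  then obtain x1 where x1: "\<And>x. x \<ge> x1 \<Longrightarrow> \<T> (2 * x) / \<T> x < 2 powr (- gm)"
    by (auto simp: eventually_at_top_linorder)
  define x0 where "x0 = max 1 x1"
  have x0: "1 \<le> x0" by (simp add: x0_def)
  define f where "f x = x powr gm * \<T> x" for x
  have step: "f (2 * y) \<le> f y" if "y \<ge> x0" for y
  proof -
    have "y \<ge> 1" "y \<ge> x1" using that by (auto simp: x0_def)
    then have "2 powr gm * \<T> (2 * y) \<le> \<T> y"
      using x1[of y] tail_pos[of y] by (auto simp: powr_minus field_simps)
    then have "y powr gm * (2 powr gm * \<T> (2 * y)) \<le> y powr gm * \<T> y"
      by (intro mult_left_mono) auto
    then show ?thesis using \<open>y \<ge> 1\<close> by (simp add: f_def powr_mult mult_ac)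
  qed
  have iter: "f (2 ^ k * y) \<le> f y" if y: "y \<ge> x0" for y k
  proof (induction k)
    case (Suc k)
    have "y \<le> 2 ^ k * y" using y x0 by simp
    then have "f (2 * (2 ^ k * y)) \<le> f (2 ^ k * y)" using y by (intro step) linarith
    with Suc show ?case by (simp add: mult_ac)
  qed simp
  have f_le: "f x \<le> c powr gm" if "0 < x" "x \<le> c" for x c
  proof -
    have "f x \<le> c powr gm * 1" unfolding f_def
      using that gp_gm by (intro mult_mono powr_mono2 tail_prob_le_1) (auto simp: tail_prob_nonneg)
    then show ?thesis by simp
  qed
  have "f x \<le> (2 * x0) powr gm" if x: "0 < x" for x
  proof (cases "x \<le> 2 * x0")
    case True then show ?thesis by (intro f_le x)
  next
    case False
    then have "1 \<le> x / x0" using x0 by (simp add: field_simps)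
    then obtain k where k: "2 ^ k \<le> x / x0" "x / x0 < 2 ^ Suc k"
      using dyadic_between by metis
    define y where "y = x / 2 ^ k"
    have "f x = f (2 ^ k * y)" by (simp add: y_def)
    also have "\<dots> \<le> f y" using k x0 by (intro iter) (simp add: y_def field_simps)
    also have "\<dots> \<le> (2 * x0) powr gm"
      using k x0 x by (intro f_le) (auto simp: y_def field_simps)
    finally show ?thesis .
  qed
  then have "\<T> x \<le> (2 * x0) powr gm * x powr (- gm)" if "0 < x" for x
    using that by (simp add: f_def powr_minus field_simps)
  moreover have "0 < (2 * x0) powr gm" using x0 by simp
  ultimately show ?thesis using that by blast
qed

text \<open>The mean is the sum of the tails, dominated by a multiple of
  \<open>real k powr (- gm)\<close> with \<open>gm > 1\<close>.\<close>

lemma integrable_degree: "integrable (measure_pmf p) real"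
proof -
  obtain C where C: "0 < C" "\<And>x. 0 < x \<Longrightarrow> \<T> x \<le> C * x powr (- gm)"
    using tail_upper_bound by blast
  have "summable (\<lambda>k. real k powr (- gm))"
    using gp_gm by (subst summable_real_powr_iff) auto
  then have "summable (\<lambda>k. C * real (Suc k) powr (- gm))"
    by (subst (asm) summable_Suc_iff[symmetric]) (rule summable_mult)
  then have "summable (\<lambda>k. \<T> (real (Suc k)))"
    by (rule summable_comparison_test'[where N=0]) (use C in \<open>auto simp: tail_prob_nonneg\<close>)
  then have s: "summable (\<lambda>k. \<T> (real k))" by (subst (asm) summable_Suc_iff)
  have "(\<integral>\<^sup>+k. of_nat k \<partial>measure_pmf p) = (\<Sum>t. emeasure (measure_pmf p) {k. t < k})"
    by (subst nn_integral_nat_function) auto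
  also have "\<dots> = (\<Sum>t. ennreal (\<T> (real t)))"
    by (simp add: tail_prob_def measure_pmf.emeasure_eq_measure)
  also have "\<dots> < \<infinity>"
    using s by (subst suminf_ennreal2) (auto simp: tail_prob_nonneg)
  finally show ?thesis
    by (intro integrableI_bounded) (auto simp: ennreal_of_nat_eq_real_of_nat)
qed

text \<open>By the power bound with \<open>gm > 1\<close>, the tail at \<open>e / 2 * t\<close>
  falls below \<open>1 / t\<close> eventually, so the quantile lies below that point. The factor 1/2
  yields the strict inequality.\<close>

lemma quantile_over_id: "((\<lambda>t. \<a> t / t) \<longlongrightarrow> 0) at_top"
proof (rule order_tendstoI)
  fix e :: real assume "e < 0"
  then show "\<forall>\<^sub>F t in at_top. e < \<a> t / t"
    by (intro eventually_mono[OF eventually_gt_at_top[of 0]]) 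
      (meson divide_nonneg_pos less_le_trans tail_quantile_nonneg)
next
  fix e :: real assume e: "0 < e"
  obtain C where C: "0 < C" "\<And>x. 0 < x \<Longrightarrow> \<T> x \<le> C * x powr (- gm)"
    using tail_upper_bound by blast
  have "((\<lambda>t. C * (e / 2) powr (- gm) * t powr (1 - gm)) \<longlongrightarrow> C * (e / 2) powr (- gm) * 0) at_top"
    using gp_gm by (intro tendsto_mult tendsto_const tendsto_neg_powr filterlim_ident) auto
  then have "\<forall>\<^sub>F t in at_top. C * (e / 2) powr (- gm) * t powr (1 - gm) < 1"
    by (intro order_tendstoD) auto
  then show "\<forall>\<^sub>F t in at_top. \<a> t / t < e"
    using eventually_gt_at_top[of 0]
  proof eventually_elim
    case (elim t)
    have "t * \<T> (e / 2 * t) \<le> t * (C * (e / 2 * t) powr (- gm))"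
      using C(2)[of "e / 2 * t"] elim e by (intro mult_left_mono) auto
    also have "\<dots> = C * (e / 2) powr (- gm) * t powr (1 - gm)"
      using elim e powr_mult[of "e / 2" t "- gm"] by (simp add: powr_diff powr_minus field_simps)
    finally have "\<T> (e / 2 * t) \<le> 1 / t" using elim by (simp add: field_simps)
    then have "\<a> t \<le> e / 2 * t" using elim e by (subst tail_quantile_le_iff) auto
    also have "\<dots> < e * t" using elim e by simp
    finally show ?case using elim by (simp add: field_simps)
  qed
qed

text \<open>The Potter bound between the fixed point \<open>x0\<close> and \<open>\<a> t\<close>,
  where the tail is at most \<open>1 / t\<close>.\<close>

lemma id_le_quantile_power:
  obtains C t0 where "0 < C" "1 \<le> t0" "\<And>t. t0 \<le> t \<Longrightarrow> t \<le> C * \<a> t powr gp"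
proof -
  obtain x0 where x0: "1 \<le> x0" "\<And>x y. x0 \<le> y \<Longrightarrow> y \<le> x \<Longrightarrow> \<T> y \<le> 2 powr gp * (x / y) powr gp * \<T> x"
    using potter_bound by blast
  have "\<forall>\<^sub>F t in at_top. x0 \<le> \<a> t"
    using quantile_at_top by (simp add: filterlim_at_top)
  then obtain t1 where t1: "\<And>t. t1 \<le> t \<Longrightarrow> x0 \<le> \<a> t" by (auto simp: eventually_at_top_linorder)
  define C where "C = 2 powr gp / x0 powr gp / \<T> x0"
  have C0: "0 < C" using x0 tail_pos by (simp add: C_def)
  have "t \<le> C * \<a> t powr gp" if t: "max 1 t1 \<le> t" for t
  proof -
    have a: "x0 \<le> \<a> t" using t1 t by simp
    have "\<T> x0 \<le> 2 powr gp * (\<a> t / x0) powr gp * \<T> (\<a> t)" using x0(2)[OF order_refl a] .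
    also have "\<dots> \<le> 2 powr gp * (\<a> t / x0) powr gp * (1 / t)"
      using t by (intro mult_left_mono tail_prob_quantile_le) auto
    also have "\<dots> = 2 powr gp / x0 powr gp * \<a> t powr gp / t"
      using a x0 by (simp add: powr_divide)
    finally have "t * \<T> x0 \<le> 2 powr gp / x0 powr gp * \<a> t powr gp"
      using t by (subst (asm) pos_le_divide_eq) (auto simp: mult.commute)
    then have "t \<le> 2 powr gp / x0 powr gp * \<a> t powr gp / \<T> x0"
      using tail_pos[of x0] by (subst pos_le_divide_eq) auto
    then show ?thesis by (simp add: C_def field_simps)
  qed
  then show ?thesis using that[of C "max 1 t1"] C0 by auto
qed

text \<open>Since \<open>gp < 2\<close>, the previous bound leaves a positive power
  \<open>2 - gp\<close> of the quantile.\<close>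

lemma quantile_sq_over_id: "filterlim (\<lambda>t. (\<a> t)\<^sup>2 / t) at_top at_top"
proof -
  obtain C t0 where C: "0 < C" "1 \<le> t0" "\<And>t. t0 \<le> t \<Longrightarrow> t \<le> C * \<a> t powr gp"
    using id_le_quantile_power by blast
  have "filterlim (\<lambda>t. 1 / C * \<a> t powr (2 - gp)) at_top at_top"
    using gp_gm C quantile_at_top
    by (intro filterlim_tendsto_pos_mult_at_top[OF tendsto_const] filterlim_compose[OF real_powr_at_top quantile_at_top]) auto
  moreover have "\<forall>\<^sub>F t in at_top. 0 < \<a> t"
    using quantile_at_top by (simp add: filterlim_at_top_dense)
  then have "\<forall>\<^sub>F t in at_top. 1 / C * \<a> t powr (2 - gp) \<le> (\<a> t)\<^sup>2 / t"
    using eventually_ge_at_top[of t0]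
  proof eventually_elim
    case (elim t)
    have "t > 0" using elim C by simp
    have "1 / C * \<a> t powr (2 - gp) * t \<le> 1 / C * \<a> t powr (2 - gp) * (C * \<a> t powr gp)"
      using C elim by (intro mult_left_mono) auto
    also have "\<dots> = (\<a> t)\<^sup>2" using C elim by (simp add: powr_add[symmetric])
    finally show ?case using \<open>t > 0\<close> by (simp add: field_simps)
  qed
  ultimately show ?thesis by (rule filterlim_at_top_mono)
qed

text \<open>The majorant near 0 for dominated convergence. The Potter bound applies only while
  \<open>\<a> t * y\<close> is at least \<open>x0\<close>; below that the tail is bounded by 1, and
  \<open>t\<close> itself by a power of \<open>\<a> t < x0 / y\<close>.\<close>

lemma tail_scaled_bound:
  obtains C t0 where "0 < C" "1 \<le> t0"
    "\<And>t y. t0 \<le> t \<Longrightarrow> 0 < y \<Longrightarrow> y \<le> 1 \<Longrightarrow> t * \<T> (\<a> t * y) \<le> C * y powr (- gp)"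
proof -
  obtain x0 where x0: "1 \<le> x0" "\<And>x y. x0 \<le> y \<Longrightarrow> y \<le> x \<Longrightarrow> \<T> y \<le> 2 powr gp * (x / y) powr gp * \<T> x"
    using potter_bound by blast
  obtain C1 t1 where C1: "0 < C1" "1 \<le> t1" "\<And>t. t1 \<le> t \<Longrightarrow> t \<le> C1 * \<a> t powr gp"
    using id_le_quantile_power by blast
  define C where "C = max (2 powr gp) (C1 * x0 powr gp)"
  have "t * \<T> (\<a> t * y) \<le> C * y powr (- gp)" if t: "t1 \<le> t" and y: "0 < y" "y \<le> 1" for t y
  proof (cases "x0 \<le> \<a> t * y")
    case True
    have t0: "0 < t" using t C1 by simp
    have "\<a> t * y \<le> \<a> t * 1" using y by (intro mult_left_mono tail_quantile_nonneg)
    then have "\<T> (\<a> t * y) \<le> 2 powr gp * (\<a> t / (\<a> t * y)) powr gp * \<T> (\<a> t)"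
      using x0(2)[OF True, of "\<a> t"] by (metis mult.right_neutral)
    also have "\<a> t / (\<a> t * y) = 1 / y" using True x0 by auto
    also have "2 powr gp * (1 / y) powr gp * \<T> (\<a> t) \<le> 2 powr gp * (1 / y) powr gp * (1 / t)"
      using t0 by (intro mult_left_mono tail_prob_quantile_le) auto
    finally have "t * \<T> (\<a> t * y) \<le> 2 powr gp * (1 / y) powr gp" using t0 by (simp add: field_simps)
    also have "\<dots> = 2 powr gp * y powr (- gp)" using y by (simp add: powr_divide powr_minus field_simps)
    also have "\<dots> \<le> C * y powr (- gp)" by (intro mult_right_mono) (auto simp: C_def)
    finally show ?thesis .
  next
    case False
    have t0: "0 < t" using t C1 by simp
    have "t * \<T> (\<a> t * y) \<le> t * 1" using t0 by (intro mult_left_mono tail_prob_le_1) auto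
    also have "\<dots> \<le> C1 * \<a> t powr gp" using C1 t by simp
    also have "\<dots> \<le> C1 * (x0 / y) powr gp"
      using False y C1 gp_gm tail_quantile_nonneg by (intro mult_left_mono powr_mono2) (auto simp: field_simps)
    also have "\<dots> = C1 * x0 powr gp * y powr (- gp)" using y x0 by (simp add: powr_divide powr_minus field_simps)
    also have "\<dots> \<le> C * y powr (- gp)" by (intro mult_right_mono) (auto simp: C_def)
    finally show ?thesis .
  qed
  moreover have "0 < C" by (simp add: C_def less_max_iff_disj)
  ultimately show ?thesis using that C1(2) by blast
qed

end

section \<open>The Poisson points\<close>

abbreviation exp1 :: "real measure" where
  "exp1 \<equiv> density lborel (exponential_density 1)"

lemma prob_space_exp1: "prob_space exp1"
  by (rule prob_space_exponential_density) simp

interpretation exp_seq: sequence_space exp1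
  using prob_space_exp1 
  by (simp add: sequence_space_def product_prob_space_def product_sigma_finite_def
      product_prob_space_axioms_def prob_space_imp_sigma_finite)

lemma exp_seq_space_eq: "exp_seq_space = PiM UNIV (\<lambda>_. exp1)"
  by (simp add: exp_seq_space_def)

lemma prob_space_exp_seq: "prob_space exp_seq_space"
  unfolding exp_seq_space_eq by (rule exp_seq.prob_space_axioms)

lemma sets_exp_seq [measurable_cong]: "sets exp_seq_space = sets (PiM UNIV (\<lambda>_. borel))"
  unfolding exp_seq_space_eq by (intro sets_PiM_cong) auto

lemma measurable_Gamma_seq [measurable]: "(\<lambda>\<omega>. Gamma_seq \<omega> i) \<in> borel_measurable exp_seq_space"
  unfolding Gamma_seq_def by measurable

lemma nn_integral_exp1:
  assumes [measurable]: "f \<in> borel_measurable borel"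
  shows "(\<integral>\<^sup>+x. f x \<partial>exp1) = (\<integral>\<^sup>+x\<in>{0<..}. ennreal (exp (- x)) * f x \<partial>lborel)"
proof -
  have "(\<integral>\<^sup>+x. f x \<partial>exp1) = (\<integral>\<^sup>+x. ennreal (exponential_density 1 x) * f x \<partial>lborel)"
    by (subst nn_integral_density) auto
  also have "\<dots> = (\<integral>\<^sup>+x\<in>{0<..}. ennreal (exp (- x)) * f x \<partial>lborel)"
    by (intro nn_integral_cong_AE eventually_mono[OF AE_lborel_singleton[of 0]])
      (auto simp: exponential_density_def indicator_def)
  finally show ?thesis .
qed

lemma AE_exp1_pos: "AE x in exp1. 0 < x"
proof -
  have "AE x in lborel. 0 < exponential_density 1 x \<longrightarrow> 0 < (x::real)"
    using AE_lborel_singleton[of 0] by eventually_elim (auto simp: exponential_density_def split: if_splits)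
  then show ?thesis by (subst AE_density) auto
qed

lemma AE_exp_seq_pos: "AE \<omega> in exp_seq_space. \<forall>i. 0 < \<omega> i"
  unfolding AE_all_countable exp_seq_space_eq
  using AE_PiM_component[of UNIV "\<lambda>_. exp1" _ "\<lambda>x. 0 < x"] prob_space_exp1 AE_exp1_pos by auto

lemma AE_Gamma_seq_pos: "AE \<omega> in exp_seq_space. \<forall>i. 0 < Gamma_seq \<omega> i"
  using AE_exp_seq_pos by eventually_elim (auto simp: Gamma_seq_def intro!: sum_pos)

text \<open>Conditioning on the first waiting time: the remaining sequence has the original law.
  Together with \<open>Gamma_seq_case_nat\<close> this makes induction on the index of a point
  possible.\<close>

lemma nn_integral_exp_seq_iter:
  assumes f [measurable]: "f \<in> borel_measurable exp_seq_space"
  shows "(\<integral>\<^sup>+\<omega>. f \<omega> \<partial>exp_seq_space) = (\<integral>\<^sup>+x. (\<integral>\<^sup>+\<omega>. f (case_nat x \<omega>) \<partial>exp_seq_space) \<partial>exp1)"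
proof -
  have [measurable]: "f \<in> borel_measurable (PiM UNIV (\<lambda>_. exp1))"
    using f unfolding exp_seq_space_eq .
  have m: "(\<lambda>(x, \<omega>). case_nat x \<omega>) \<in> measurable (exp1 \<Otimes>\<^sub>M PiM UNIV (\<lambda>_. exp1)) (PiM UNIV (\<lambda>_. exp1))"
    by measurable
  have "(\<integral>\<^sup>+\<omega>. f \<omega> \<partial>exp_seq_space)
      = (\<integral>\<^sup>+\<omega>. f \<omega> \<partial>distr (exp1 \<Otimes>\<^sub>M PiM UNIV (\<lambda>_. exp1)) (PiM UNIV (\<lambda>_. exp1)) (\<lambda>(x, \<omega>). case_nat x \<omega>))"
    unfolding exp_seq_space_eq exp_seq.PiM_iter ..
  also have "\<dots> = (\<integral>\<^sup>+z. f (case z of (x, \<omega>) \<Rightarrow> case_nat x \<omega>) \<partial>(exp1 \<Otimes>\<^sub>M PiM UNIV (\<lambda>_. exp1)))"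
    by (subst nn_integral_distr[OF m]) auto
  also have "\<dots> = (\<integral>\<^sup>+x. (\<integral>\<^sup>+\<omega>. f (case_nat x \<omega>) \<partial>PiM UNIV (\<lambda>_. exp1)) \<partial>exp1)"
    by (subst exp_seq.nn_integral_fst[symmetric]) (use m in \<open>auto simp: split_beta'\<close>)
  finally show ?thesis unfolding exp_seq_space_eq .
qed

lemma Gamma_seq_case_nat:
  "Gamma_seq (case_nat x \<omega>) 0 = x" "Gamma_seq (case_nat x \<omega>) (Suc i) = x + Gamma_seq \<omega> i"
  by (simp_all only: Gamma_seq_def sum.atMost_Suc_shift) simp_all

lemma nn_integral_exp_minus: "(\<integral>\<^sup>+x. ennreal (exp (- x)) \<partial>exp1) = ennreal (1 / 2)"
proof -
  have "(\<integral>\<^sup>+x. ennreal (exp (- x)) \<partial>exp1) = (\<integral>\<^sup>+x\<in>{0<..}. ennreal (exp (- x)) * ennreal (exp (- x)) \<partial>lborel)"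
    by (rule nn_integral_exp1) auto
  also have "\<dots> = (\<integral>\<^sup>+x. ennreal (exp (- 2 * x)) * indicator {0..} x \<partial>lborel)"
    by (intro nn_integral_cong_AE eventually_mono[OF AE_lborel_singleton[of 0]])
      (auto simp: indicator_def ennreal_mult[symmetric] exp_add[symmetric])
  also have "\<dots> = ennreal (0 - (- exp (- 2 * 0) / 2))"
  proof (rule nn_integral_FTC_atLeast)
    have "filterlim (\<lambda>x::real. - (2 * x)) at_bot at_top"
      by (intro filterlim_compose[OF filterlim_uminus_at_bot_at_top]
          filterlim_tendsto_pos_mult_at_top[OF tendsto_const _ filterlim_ident]) auto
    from tendsto_divide[OF tendsto_minus[OF filterlim_compose[OF exp_at_bot this]] tendsto_const, of 2]
    show "((\<lambda>x::real. - exp (- 2 * x) / 2) \<longlongrightarrow> 0) at_top" by simp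
  qed (auto intro!: derivative_eq_intros)
  finally show ?thesis by simp
qed

lemma nn_integral_exp_minus_Gamma:
  "(\<integral>\<^sup>+\<omega>. ennreal (exp (- Gamma_seq \<omega> m)) \<partial>exp_seq_space) = ennreal ((1 / 2) ^ Suc m)"
proof (induction m)
  case 0
  have "(\<integral>\<^sup>+\<omega>. ennreal (exp (- Gamma_seq \<omega> 0)) \<partial>exp_seq_space)
      = (\<integral>\<^sup>+x. (\<integral>\<^sup>+\<omega>. ennreal (exp (- x)) \<partial>exp_seq_space) \<partial>exp1)"
    by (subst nn_integral_exp_seq_iter) (auto simp: Gamma_seq_case_nat)
  also have "\<dots> = (\<integral>\<^sup>+x. ennreal (exp (- x)) \<partial>exp1)"
    by (simp add: prob_space.emeasure_space_1[OF prob_space_exp_seq])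
  finally show ?case by (simp add: nn_integral_exp_minus)
next
  case (Suc m)
  have "(\<integral>\<^sup>+\<omega>. ennreal (exp (- Gamma_seq \<omega> (Suc m))) \<partial>exp_seq_space)
      = (\<integral>\<^sup>+x. (\<integral>\<^sup>+\<omega>. ennreal (exp (- x)) * ennreal (exp (- Gamma_seq \<omega> m)) \<partial>exp_seq_space) \<partial>exp1)"
    by (subst nn_integral_exp_seq_iter) (auto simp: Gamma_seq_case_nat ennreal_mult[symmetric] exp_add[symmetric])
  also have "\<dots> = (\<integral>\<^sup>+x. ennreal (exp (- x)) * ennreal ((1 / 2) ^ Suc m) \<partial>exp1)"
    by (subst nn_integral_cmult) (auto simp: Suc)
  also have "\<dots> = ennreal (1 / 2) * ennreal ((1 / 2) ^ Suc m)"
    by (subst nn_integral_multc) (auto simp: nn_integral_exp_minus)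
  finally show ?case by (subst (asm) ennreal_mult[symmetric]) auto
qed

section \<open>Linear growth of the points and summability of their negative powers\<close>

lemma exp_half_less_2: "exp (1 / 2 :: real) < 2"
proof -
  have "(exp (1 / 2 :: real))\<^sup>2 = exp 1" by (simp add: power2_eq_square exp_add[symmetric])
  also have "\<dots> \<le> 3" by (rule exp_le)
  also have "\<dots> < 2\<^sup>2" by simp
  finally show ?thesis by (rule power_less_imp_less_base) simp
qed

text \<open>Chernoff's bound with exponent \<open>1\<close> followed by Borel--Cantelli.\<close>
lemma AE_Gamma_seq_linear:
  "AE \<omega> in exp_seq_space. \<forall>\<^sub>F m in sequentially. real (Suc m) / 2 < Gamma_seq \<omega> m"
proof -
  define f where "f m \<omega> = ennreal (exp (real (Suc m) / 2 - Gamma_seq \<omega> m))" for m \<omega>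
  have [measurable]: "f m \<in> borel_measurable exp_seq_space" for m
    unfolding f_def by measurable
  have f: "(\<integral>\<^sup>+\<omega>. f m \<omega> \<partial>exp_seq_space) = ennreal ((exp (1 / 2) / 2) ^ Suc m)" for m
  proof -
    have "(\<integral>\<^sup>+\<omega>. f m \<omega> \<partial>exp_seq_space)
        = (\<integral>\<^sup>+\<omega>. ennreal (exp (1 / 2) ^ Suc m) * ennreal (exp (- Gamma_seq \<omega> m)) \<partial>exp_seq_space)"
      unfolding f_def
      by (intro nn_integral_cong) (simp add: ennreal_mult[symmetric] exp_of_nat_mult[symmetric] exp_add[symmetric] del: power_Suc of_nat_Suc)
    also have "\<dots> = ennreal (exp (1 / 2) ^ Suc m) * ennreal ((1 / 2) ^ Suc m)"
      by (subst nn_integral_cmult) (auto simp: nn_integral_exp_minus_Gamma simp del: power_Suc)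
    finally show ?thesis by (simp add: ennreal_mult[symmetric] power_divide field_simps)
  qed
  have "(\<integral>\<^sup>+\<omega>. (\<Sum>m. f m \<omega>) \<partial>exp_seq_space) = (\<Sum>m. ennreal ((exp (1 / 2) / 2) ^ Suc m))"
    by (subst nn_integral_suminf) (auto simp: f simp del: power_Suc)
  also have "\<dots> = ennreal (\<Sum>m. (exp (1 / 2) / 2) ^ Suc m)"
    using exp_half_less_2 by (intro suminf_ennreal2) (auto simp del: power_Suc simp: summable_Suc_iff summable_geometric)
  finally have "(\<integral>\<^sup>+\<omega>. (\<Sum>m. f m \<omega>) \<partial>exp_seq_space) \<noteq> \<infinity>" by simp
  then have "AE \<omega> in exp_seq_space. (\<Sum>m. f m \<omega>) \<noteq> \<infinity>"
    by (intro nn_integral_PInf_AE) auto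
  then show ?thesis
  proof eventually_elim
    case (elim \<omega>)
    have "summable (\<lambda>m. exp (real (Suc m) / 2 - Gamma_seq \<omega> m))"
      using elim unfolding f_def by (intro summable_suminf_not_top) auto
    then have "(\<lambda>m. exp (real (Suc m) / 2 - Gamma_seq \<omega> m)) \<longlonglongrightarrow> 0"
      by (rule summable_LIMSEQ_zero)
    then have "\<forall>\<^sub>F m in sequentially. exp (real (Suc m) / 2 - Gamma_seq \<omega> m) < 1"
      by (rule order_tendstoD) simp
    then show ?case by eventually_elim simp
  qed
qed

lemma AE_Gamma_seq_at_top: "AE \<omega> in exp_seq_space. filterlim (Gamma_seq \<omega>) at_top sequentially"
  using AE_Gamma_seq_linear
proof eventually_elim
  case (elim \<omega>)
  have "filterlim (\<lambda>m. 1 / 2 * real (Suc m)) at_top sequentially"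
    by (intro filterlim_tendsto_pos_mult_at_top[OF tendsto_const]
        filterlim_compose[OF filterlim_real_sequentially filterlim_Suc]) auto
  then have "filterlim (\<lambda>m. real (Suc m) / 2) at_top sequentially" by simp
  then show ?case by (rule filterlim_at_top_mono) (use elim in \<open>auto elim: eventually_mono\<close>)
qed

lemma AE_summable_Gamma_powr:
  assumes "1 < r"
  shows "AE \<omega> in exp_seq_space. summable (\<lambda>i. Gamma_seq \<omega> i powr (- r))"
  using AE_Gamma_seq_linear
proof eventually_elim
  case (elim \<omega>)
  have "summable (\<lambda>m. real m powr (- r))" using assms by (simp add: summable_real_powr_iff)
  then have "summable (\<lambda>m. real (Suc m) powr (- r))" by (subst summable_Suc_iff)
  then have "summable (\<lambda>m. 2 powr r * real (Suc m) powr (- r))" by (rule summable_mult)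
  then show ?case
  proof (rule summable_comparison_test_ev[rotated])
    show "\<forall>\<^sub>F m in sequentially. norm (Gamma_seq \<omega> m powr (- r)) \<le> 2 powr r * real (Suc m) powr (- r)"
      using elim
    proof eventually_elim
      case (elim m)
      have "Gamma_seq \<omega> m powr (- r) \<le> (real (Suc m) / 2) powr (- r)"
        using elim assms by (intro powr_mono2') auto
      also have "\<dots> = 2 powr r * real (Suc m) powr (- r)"
        by (simp add: powr_divide powr_minus field_simps)
      finally show ?case by simp
    qed
  qed
qed

section \<open>The Laplace functional of the Poisson process\<close>

text \<open>Continuity of \<open>v\<close> is available only at positive arguments: the functions to
  which this is applied jump at 0, where \<open>powr\<close> has the value 0. Hence
  differentiability for positive \<open>s\<close>, but only right continuity at 0.\<close>

lemma tail_integral_properties: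
  fixes v :: "real \<Rightarrow> real"
  assumes v [measurable]: "v \<in> borel_measurable borel" and int: "set_integrable lborel {0<..} v"
    and cont: "\<And>x. 0 < x \<Longrightarrow> isCont v x" and v01: "\<And>x. 0 \<le> v x" "\<And>x. v x \<le> 1"
  defines "R \<equiv> \<lambda>s. LINT x:{s<..}|lborel. v x"
  shows "\<And>s. 0 < s \<Longrightarrow> (R has_real_derivative - v s) (at s)"
    and "\<And>s. 0 \<le> s \<Longrightarrow> (R \<longlongrightarrow> R s) (at_right s)"
    and "(R \<longlongrightarrow> 0) at_top"
    and "\<And>s. 0 \<le> R s"
proof -
  have int': "set_integrable lborel A v" if "A \<subseteq> {0<..}" "A \<in> sets borel" for A
    using int that by (auto intro: set_integrable_subset)
  have split: "R a = R b + (LINT x:{a<..b}|lborel. v x)" if "0 \<le> a" "a \<le> b" for a b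
  proof -
    have "{a<..} = {a<..b} \<union> {b<..}" using that by auto
    then have "R a = (LINT x:{a<..b} \<union> {b<..}|lborel. v x)" by (simp add: R_def)
    also have "\<dots> = (LINT x:{a<..b}|lborel. v x) + R b" unfolding R_def
      using that by (intro set_integral_Un int') auto
    finally show ?thesis by simp
  qed
  have nn: "0 \<le> (LINT x:A|lborel. v x)" for A
    unfolding set_lebesgue_integral_def using v01 by (intro Bochner_Integration.integral_nonneg) auto
  show "0 \<le> R s" for s by (simp add: R_def nn)
  have le: "(LINT x:{a<..b}|lborel. v x) \<le> b - a" if "0 \<le> a" "a \<le> b" for a b
  proof -
    have "set_integrable lborel {a<..b} (\<lambda>_. 1 :: real)"
      unfolding set_integrable_def by (auto intro!: integrable_real_indicator simp: emeasure_lborel_Ioc that)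
    then have "(LINT x:{a<..b}|lborel. v x) \<le> (LINT x:{a<..b}|lborel. 1)"
      using that v01 by (intro set_integral_mono int') auto
    also have "\<dots> = b - a" using that by (simp add: set_lebesgue_integral_def)
    finally show ?thesis .
  qed
  show "(R \<longlongrightarrow> R s) (at_right s)" if "0 \<le> s" for s
  proof (rule tendsto_sandwich[where f="\<lambda>x. R s - (x - s)" and h="\<lambda>x. R s"])
    show "\<forall>\<^sub>F x in at_right s. R s - (x - s) \<le> R x"
    proof (rule eventually_mono[OF eventually_at_right_less[of s]])
      fix x assume "s < x"
      then show "R s - (x - s) \<le> R x" using split[of s x] le[of s x] that by linarith
    qed
    show "\<forall>\<^sub>F x in at_right s. R x \<le> R s"
    proof (rule eventually_mono[OF eventually_at_right_less[of s]])
      fix x assume "s < x"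
      then show "R x \<le> R s" using split[of s x] nn[of "{s<..x}"] that by linarith
    qed
    show "((\<lambda>x. R s - (x - s)) \<longlongrightarrow> R s) (at_right s)"
      by (rule tendsto_eq_intros refl | simp)+
  qed simp
  show "(R has_real_derivative - v s) (at s)" if s: "0 < s" for s
  proof -
    have ev: "\<forall>\<^sub>F u in nhds s. u \<in> {s / 2<..<s + 1}" using s by (intro eventually_nhds_in_open) auto
    have cv: "continuous_on {s / 2..s + 1} v" using s cont by (intro continuous_at_imp_continuous_on) auto
    have "((\<lambda>u. integral {s / 2..u} v) has_real_derivative v s) (at s within {s / 2..s + 1})"
      using s by (intro integral_has_real_derivative cv) auto
    then have "((\<lambda>u. integral {s / 2..u} v) has_real_derivative v s) (at s within {s / 2<..<s + 1})"
      by (rule has_field_derivative_subset) auto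
    then have "((\<lambda>u. integral {s / 2..u} v) has_real_derivative v s) (at s)"
      using s by (subst (asm) at_within_open) auto
    then have "((\<lambda>u. R (s / 2) - integral {s / 2..u} v) has_real_derivative - v s) (at s)"
      by (auto intro!: derivative_eq_intros)
    moreover have "\<forall>\<^sub>F u in nhds s. R u = R (s / 2) - integral {s / 2..u} v"
      using ev
    proof eventually_elim
      case (elim u)
      have "(LINT x:{s / 2<..u}|lborel. v x) = integral {s / 2<..u} v"
        using s by (intro set_borel_integral_eq_integral int') auto
      also have "\<dots> = integral {s / 2..u} v"
        by (rule integral_subset_negligible) (auto intro: negligible_subset[of "{s / 2}"])
      finally show ?case using split[of "s / 2" u] elim s by simp
    qed
    ultimately show ?thesis by (subst DERIV_cong_ev[OF refl _ refl]) auto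
  qed
  have "((\<lambda>s. integral\<^sup>L lborel (\<lambda>x. indicator {s<..} x *\<^sub>R v x)) \<longlongrightarrow> integral\<^sup>L lborel (\<lambda>x::real. 0)) at_top"
  proof (rule integral_dominated_convergence_at_top[where s="\<lambda>s x. indicator {s<..} x *\<^sub>R v x" and f="\<lambda>_. 0" and w="\<lambda>x. indicator {0<..} x *\<^sub>R v x"])
    show "integrable lborel (\<lambda>x. indicator {0<..} x *\<^sub>R v x)" using int by (simp add: set_integrable_def)
    show "\<forall>\<^sub>F s in at_top. AE x in lborel. norm (indicator {s<..} x *\<^sub>R v x) \<le> indicator {0<..} x *\<^sub>R v x"
      using eventually_ge_at_top[of 0] by eventually_elim (auto simp: indicator_def v01)
    show "AE x in lborel. ((\<lambda>s. indicator {s<..} x *\<^sub>R v x) \<longlongrightarrow> 0) at_top"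
    proof (rule AE_I2)
      fix x :: real
      have "\<forall>\<^sub>F s in at_top. indicator {s<..} x *\<^sub>R v x = 0"
        using eventually_ge_at_top[of x] by eventually_elim auto
      then show "((\<lambda>s. indicator {s<..} x *\<^sub>R v x) \<longlongrightarrow> 0) at_top" by (rule tendsto_eventually)
    qed
  qed auto
  then show "(R \<longlongrightarrow> 0) at_top" by (simp add: R_def set_lebesgue_integral_def)
qed

text \<open>The differential equation says that \<open>- exp (- x) * \<Phi> (s + x)\<close> is a
  primitive of the integrand, with boundary values \<open>- \<Phi> s\<close> and 0. In the
  application \<Phi> s is the expected product of \<open>w\<close> over the Poisson points beyond
  \<open>s\<close>, and the identity decomposes it at the first such point.\<close>

lemma survival_fixed_point:
  fixes w \<Phi> :: "real \<Rightarrow> real"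
  assumes cont: "\<And>x. 0 < x \<Longrightarrow> isCont w x" and w01: "\<And>x. 0 \<le> w x"
    and der: "\<And>x. 0 < x \<Longrightarrow> (\<Phi> has_real_derivative (1 - w x) * \<Phi> x) (at x)"
    and rc: "\<And>s. 0 \<le> s \<Longrightarrow> (\<Phi> \<longlongrightarrow> \<Phi> s) (at_right s)" and \<Phi>01: "\<And>x. 0 \<le> \<Phi> x" "\<And>x. \<Phi> x \<le> 1"
    and [measurable]: "w \<in> borel_measurable borel" "\<Phi> \<in> borel_measurable borel"
    and s: "0 \<le> s"
  shows "(\<integral>\<^sup>+x. ennreal (w (s + x) * \<Phi> (s + x)) \<partial>exp1) = ennreal (\<Phi> s)"
proof -
  define f where "f x = exp (- x) * (w (s + x) * \<Phi> (s + x))" for x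
  define F where "F x = - exp (- x) * \<Phi> (s + x)" for x
  have isc: "isCont (\<lambda>x. \<Phi> (s + x)) x" "isCont (\<lambda>x. w (s + x)) x" if "0 < x" for x
    using s that cont[of "s + x"] der[of "s + x", THEN DERIV_isCont]
    by (auto intro!: isCont_o2[where g=\<Phi>] isCont_o2[where g=w])
  have dF: "(F has_real_derivative f x) (at x)" if x: "0 < x" for x
  proof -
    have "((\<lambda>x. \<Phi> (s + x)) has_real_derivative (1 - w (s + x)) * \<Phi> (s + x) * 1) (at x)"
      using s x by (intro DERIV_chain2[OF der]) (auto intro!: derivative_eq_intros)
    then show ?thesis unfolding F_def f_def
      by (auto intro!: derivative_eq_intros simp: algebra_simps)
  qed
  have "((\<lambda>x. \<Phi> (s + x)) \<longlongrightarrow> \<Phi> s) (at_right 0)"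
    using rc[OF s] by (subst (asm) filterlim_at_right_to_0) (simp add: add.commute)
  then have "(F \<longlongrightarrow> - exp (- 0) * \<Phi> s) (at_right 0)"
    unfolding F_def by (intro tendsto_intros)
  then have A: "((F \<circ> real_of_ereal) \<longlongrightarrow> - \<Phi> s) (at_right 0)"
    unfolding zero_ereal_def ereal_tendsto_simps1 by simp
  have "(F \<longlongrightarrow> 0) at_top"
  proof (rule tendsto_sandwich[where f="\<lambda>x. - exp (- x)" and h="\<lambda>x. 0"])
    have e: "((\<lambda>x::real. exp (- x)) \<longlongrightarrow> 0) at_top"
      by (rule filterlim_compose[OF exp_at_bot filterlim_uminus_at_bot_at_top])
    show "((\<lambda>x::real. - exp (- x)) \<longlongrightarrow> 0) at_top" using tendsto_minus[OF e] by simp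
  qed (auto simp: F_def \<Phi>01 mult_le_cancel_left1)
  then have B: "((F \<circ> real_of_ereal) \<longlongrightarrow> 0) (at_left \<infinity>)"
    unfolding ereal_tendsto_simps1 by simp
  have fnn: "0 \<le> f x" for x by (simp add: f_def w01 \<Phi>01)
  have "set_integrable lborel (einterval 0 \<infinity>) f" "(LBINT x=0..\<infinity>. f x) = 0 - (- \<Phi> s)"
    by (rule interval_integral_FTC_nonneg[OF _ dF _ _ A B]; use isc in \<open>auto simp: f_def w01 \<Phi>01 intro!: continuous_intros\<close>)+
  then have int: "set_integrable lborel {0<..} f" "(LINT x:{0<..}|lborel. f x) = \<Phi> s"
    by (auto simp: interval_lebesgue_integral_0_infty(2)) (simp add: zero_ereal_def)
  have "(\<integral>\<^sup>+x. ennreal (w (s + x) * \<Phi> (s + x)) \<partial>exp1)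
      = (\<integral>\<^sup>+x\<in>{0<..}. ennreal (exp (- x)) * ennreal (w (s + x) * \<Phi> (s + x)) \<partial>lborel)"
    by (rule nn_integral_exp1) auto
  also have "\<dots> = (\<integral>\<^sup>+x. ennreal (indicator {0<..} x *\<^sub>R f x) \<partial>lborel)"
    by (intro nn_integral_cong) (auto simp: f_def indicator_def ennreal_mult w01 \<Phi>01)
  also have "\<dots> = ennreal (\<Phi> s)"
    using int fnn unfolding set_integrable_def set_lebesgue_integral_def
    by (subst nn_integral_eq_integral) auto
  finally show ?thesis .
qed

text \<open>The fixed-point equation is applied once per point. The level \<open>s\<close> has to be
  arbitrary because the first waiting time shifts all later points.\<close>

lemma Gamma_product_identity:
  fixes w \<Phi> :: "real \<Rightarrow> real"
  assumes w01: "\<And>x. 0 \<le> w x" and \<Phi>01: "\<And>x. 0 \<le> \<Phi> x"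
    and [measurable]: "w \<in> borel_measurable borel" "\<Phi> \<in> borel_measurable borel"
    and fp: "\<And>s. 0 \<le> s \<Longrightarrow> (\<integral>\<^sup>+x. ennreal (w (s + x) * \<Phi> (s + x)) \<partial>exp1) = ennreal (\<Phi> s)"
    and s: "0 \<le> s"
  shows "(\<integral>\<^sup>+\<omega>. ennreal ((\<Prod>i\<le>m. w (s + Gamma_seq \<omega> i)) * \<Phi> (s + Gamma_seq \<omega> m)) \<partial>exp_seq_space)
      = ennreal (\<Phi> s)"
  using s
proof (induction m arbitrary: s)
  case 0
  have "(\<integral>\<^sup>+\<omega>. ennreal ((\<Prod>i\<le>0. w (s + Gamma_seq \<omega> i)) * \<Phi> (s + Gamma_seq \<omega> 0)) \<partial>exp_seq_space)
      = (\<integral>\<^sup>+x. (\<integral>\<^sup>+\<omega>. ennreal (w (s + x) * \<Phi> (s + x)) \<partial>exp_seq_space) \<partial>exp1)"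
    by (subst nn_integral_exp_seq_iter) (auto simp: Gamma_seq_case_nat)
  also have "\<dots> = ennreal (\<Phi> s)"
    using fp[OF 0] by (simp add: prob_space.emeasure_space_1[OF prob_space_exp_seq])
  finally show ?case .
next
  case (Suc m)
  have "(\<integral>\<^sup>+\<omega>. ennreal ((\<Prod>i\<le>Suc m. w (s + Gamma_seq \<omega> i)) * \<Phi> (s + Gamma_seq \<omega> (Suc m))) \<partial>exp_seq_space)
      = (\<integral>\<^sup>+x. (\<integral>\<^sup>+\<omega>. ennreal ((\<Prod>i\<le>Suc m. w (s + Gamma_seq (case_nat x \<omega>) i))
          * \<Phi> (s + Gamma_seq (case_nat x \<omega>) (Suc m))) \<partial>exp_seq_space) \<partial>exp1)"
    by (rule nn_integral_exp_seq_iter) measurable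
  also have "\<dots> = (\<integral>\<^sup>+x. (\<integral>\<^sup>+\<omega>. ennreal (w (s + x)) *
       ennreal ((\<Prod>i\<le>m. w ((s + x) + Gamma_seq \<omega> i)) * \<Phi> ((s + x) + Gamma_seq \<omega> m)) \<partial>exp_seq_space) \<partial>exp1)"
    by (intro nn_integral_cong, simp only: prod.atMost_Suc_shift Gamma_seq_case_nat)
      (simp add: ennreal_mult[symmetric] w01 \<Phi>01 prod_nonneg add.assoc mult.assoc)
  also have "\<dots> = (\<integral>\<^sup>+x. ennreal (w (s + x)) * (\<integral>\<^sup>+\<omega>.
       ennreal ((\<Prod>i\<le>m. w ((s + x) + Gamma_seq \<omega> i)) * \<Phi> ((s + x) + Gamma_seq \<omega> m)) \<partial>exp_seq_space) \<partial>exp1)"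
    by (intro nn_integral_cong nn_integral_cmult) measurable
  also have "\<dots> = (\<integral>\<^sup>+x. ennreal (w (s + x) * \<Phi> (s + x)) \<partial>exp1)"
    by (intro nn_integral_cong_AE eventually_mono[OF AE_exp1_pos])
      (use Suc in \<open>simp add: ennreal_mult w01 \<Phi>01\<close>)
  also have "\<dots> = ennreal (\<Phi> s)" by (rule fp[OF Suc.prems])
  finally show ?case .
qed

text \<open>The Laplace functional of the Poisson process with points \<open>Gamma_seq\<close>: with
  \<open>\<Phi> s = exp (- \<integral>\<^sub>s\<^sup>\<infinity> (1 - w))\<close>, the expectation of \<open>\<Prod>\<^sub>i\<^sub>\<le>\<^sub>m w (\<Gamma>\<^sub>i) * \<Phi> (\<Gamma>\<^sub>m)\<close> does not depend on \<open>m\<close>.\<close>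
lemma Gamma_product_limit:
  fixes w :: "real \<Rightarrow> real"
  assumes cont: "\<And>x. 0 < x \<Longrightarrow> isCont w x" and w01: "\<And>x. 0 \<le> w x" "\<And>x. w x \<le> 1"
    and w [measurable]: "w \<in> borel_measurable borel"
    and int: "set_integrable lborel {0<..} (\<lambda>x. 1 - w x)"
  shows "(\<lambda>m. \<integral>\<omega>. (\<Prod>i\<le>m. w (Gamma_seq \<omega> i)) \<partial>exp_seq_space)
      \<longlonglongrightarrow> exp (- (LINT x:{0<..}|lborel. 1 - w x))"
proof -
  interpret S: prob_space exp_seq_space by (rule prob_space_exp_seq)
  define R where "R = (\<lambda>s. LINT x:{s<..}|lborel. 1 - w x)"
  define \<Phi> where "\<Phi> s = exp (- R s)" for s
  have isc: "isCont (\<lambda>x. 1 - w x) x" if "0 < x" for x using cont[OF that] by (intro continuous_intros)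
  have "(\<lambda>x. 1 - w x) \<in> borel_measurable borel" by measurable
  note R = tail_integral_properties[OF this int isc]
  have R1: "(R has_real_derivative - (1 - w s)) (at s)" if "0 < s" for s
    using R(1) w01 that by (simp add: R_def)
  have R2: "(R \<longlongrightarrow> R s) (at_right s)" if "0 \<le> s" for s
    using R(2) w01 that by (simp add: R_def)
  have R3: "(R \<longlongrightarrow> 0) at_top" using R(3) w01 by (simp add: R_def)
  have R4: "0 \<le> R s" for s using R(4) w01 by (simp add: R_def)
  have R_m [measurable]: "R \<in> borel_measurable borel"
  proof -
    have "(\<lambda>(s, x). if s < x then 1 - w x else 0) \<in> borel_measurable (borel \<Otimes>\<^sub>M lborel)"
      by measurable
    then have "(\<lambda>s. LINT x|lborel. (if s < x then 1 - w x else 0)) \<in> borel_measurable borel"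
      by (rule lborel.borel_measurable_lebesgue_integral)
    also have "(\<lambda>s. LINT x|lborel. (if s < x then 1 - w x else 0)) = R"
      by (auto simp: R_def set_lebesgue_integral_def intro!: ext Bochner_Integration.integral_cong)
    finally show ?thesis .
  qed
  have [measurable]: "\<Phi> \<in> borel_measurable borel" unfolding \<Phi>_def by measurable
  have \<Phi>01: "0 \<le> \<Phi> s" "\<Phi> s \<le> 1" for s by (auto simp: \<Phi>_def R4)
  have fp: "(\<integral>\<^sup>+x. ennreal (w (s + x) * \<Phi> (s + x)) \<partial>exp1) = ennreal (\<Phi> s)" if "0 \<le> s" for s
  proof (rule survival_fixed_point[OF cont w01(1) _ _ \<Phi>01 w _ that])
    show "(\<Phi> has_real_derivative (1 - w x) * \<Phi> x) (at x)" if "0 < x" for x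
      unfolding \<Phi>_def using R1[OF that] by (auto intro!: derivative_eq_intros)
    show "(\<Phi> \<longlongrightarrow> \<Phi> s) (at_right s)" if "0 \<le> s" for s
      unfolding \<Phi>_def using R2[OF that] by (intro tendsto_intros)
  qed auto
  define W where "W m \<omega> = (\<Prod>i\<le>m. w (Gamma_seq \<omega> i))" for m \<omega>
  have [measurable]: "W m \<in> borel_measurable exp_seq_space" for m unfolding W_def by measurable
  have W01: "0 \<le> W m \<omega>" "W m \<omega> \<le> 1" for m \<omega>
    by (auto simp: W_def w01 intro!: prod_nonneg prod_le_1)
  have intW: "integrable exp_seq_space (W m)" for m
    by (rule S.integrable_const_bound[where B=1]) (auto simp: W01)
  have WPhi: "0 \<le> W m \<omega> * \<Phi> x" "W m \<omega> * \<Phi> x \<le> 1" for m \<omega> x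
    using W01 \<Phi>01 by (auto intro!: mult_le_one)
  have intWP: "integrable exp_seq_space (\<lambda>\<omega>. W m \<omega> * \<Phi> (Gamma_seq \<omega> m))" for m
    by (rule S.integrable_const_bound[where B=1]) (auto simp: WPhi)
  have id: "(\<integral>\<omega>. W m \<omega> * \<Phi> (Gamma_seq \<omega> m) \<partial>exp_seq_space) = \<Phi> 0" for m
  proof -
    have "(\<integral>\<^sup>+\<omega>. ennreal (W m \<omega> * \<Phi> (Gamma_seq \<omega> m)) \<partial>exp_seq_space) = ennreal (\<Phi> 0)"
      using Gamma_product_identity[OF w01(1) \<Phi>01(1) _ _ fp, where s=0 and m=m] by (simp add: W_def)
    then show ?thesis using WPhi \<Phi>01 by (subst integral_eq_nn_integral) auto
  qed
  \<comment> \<open>The points diverge and \<open>R\<close> vanishes at infinity, so \<Phi> at the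
    last point tends to 1. As \<open>W\<close> lies in the unit interval, this quantity bounds the
    error of dropping that factor.\<close>
  have "(\<lambda>m. \<integral>\<omega>. 1 - \<Phi> (Gamma_seq \<omega> m) \<partial>exp_seq_space) \<longlonglongrightarrow> (\<integral>\<omega>. 0 \<partial>exp_seq_space)"
  proof (rule integral_dominated_convergence[where w="\<lambda>_. 1"])
    show "AE \<omega> in exp_seq_space. (\<lambda>m. 1 - \<Phi> (Gamma_seq \<omega> m)) \<longlonglongrightarrow> 0"
      using AE_Gamma_seq_at_top
    proof eventually_elim
      case (elim \<omega>)
      have "((\<lambda>s. 1 - \<Phi> s) \<longlongrightarrow> 1 - exp (- 0)) at_top" unfolding \<Phi>_def by (intro tendsto_intros R3)
      from filterlim_compose[OF this elim] show ?case by simp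
    qed
    show "AE \<omega> in exp_seq_space. norm (1 - \<Phi> (Gamma_seq \<omega> m)) \<le> 1" for m
      using \<Phi>01 by simp
  qed auto
  then have lim0: "(\<lambda>m. \<integral>\<omega>. 1 - \<Phi> (Gamma_seq \<omega> m) \<partial>exp_seq_space) \<longlonglongrightarrow> 0" by simp
  have "(\<lambda>m. (\<integral>\<omega>. W m \<omega> \<partial>exp_seq_space) - \<Phi> 0) \<longlonglongrightarrow> 0"
  proof (rule tendsto_sandwich[OF _ _ tendsto_const lim0])
    have diff: "(\<integral>\<omega>. W m \<omega> \<partial>exp_seq_space) - \<Phi> 0 = (\<integral>\<omega>. W m \<omega> * (1 - \<Phi> (Gamma_seq \<omega> m)) \<partial>exp_seq_space)" for m
      unfolding id[of m, symmetric] using intW intWP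
      by (subst Bochner_Integration.integral_diff[symmetric]) (auto simp: algebra_simps)
    show "\<forall>\<^sub>F m in sequentially. 0 \<le> (\<integral>\<omega>. W m \<omega> \<partial>exp_seq_space) - \<Phi> 0"
      unfolding diff using W01 \<Phi>01 by (intro always_eventually allI Bochner_Integration.integral_nonneg) auto
    show "\<forall>\<^sub>F m in sequentially. (\<integral>\<omega>. W m \<omega> \<partial>exp_seq_space) - \<Phi> 0
        \<le> (\<integral>\<omega>. 1 - \<Phi> (Gamma_seq \<omega> m) \<partial>exp_seq_space)"
      unfolding diff
    proof (intro always_eventually allI integral_mono)
      fix m
      show "integrable exp_seq_space (\<lambda>\<omega>. W m \<omega> * (1 - \<Phi> (Gamma_seq \<omega> m)))"
        using intW intWP by (simp add: algebra_simps)
      show "integrable exp_seq_space (\<lambda>\<omega>. 1 - \<Phi> (Gamma_seq \<omega> m))"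
        by (rule S.integrable_const_bound[where B=1]) (auto simp: \<Phi>01)
      show "W m \<omega> * (1 - \<Phi> (Gamma_seq \<omega> m)) \<le> 1 - \<Phi> (Gamma_seq \<omega> m)" for \<omega>
        using W01 \<Phi>01 by (intro mult_left_le_one_le) auto
    qed
  qed
  then have "(\<lambda>m. \<integral>\<omega>. W m \<omega> \<partial>exp_seq_space) \<longlonglongrightarrow> \<Phi> 0" by (simp add: LIM_zero_iff)
  then show ?thesis by (simp add: W_def \<Phi>_def R_def)
qed

text \<open>For \<open>w = exp (- F)\<close> the products are exponentials of partial sums of the
  two series, so dominated convergence provides a second limit for the sequence in
  \<open>Gamma_product_limit\<close>. Natural \<open>j\<close> and \<open>k\<close> turn the
  transform into mixed moments.\<close>

lemma laplace_stable_S: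
  fixes j k :: nat and \<gamma> :: real
  assumes g: "1 < \<gamma>" "\<gamma> < 2"
  defines "F \<equiv> \<lambda>x. real j * x powr (- 2 / \<gamma>) + real k * x powr (- 3 / \<gamma>)"
  assumes int: "set_integrable lborel {0<..} (\<lambda>x. 1 - exp (- F x))"
  shows "(\<integral>\<omega>. exp (- stable_S \<gamma> 2 \<omega>) ^ j * exp (- stable_S \<gamma> 3 \<omega>) ^ k \<partial>exp_seq_space)
      = exp (- (LINT x:{0<..}|lborel. 1 - exp (- F x)))"
proof -
  interpret S: prob_space exp_seq_space by (rule prob_space_exp_seq)
  have g2: "1 < 2 / \<gamma>" and g3: "1 < 3 / \<gamma>" using g by auto
  have Fnn: "0 \<le> F x" for x by (simp add: F_def)
  have [measurable]: "F \<in> borel_measurable borel" unfolding F_def by measurable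
  have lim1: "(\<lambda>m. \<integral>\<omega>. (\<Prod>i\<le>m. exp (- F (Gamma_seq \<omega> i))) \<partial>exp_seq_space)
      \<longlonglongrightarrow> exp (- (LINT x:{0<..}|lborel. 1 - exp (- F x)))"
  proof (rule Gamma_product_limit)
    show "isCont (\<lambda>x. exp (- F x)) x" if "0 < x" for x
      unfolding F_def using that by (intro continuous_intros) auto
  qed (use int Fnn in auto)
  have lim2: "(\<lambda>m. \<integral>\<omega>. (\<Prod>i\<le>m. exp (- F (Gamma_seq \<omega> i))) \<partial>exp_seq_space)
      \<longlonglongrightarrow> (\<integral>\<omega>. exp (- stable_S \<gamma> 2 \<omega>) ^ j * exp (- stable_S \<gamma> 3 \<omega>) ^ k \<partial>exp_seq_space)"
  proof (rule integral_dominated_convergence[where w="\<lambda>_. 1"])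
    show "(\<lambda>\<omega>. exp (- stable_S \<gamma> 2 \<omega>) ^ j * exp (- stable_S \<gamma> 3 \<omega>) ^ k) \<in> borel_measurable exp_seq_space"
      unfolding stable_S_def by measurable
    show "AE \<omega> in exp_seq_space. (\<lambda>m. \<Prod>i\<le>m. exp (- F (Gamma_seq \<omega> i)))
        \<longlonglongrightarrow> exp (- stable_S \<gamma> 2 \<omega>) ^ j * exp (- stable_S \<gamma> 3 \<omega>) ^ k"
      using AE_summable_Gamma_powr[OF g2] AE_summable_Gamma_powr[OF g3]
    proof (eventually_elim)
      case s: (elim \<omega>)
      have "(\<lambda>i. F (Gamma_seq \<omega> i)) sums (real j * stable_S \<gamma> 2 \<omega> + real k * stable_S \<gamma> 3 \<omega>)"
        unfolding F_def stable_S_def using s by (intro sums_add sums_mult) (auto intro!: summable_sums)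
      then have "(\<lambda>m. \<Sum>i\<le>m. F (Gamma_seq \<omega> i)) \<longlonglongrightarrow> real j * stable_S \<gamma> 2 \<omega> + real k * stable_S \<gamma> 3 \<omega>"
        by (simp add: sums_def_le)
      then have "(\<lambda>m. exp (- (\<Sum>i\<le>m. F (Gamma_seq \<omega> i))))
         \<longlonglongrightarrow> exp (- (real j * stable_S \<gamma> 2 \<omega> + real k * stable_S \<gamma> 3 \<omega>))" by (intro tendsto_intros)
      then show ?case
        by (simp add: exp_sum[symmetric] sum_negf exp_of_nat_mult[symmetric] exp_add[symmetric])
    qed
    show "AE \<omega> in exp_seq_space. norm (\<Prod>i\<le>m. exp (- F (Gamma_seq \<omega> i))) \<le> 1" for m
      using Fnn by (auto simp: abs_prod intro!: prod_le_1)
  qed auto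
  show ?thesis by (rule LIMSEQ_unique[OF lim2 lim1])
qed

section \<open>Laplace transforms of the degree sums\<close>

text \<open>Tonelli's theorem for the region \<open>0 < y < X \<omega>\<close>. The measure is only
  required to be sigma-finite because the lemma serves both the degree distribution and Lebesgue
  measure on the half-line.\<close>

lemma nn_integral_layer_cake:
  fixes X :: "'a \<Rightarrow> real" and g :: "real \<Rightarrow> real"
  assumes "sigma_finite_measure M" and [measurable]: "X \<in> borel_measurable M" "g \<in> borel_measurable borel"
  shows "(\<integral>\<^sup>+\<omega>. (\<integral>\<^sup>+y\<in>{0<..<X \<omega>}. ennreal (g y) \<partial>lborel) \<partial>M)
     = (\<integral>\<^sup>+y\<in>{0<..}. ennreal (g y) * emeasure M {\<omega> \<in> space M. y < X \<omega>} \<partial>lborel)"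
proof -
  interpret sigma_finite_measure M by fact
  interpret pair_sigma_finite M lborel ..
  let ?f = "\<lambda>\<omega> y. if 0 < y \<and> y < X \<omega> then ennreal (g y) else 0"
  have m: "case_prod ?f \<in> borel_measurable (M \<Otimes>\<^sub>M lborel)" by measurable
  have "(\<integral>\<^sup>+\<omega>. (\<integral>\<^sup>+y\<in>{0<..<X \<omega>}. ennreal (g y) \<partial>lborel) \<partial>M) = (\<integral>\<^sup>+\<omega>. (\<integral>\<^sup>+y. ?f \<omega> y \<partial>lborel) \<partial>M)"
    by (intro nn_integral_cong) (auto simp: indicator_def)
  also have "\<dots> = (\<integral>\<^sup>+y. (\<integral>\<^sup>+\<omega>. ?f \<omega> y \<partial>M) \<partial>lborel)"
    by (rule Fubini'[OF m, symmetric])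
  also have "\<dots> = (\<integral>\<^sup>+y\<in>{0<..}. ennreal (g y) * emeasure M {\<omega> \<in> space M. y < X \<omega>} \<partial>lborel)"
  proof (intro nn_integral_cong)
    fix y :: real
    have "(\<integral>\<^sup>+\<omega>. ?f \<omega> y \<partial>M)
        = (\<integral>\<^sup>+\<omega>. (ennreal (g y) * indicator {0<..} y) * indicator {\<omega> \<in> space M. y < X \<omega>} \<omega> \<partial>M)"
      by (intro nn_integral_cong) (auto simp: indicator_def)
    also have "\<dots> = (ennreal (g y) * indicator {0<..} y) * emeasure M {\<omega> \<in> space M. y < X \<omega>}"
      by (subst nn_integral_cmult_indicator) auto
    finally show "(\<integral>\<^sup>+\<omega>. ?f \<omega> y \<partial>M)
        = ennreal (g y) * emeasure M {\<omega> \<in> space M. y < X \<omega>} * indicator {0<..} y"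
      by (simp add: mult_ac)
  qed
  finally show ?thesis .
qed

text \<open>For numbers of modulus at most 1 the n-th powers differ by at most n times the
  difference, so replacing \<open>c n\<close> by \<open>I\<close> costs at most
  \<open>\<bar>c n - I\<bar>\<close>.\<close>

lemma tendsto_one_minus_power_exp:
  fixes c :: "nat \<Rightarrow> real"
  assumes c: "c \<longlonglongrightarrow> I" and b: "\<And>n. \<bar>1 - c n / real n\<bar> \<le> 1"
  shows "(\<lambda>n. (1 - c n / real n) ^ n) \<longlonglongrightarrow> exp (- I)"
proof -
  \<comment> \<open>Nonnegativity of the limit places \<open>1 - I / n\<close> in the unit interval
    for large \<open>n\<close>, as the comparison of powers demands.\<close>
  have I0: "0 \<le> I"
  proof (rule tendsto_lowerbound[OF c])
    show "\<forall>\<^sub>F n in sequentially. 0 \<le> c n"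
      using eventually_gt_at_top[of 0]
    proof eventually_elim
      case (elim n)
      then have "c n / real n \<ge> 0" using b[of n] by linarith
      then show ?case using elim by (simp add: zero_le_divide_iff)
    qed
  qed simp
  have lim: "(\<lambda>n. (1 + (- I) / real n) ^ n) \<longlonglongrightarrow> exp (- I)" by (rule tendsto_exp_limit_sequentially)
  have "(\<lambda>n. (1 - c n / real n) ^ n - (1 + (- I) / real n) ^ n) \<longlonglongrightarrow> 0"
  proof (rule Lim_null_comparison)
    show "\<forall>\<^sub>F n in sequentially. norm ((1 - c n / real n) ^ n - (1 + (- I) / real n) ^ n) \<le> \<bar>c n - I\<bar>"
      using eventually_gt_at_top[of "nat \<lceil>I\<rceil>"]
    proof eventually_elim
      case (elim n)
      then have n: "0 < real n" "I \<le> real n" using I0 by linarith+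
      have "norm ((1 - c n / real n) ^ n - (1 + (- I) / real n) ^ n)
          \<le> real n * norm ((1 - c n / real n) - (1 + (- I) / real n))"
        using b[of n] I0 n by (intro norm_power_diff) (auto simp: abs_le_iff field_simps)
      also have "(1 - c n / real n) - (1 + (- I) / real n) = (I - c n) / real n"
        by (simp add: diff_divide_distrib)
      also have "real n * norm ((I - c n) / real n) = \<bar>c n - I\<bar>"
        using n by (simp add: abs_divide abs_minus_commute)
      finally show ?case .
    qed
    show "(\<lambda>n. \<bar>c n - I\<bar>) \<longlonglongrightarrow> 0"
      using c by (simp add: LIM_zero tendsto_rabs_zero)
  qed
  from tendsto_add[OF this lim] show ?thesis by simp
qed

section \<open>The exponent contributed by a single degree or a single Poisson point\<close>

definition cubic :: "nat \<Rightarrow> nat \<Rightarrow> real \<Rightarrow> real" where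
  "cubic j k x = real j * x ^ 2 + real k * x ^ 3"

text \<open>The derivative of \<open>1 - exp (- cubic j k y)\<close>. Its mass on the positive
  half-line is 1 unless \<open>j\<close> and \<open>k\<close> both vanish, in which case it is 0;
  hence the inequality in \<open>nn_integral_cubic_density_le_1\<close>.\<close>

definition cubic_density :: "nat \<Rightarrow> nat \<Rightarrow> real \<Rightarrow> real" where
  "cubic_density j k y = (2 * real j * y + 3 * real k * y ^ 2) * exp (- cubic j k y)"

lemma measurable_cubic [measurable]: "cubic j k \<in> borel_measurable borel"
  "cubic_density j k \<in> borel_measurable borel"
  unfolding cubic_density_def[abs_def] cubic_def[abs_def] by measurable

lemma cubic_nonneg: "0 \<le> x \<Longrightarrow> 0 \<le> cubic j k x"
  by (simp add: cubic_def)

lemma cubic_density_nonneg: "0 \<le> x \<Longrightarrow> 0 \<le> cubic_density j k x"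
  by (simp add: cubic_density_def)

lemma DERIV_cubic_density:
  "((\<lambda>x. 1 - exp (- cubic j k x)) has_real_derivative cubic_density j k x) (at x)"
  unfolding cubic_def cubic_density_def
  by (auto intro!: derivative_eq_intros simp: algebra_simps)

lemma nn_integral_cubic_density:
  assumes "0 \<le> x"
  shows "(\<integral>\<^sup>+y\<in>{0<..<x}. ennreal (cubic_density j k y) \<partial>lborel) = ennreal (1 - exp (- cubic j k x))"
proof -
  have "(\<integral>\<^sup>+y\<in>{0<..<x}. ennreal (cubic_density j k y) \<partial>lborel)
      = (\<integral>\<^sup>+y. ennreal (cubic_density j k y) * indicator {0..x} y \<partial>lborel)"
  proof (rule nn_integral_cong_AE)
    show "AE y in lborel. ennreal (cubic_density j k y) * indicator {0<..<x} y
        = ennreal (cubic_density j k y) * indicator {0..x} y"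
      using AE_lborel_singleton[of 0] AE_lborel_singleton[of x]
      by eventually_elim (auto simp: indicator_def)
  qed
  also have "\<dots> = ennreal ((1 - exp (- cubic j k x)) - (1 - exp (- cubic j k 0)))"
    using assms by (intro nn_integral_FTC_Icc DERIV_cubic_density cubic_density_nonneg) auto
  finally show ?thesis by (simp add: cubic_def)
qed

lemma nn_integral_cubic_density_le_1:
  "(\<integral>\<^sup>+y\<in>{0<..}. ennreal (cubic_density j k y) \<partial>lborel) \<le> 1"
proof -
  have "(\<integral>\<^sup>+y\<in>{0<..}. ennreal (cubic_density j k y) \<partial>lborel)
     = (SUP n. \<integral>\<^sup>+y\<in>{0<..<real n}. ennreal (cubic_density j k y) \<partial>lborel)"
  proof (subst nn_integral_monotone_convergence_SUP[symmetric])
    show "incseq (\<lambda>i x. ennreal (cubic_density j k x) * indicator {0<..<real i} x)"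
      by (auto simp: incseq_def le_fun_def indicator_def)
    have "(SUP i. ennreal (cubic_density j k x) * indicator {0<..<real i} x)
        = ennreal (cubic_density j k x) * indicator {0<..} x" for x
    proof (rule antisym)
      show "(SUP i. ennreal (cubic_density j k x) * indicator {0<..<real i} x)
          \<le> ennreal (cubic_density j k x) * indicator {0<..} x"
        by (intro SUP_least) (auto simp: indicator_def)
      obtain i where "x < real i" using reals_Archimedean2 by blast
      then show "ennreal (cubic_density j k x) * indicator {0<..} x
          \<le> (SUP i. ennreal (cubic_density j k x) * indicator {0<..<real i} x)"
        by (intro SUP_upper2[of i]) (auto simp: indicator_def)
    qed
    then show "(\<integral>\<^sup>+y\<in>{0<..}. ennreal (cubic_density j k y) \<partial>lborel)
        = (\<integral>\<^sup>+x. (SUP i. ennreal (cubic_density j k x) * indicator {0<..<real i} x) \<partial>lborel)"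
      by simp
  qed auto
  also have "\<dots> \<le> 1"
    by (intro SUP_least) (auto simp: nn_integral_cubic_density ennreal_le_1)
  finally show ?thesis .
qed

lemma nn_integral_powr_0:
  assumes "- 1 < r" "0 \<le> c"
  shows "(\<integral>\<^sup>+y\<in>{0<..<c}. ennreal (y powr r) \<partial>lborel) = ennreal (c powr (r + 1) / (r + 1))"
proof -
  have "(\<integral>\<^sup>+y\<in>{0<..<c}. ennreal (y powr r) \<partial>lborel) = (\<integral>\<^sup>+y. indicator {0..c} y * ennreal (y powr r) \<partial>lborel)"
  proof (rule nn_integral_cong_AE)
    show "AE y in lborel. ennreal (y powr r) * indicator {0<..<c} y = indicator {0..c} y * ennreal (y powr r)"
      using AE_lborel_singleton[of 0] AE_lborel_singleton[of c]
      by eventually_elim (auto simp: indicator_def)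
  qed
  also have "\<dots> = (\<integral>\<^sup>+y. ennreal (indicator {0..c} y * y powr r) \<partial>lborel)"
    by (intro nn_integral_cong) (auto simp: indicator_def)
  also have "\<dots> = ennreal (c powr (r + 1) / (r + 1))"
    using has_integral_powr_from_0[OF assms]
    by (intro nn_integral_has_integral_lebesgue) auto
  finally show ?thesis .
qed

context heavy_tail
begin

lemma nn_integral_cubic_degree:
  assumes a: "0 < a"
  shows "(\<integral>\<^sup>+d. ennreal (1 - exp (- cubic j k (real d / a))) \<partial>measure_pmf p)
     = (\<integral>\<^sup>+y\<in>{0<..}. ennreal (cubic_density j k y * \<T> (a * y)) \<partial>lborel)"
proof -
  have "(\<integral>\<^sup>+d. ennreal (1 - exp (- cubic j k (real d / a))) \<partial>measure_pmf p)
     = (\<integral>\<^sup>+d. (\<integral>\<^sup>+y\<in>{0<..<real d / a}. ennreal (cubic_density j k y) \<partial>lborel) \<partial>measure_pmf p)"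
    using a by (intro nn_integral_cong nn_integral_cubic_density[symmetric]) auto
  also have "\<dots> = (\<integral>\<^sup>+y\<in>{0<..}. ennreal (cubic_density j k y) * emeasure (measure_pmf p) {d. y < real d / a} \<partial>lborel)"
    using nn_integral_layer_cake[of "measure_pmf p" "\<lambda>d. real d / a" "cubic_density j k"]
    by (simp add: measure_pmf.sigma_finite_measure_axioms)
  also have "\<dots> = (\<integral>\<^sup>+y\<in>{0<..}. ennreal (cubic_density j k y * \<T> (a * y)) \<partial>lborel)"
  proof (intro nn_integral_cong)
    fix y :: real
    have "{d. y < real d / a} = {d. a * y < real d}" using a by (auto simp: field_simps)
    then have "emeasure (measure_pmf p) {d. y < real d / a} = ennreal (\<T> (a * y))"
      by (simp add: tail_prob_def measure_pmf.emeasure_eq_measure)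
    then show "ennreal (cubic_density j k y) * emeasure (measure_pmf p) {d. y < real d / a} * indicator {0<..} y
        = ennreal (cubic_density j k y * \<T> (a * y)) * indicator {0<..} y"
      by (auto simp: indicator_def ennreal_mult cubic_density_nonneg tail_prob_nonneg)
  qed
  finally show ?thesis .
qed

text \<open>The layer-cake formula again: the set of \<open>x\<close> with
  \<open>y < x powr (- 1 / \<gamma>)\<close> is an interval of length
  \<open>y powr (- \<gamma>)\<close>. Thus the limit has the form of
  \<open>nn_integral_cubic_degree\<close> with the scaled tail replaced by its limit.\<close>

lemma nn_integral_cubic_limit:
  "(\<integral>\<^sup>+x\<in>{0<..}. ennreal (1 - exp (- cubic j k (x powr (- 1 / \<gamma>)))) \<partial>lborel)
     = (\<integral>\<^sup>+y\<in>{0<..}. ennreal (cubic_density j k y * y powr (- \<gamma>)) \<partial>lborel)"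
proof -
  let ?M = "restrict_space lborel {0::real<..}"
  have g: "0 < \<gamma>" using gamma_gt_1 by simp
  have sf: "sigma_finite_measure ?M"
    by (intro sigma_finite_measure_restrict_space lborel.sigma_finite_measure_axioms) auto
  have "(\<integral>\<^sup>+x\<in>{0<..}. ennreal (1 - exp (- cubic j k (x powr (- 1 / \<gamma>)))) \<partial>lborel)
      = (\<integral>\<^sup>+x. ennreal (1 - exp (- cubic j k (x powr (- 1 / \<gamma>)))) \<partial>?M)"
    by (subst nn_integral_restrict_space) (auto simp: mult.commute)
  also have "\<dots> = (\<integral>\<^sup>+x. (\<integral>\<^sup>+y\<in>{0<..<x powr (- 1 / \<gamma>)}. ennreal (cubic_density j k y) \<partial>lborel) \<partial>?M)"
    by (intro nn_integral_cong nn_integral_cubic_density[symmetric]) auto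
  also have "\<dots> = (\<integral>\<^sup>+y\<in>{0<..}. ennreal (cubic_density j k y) * emeasure ?M {x \<in> space ?M. y < x powr (- 1 / \<gamma>)} \<partial>lborel)"
    by (intro nn_integral_layer_cake sf measurable_restrict_space1) auto
  also have "\<dots> = (\<integral>\<^sup>+y\<in>{0<..}. ennreal (cubic_density j k y * y powr (- \<gamma>)) \<partial>lborel)"
  proof (intro nn_integral_cong)
    fix y :: real
    show "ennreal (cubic_density j k y) * emeasure ?M {x \<in> space ?M. y < x powr (- 1 / \<gamma>)} * indicator {0<..} y
        = ennreal (cubic_density j k y * y powr (- \<gamma>)) * indicator {0<..} y"
    proof (cases "0 < y")
      case True
      have "y < x powr (- 1 / \<gamma>) \<longleftrightarrow> x < y powr (- \<gamma>)" if "0 < x" for x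
      proof -
        have "y < x powr (- 1 / \<gamma>) \<longleftrightarrow> ln y < - 1 / \<gamma> * ln x"
          using True that by (subst ln_less_cancel_iff[symmetric]) (auto simp: ln_powr)
        also have "\<dots> \<longleftrightarrow> ln x < - \<gamma> * ln y" using g by (auto simp: field_simps)
        also have "\<dots> \<longleftrightarrow> x < y powr (- \<gamma>)"
          using True that by (subst (2) ln_less_cancel_iff[symmetric]) (auto simp: ln_powr)
        finally show ?thesis .
      qed
      then have "{x \<in> space ?M. y < x powr (- 1 / \<gamma>)} = {0<..<y powr (- \<gamma>)}"
        by (auto simp: space_restrict_space)
      then have "emeasure ?M {x \<in> space ?M. y < x powr (- 1 / \<gamma>)} = ennreal (y powr (- \<gamma>))"
        by (subst emeasure_restrict_space) auto
      then show ?thesis using True by (simp add: ennreal_mult cubic_density_nonneg)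
    qed auto
  qed
  finally show ?thesis .
qed

lemma quantile_eventually_pos: "\<forall>\<^sub>F n in sequentially. 0 < \<a> (real n)"
  using filterlim_compose[OF quantile_at_top filterlim_real_sequentially]
  by (simp add: filterlim_at_top_dense)

text \<open>The density is O(y) near 0, so the singular part of the majorant is
  O(\<open>y powr (1 - gp)\<close>), which is integrable because \<open>gp < 2\<close>.\<close>

lemma cubic_density_dominating_finite:
  "(\<integral>\<^sup>+y\<in>{0<..}. ennreal (cubic_density j k y) * (1 + ennreal (C * y powr (- gp)) * indicator {..1} y) \<partial>lborel) < \<infinity>"
proof -
  \<comment> \<open>The interval ending at 2 covers the range \<open>y \<le> 1\<close> and is open
    on both sides, as in \<open>nn_integral_powr_0\<close>.\<close>
  have "(\<integral>\<^sup>+y\<in>{0<..}. ennreal (cubic_density j k y) * (1 + ennreal (C * y powr (- gp)) * indicator {..1} y) \<partial>lborel)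
     \<le> (\<integral>\<^sup>+y. ennreal (cubic_density j k y) * indicator {0<..} y + 
          ennreal ((2 * real j + 3 * real k) * \<bar>C\<bar>) * (ennreal (y powr (1 - gp)) * indicator {0<..<2} y) \<partial>lborel)"
  proof (rule nn_integral_mono)
    fix y :: real
    have "ennreal (cubic_density j k y) * ennreal (C * y powr (- gp))
        \<le> ennreal ((2 * real j + 3 * real k) * \<bar>C\<bar>) * ennreal (y powr (1 - gp))" if y: "0 < y" "y \<le> 1"
    proof -
      have "cubic_density j k y \<le> (2 * real j * y + 3 * real k * y ^ 2) * 1"
        unfolding cubic_density_def using y by (intro mult_left_mono) (auto simp: cubic_nonneg)
      also have "\<dots> \<le> (2 * real j * y + 3 * real k * y) * 1"
        using y by (intro mult_right_mono add_left_mono mult_left_mono) (auto simp: power2_eq_square mult_left_le)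
      finally have 1: "cubic_density j k y \<le> (2 * real j + 3 * real k) * y" by (simp add: algebra_simps)
      have "cubic_density j k y * (C * y powr (- gp)) \<le> cubic_density j k y * (\<bar>C\<bar> * y powr (- gp))"
        using y by (intro mult_left_mono mult_right_mono cubic_density_nonneg) auto
      also have "\<dots> \<le> (2 * real j + 3 * real k) * y * (\<bar>C\<bar> * y powr (- gp))"
        by (intro mult_right_mono 1) auto
      also have "\<dots> = (2 * real j + 3 * real k) * \<bar>C\<bar> * y powr (1 - gp)"
        using y by (simp add: powr_diff powr_minus field_simps)
      finally show ?thesis
        using y by (simp add: ennreal_mult'[symmetric] ennreal_mult''[symmetric] ennreal_leI cubic_density_nonneg)
    qed
    then show "ennreal (cubic_density j k y) * (1 + ennreal (C * y powr (- gp)) * indicator {..1} y) * indicator {0<..} y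
        \<le> ennreal (cubic_density j k y) * indicator {0<..} y + 
          ennreal ((2 * real j + 3 * real k) * \<bar>C\<bar>) * (ennreal (y powr (1 - gp)) * indicator {0<..<2} y)"
      by (auto simp: indicator_def distrib_left)
  qed
  also have "\<dots> = (\<integral>\<^sup>+y\<in>{0<..}. ennreal (cubic_density j k y) \<partial>lborel) +
      ennreal ((2 * real j + 3 * real k) * \<bar>C\<bar>) * ennreal (2 powr (1 - gp + 1) / (1 - gp + 1))"
    using gp_gm by (subst nn_integral_add) (auto simp: nn_integral_cmult nn_integral_powr_0)
  also have "\<dots> < \<infinity>"
    using nn_integral_cubic_density_le_1[of j k] 
    by (auto simp: less_top[symmetric] top_unique ennreal_mult_eq_top_iff)
  finally show ?thesis .
qed

text \<open>Dominated convergence after the layer-cake formula. For \<open>y \<le> 1\<close> the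
  scaled tail is bounded by \<open>tail_scaled_bound\<close>, for larger \<open>y\<close> by its
  value at the quantile, which is at most 1. The pointwise limit stays below the same majorant, so
  its integral is finite too. The shift by \<open>N\<close> restricts to the indices for which the
  majorant is valid.\<close>

lemma cubic_degree_tendsto:
  "(\<lambda>n. \<integral>\<^sup>+d. ennreal (real n * (1 - exp (- cubic j k (real d / \<a> (real n))))) \<partial>measure_pmf p)
     \<longlonglongrightarrow> (\<integral>\<^sup>+x\<in>{0<..}. ennreal (1 - exp (- cubic j k (x powr (- 1 / \<gamma>)))) \<partial>lborel)" (is "?A \<longlonglongrightarrow> ?B")
  and cubic_limit_finite:
  "(\<integral>\<^sup>+x\<in>{0<..}. ennreal (1 - exp (- cubic j k (x powr (- 1 / \<gamma>)))) \<partial>lborel) < \<infinity>"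
proof -
  obtain C t0 where C: "0 < C" "1 \<le> t0"
    "\<And>t y. t0 \<le> t \<Longrightarrow> 0 < y \<Longrightarrow> y \<le> 1 \<Longrightarrow> t * \<T> (\<a> t * y) \<le> C * y powr (- gp)"
    using tail_scaled_bound by blast
  define w where "w y = ennreal (cubic_density j k y) * (1 + ennreal (C * y powr (- gp)) * indicator {..1} y) * indicator {0<..} y" for y
  define u where "u n y = cubic_density j k y * (real n * \<T> (\<a> (real n) * y))" for n y
  define l where "l y = cubic_density j k y * y powr (- \<gamma>)" for y
  have meas [measurable]: "w \<in> borel_measurable borel" "u n \<in> borel_measurable borel" "l \<in> borel_measurable borel" for n
    unfolding w_def u_def l_def by measurable
  have wfin: "(\<integral>\<^sup>+y. w y \<partial>lborel) < \<infinity>"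
    unfolding w_def by (rule cubic_density_dominating_finite)
  obtain n0 where n0: "\<And>n. n \<ge> n0 \<Longrightarrow> 0 < \<a> (real n)"
    using quantile_eventually_pos by (auto simp: eventually_sequentially)
  define N where "N = max n0 (nat \<lceil>t0\<rceil>)"
  have N: "0 < \<a> (real n)" "t0 \<le> real n" if "n \<ge> N" for n
    using that n0 by (auto simp: N_def)
  have eq: "?A n = (\<integral>\<^sup>+y\<in>{0<..}. ennreal (u n y) \<partial>lborel)" if "n \<ge> N" for n
  proof -
    have "?A n = (\<integral>\<^sup>+d. ennreal (real n) * ennreal (1 - exp (- cubic j k (real d / \<a> (real n)))) \<partial>measure_pmf p)"
      by (intro nn_integral_cong) (simp add: ennreal_mult' tail_quantile_nonneg cubic_nonneg)
    also have "\<dots> = ennreal (real n) * (\<integral>\<^sup>+y\<in>{0<..}. ennreal (cubic_density j k y * \<T> (\<a> (real n) * y)) \<partial>lborel)"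
      by (subst nn_integral_cmult) (auto simp: nn_integral_cubic_degree[OF N(1)[OF that]])
    also have "\<dots> = (\<integral>\<^sup>+y. ennreal (real n) * (ennreal (cubic_density j k y * \<T> (\<a> (real n) * y)) * indicator {0<..} y) \<partial>lborel)"
      by (rule nn_integral_cmult[symmetric]) measurable
    also have "\<dots> = (\<integral>\<^sup>+y\<in>{0<..}. ennreal (u n y) \<partial>lborel)"
    proof (rule nn_integral_cong)
      fix y :: real
      have "ennreal (real n) * ennreal (cubic_density j k y * \<T> (\<a> (real n) * y)) = ennreal (u n y)"
        by (simp add: u_def ennreal_mult'[symmetric] mult.left_commute)
      then show "ennreal (real n) * (ennreal (cubic_density j k y * \<T> (\<a> (real n) * y)) * indicator {0<..} y)
          = ennreal (u n y) * indicator {0<..} y" by (simp only: mult.assoc[symmetric])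
    qed
    finally show ?thesis .
  qed
  have lim_u: "(\<lambda>n. ennreal (u (n + N) y) * indicator {0<..} y) \<longlonglongrightarrow> ennreal (l y) * indicator {0<..} y" for y
  proof (cases "0 < y")
    case True
    have "(\<lambda>n. real n * \<T> (\<a> (real n) * y)) \<longlonglongrightarrow> y powr (- \<gamma>)"
      using filterlim_compose[OF tail_scaled[OF True] filterlim_real_sequentially] .
    then have "(\<lambda>n. u n y) \<longlonglongrightarrow> l y" unfolding u_def l_def by (intro tendsto_mult tendsto_const)
    then have "(\<lambda>n. ennreal (u (n + N) y)) \<longlonglongrightarrow> ennreal (l y)"
      by (intro tendsto_ennrealI LIMSEQ_ignore_initial_segment)
    then show ?thesis using True by simp
  qed simp
  have bnd: "ennreal (u n y) * indicator {0<..} y \<le> w y" if n: "n \<ge> N" for n y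
  proof (cases "0 < y")
    case y: True
    have n1: "0 < real n" using N(2)[OF n] C by simp
    show ?thesis
    proof (cases "y \<le> 1")
      case True
      have "u n y \<le> cubic_density j k y * (C * y powr (- gp))"
        unfolding u_def using y True C N(2)[OF n] by (intro mult_left_mono cubic_density_nonneg C(3)) auto
      then have "ennreal (u n y) \<le> ennreal (cubic_density j k y) * ennreal (C * y powr (- gp))"
        using y C by (subst ennreal_mult[symmetric]) (auto simp: cubic_density_nonneg ennreal_leI)
      also have "\<dots> \<le> ennreal (cubic_density j k y) * (1 + ennreal (C * y powr (- gp)))"
        by (intro mult_left_mono) auto
      finally show ?thesis using y True by (simp add: w_def)
    next
      case False
      have "\<T> (\<a> (real n) * y) \<le> \<T> (\<a> (real n))"
        using False tail_quantile_nonneg[of p "real n"] by (intro tail_prob_antimono) (auto simp: mult_le_cancel_left1)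
      also have "\<dots> \<le> 1 / real n" by (rule tail_prob_quantile_le[OF n1])
      finally have "real n * \<T> (\<a> (real n) * y) \<le> 1" using n1 by (simp add: field_simps)
      then have "u n y \<le> cubic_density j k y * 1"
        unfolding u_def using y by (intro mult_left_mono cubic_density_nonneg) auto
      then show ?thesis using y False by (simp add: w_def ennreal_leI)
    qed
  qed simp
  have lim: "(\<lambda>n. \<integral>\<^sup>+y\<in>{0<..}. ennreal (u (n + N) y) \<partial>lborel) \<longlonglongrightarrow> (\<integral>\<^sup>+y\<in>{0<..}. ennreal (l y) \<partial>lborel)"
  proof (rule nn_integral_dominated_convergence[where w=w])
    show "AE y in lborel. (\<lambda>n. ennreal (u (n + N) y) * indicator {0<..} y) \<longlonglongrightarrow> ennreal (l y) * indicator {0<..} y"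
      by (rule AE_I2) (rule lim_u)
    show "AE y in lborel. ennreal (u (n + N) y) * indicator {0<..} y \<le> w y" for n
      by (rule AE_I2) (rule bnd[OF le_add2])
  qed (use wfin in \<open>simp_all\<close>)
  have "?A \<longlonglongrightarrow> (\<integral>\<^sup>+y\<in>{0<..}. ennreal (l y) \<partial>lborel)"
    by (rule LIMSEQ_offset[where k=N]) (simp only: eq[OF le_add2] lim)
  then show "?A \<longlonglongrightarrow> ?B" by (simp only: nn_integral_cubic_limit l_def)
  have "(\<integral>\<^sup>+y\<in>{0<..}. ennreal (l y) \<partial>lborel) \<le> (\<integral>\<^sup>+y. w y \<partial>lborel)"
  proof (rule nn_integral_mono)
    fix y :: real
    show "ennreal (l y) * indicator {0<..} y \<le> w y"
      by (rule tendsto_upperbound[OF lim_u always_eventually])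
        (auto intro!: bnd simp del: of_nat_add)
  qed
  then show "?B < \<infinity>"
    unfolding nn_integral_cubic_limit l_def using wfin by (rule le_less_trans)
qed

lemma set_integrable_cubic_limit:
  "set_integrable lborel {0<..} (\<lambda>x. 1 - exp (- cubic j k (x powr (- 1 / \<gamma>))))"
  unfolding set_integrable_def
proof (rule integrableI_bounded)
  have "(\<integral>\<^sup>+x. ennreal (norm (indicator {0<..} x *\<^sub>R (1 - exp (- cubic j k (x powr (- 1 / \<gamma>)))))) \<partial>lborel)
     = (\<integral>\<^sup>+x\<in>{0<..}. ennreal (1 - exp (- cubic j k (x powr (- 1 / \<gamma>)))) \<partial>lborel)"
    by (intro nn_integral_cong) (auto simp: indicator_def cubic_nonneg)
  then show "(\<integral>\<^sup>+x. ennreal (norm (indicator {0<..} x *\<^sub>R (1 - exp (- cubic j k (x powr (- 1 / \<gamma>)))))) \<partial>lborel) < \<infinity>"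
    using cubic_limit_finite[of j k] by simp
qed measurable

lemma cubic_powr_quantile:
  assumes "0 < x"
  shows "cubic j k (x powr (- 1 / \<gamma>)) = real j * x powr (- 2 / \<gamma>) + real k * x powr (- 3 / \<gamma>)"
proof -
  have "(x powr (- 1 / \<gamma>)) ^ m = x powr (- real m / \<gamma>)" for m
    using assms by (simp add: powr_realpow[symmetric] powr_powr)
  from this[of 2] this[of 3] show ?thesis by (simp add: cubic_def)
qed

lemma degree_laplace_tendsto:
  "(\<lambda>n. real n * measure_pmf.expectation p (\<lambda>d. 1 - exp (- cubic j k (real d / \<a> (real n)))))
     \<longlonglongrightarrow> (LINT x:{0<..}|lborel. 1 - exp (- cubic j k (x powr (- 1 / \<gamma>))))"
proof -
  have nn: "0 \<le> 1 - exp (- cubic j k (real d / \<a> (real n)))" for d n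
    by (simp add: cubic_nonneg tail_quantile_nonneg)
  let ?B = "\<integral>\<^sup>+x\<in>{0<..}. ennreal (1 - exp (- cubic j k (x powr (- 1 / \<gamma>)))) \<partial>lborel"
  have "(\<lambda>n. enn2real (\<integral>\<^sup>+d. ennreal (real n * (1 - exp (- cubic j k (real d / \<a> (real n))))) \<partial>measure_pmf p))
      \<longlonglongrightarrow> enn2real ?B"
    using cubic_limit_finite[of j k] cubic_degree_tendsto[of j k]
    by (intro tendsto_enn2real) (auto simp: less_top)
  moreover have "enn2real (\<integral>\<^sup>+d. ennreal (real n * (1 - exp (- cubic j k (real d / \<a> (real n))))) \<partial>measure_pmf p)
      = real n * measure_pmf.expectation p (\<lambda>d. 1 - exp (- cubic j k (real d / \<a> (real n))))" for n
  proof -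
    have "measure_pmf.expectation p (\<lambda>d. real n * (1 - exp (- cubic j k (real d / \<a> (real n)))))
      = enn2real (\<integral>\<^sup>+d. ennreal (real n * (1 - exp (- cubic j k (real d / \<a> (real n))))) \<partial>measure_pmf p)"
      using nn by (intro integral_eq_nn_integral AE_I2 mult_nonneg_nonneg) auto
    then show ?thesis by simp
  qed
  moreover have "(LINT x:{0<..}|lborel. 1 - exp (- cubic j k (x powr (- 1 / \<gamma>)))) = enn2real ?B"
    unfolding set_lebesgue_integral_def
    by (subst integral_eq_nn_integral)
      (auto simp: cubic_nonneg indicator_def intro!: arg_cong[where f=enn2real] nn_integral_cong)
  ultimately show ?thesis by simp
qed

abbreviation deg_law :: "nat \<Rightarrow> (nat \<Rightarrow> nat) pmf" where
  "deg_law n \<equiv> Pi_pmf {..<n} 0 (\<lambda>_. p)"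

definition scaled_sum :: "nat \<Rightarrow> nat \<Rightarrow> (nat \<Rightarrow> nat) \<Rightarrow> real" where
  "scaled_sum q n d = (\<Sum>i<n. real (d i) ^ q) / \<a> (real n) ^ q"

text \<open>Independence gives the n-th power of the one-vertex expectation, and
  \<open>cubic_powr_quantile\<close> rewrites the limiting exponent into the one of
  \<open>laplace_stable_S\<close>.\<close>

lemma scaled_sum_laplace_tendsto:
  "(\<lambda>n. measure_pmf.expectation (deg_law n) (\<lambda>d. exp (- scaled_sum 2 n d) ^ j * exp (- scaled_sum 3 n d) ^ k))
     \<longlonglongrightarrow> (\<integral>\<omega>. exp (- stable_S \<gamma> 2 \<omega>) ^ j * exp (- stable_S \<gamma> 3 \<omega>) ^ k \<partial>exp_seq_space)"
proof -
  let ?I = "LINT x:{0<..}|lborel. 1 - exp (- cubic j k (x powr (- 1 / \<gamma>)))"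
  let ?E = "\<lambda>n. measure_pmf.expectation p (\<lambda>d. exp (- cubic j k (real d / \<a> (real n))))"
  let ?c = "\<lambda>n. real n * measure_pmf.expectation p (\<lambda>d. 1 - exp (- cubic j k (real d / \<a> (real n))))"
  have cn: "0 \<le> cubic j k (real d / \<a> (real n))" for d n
    by (intro cubic_nonneg divide_nonneg_nonneg tail_quantile_nonneg) simp
  have int: "integrable (measure_pmf p) (\<lambda>d. exp (- cubic j k (real d / \<a> (real n))))" for n
    using cn by (intro measure_pmf.integrable_const_bound[where B=1]) auto
  have E: "measure_pmf.expectation p (\<lambda>d. 1 - exp (- cubic j k (real d / \<a> (real n)))) = 1 - ?E n" for n
    using int by simp
  have E01: "0 \<le> ?E n" "?E n \<le> 1" for n
  proof -
    show "0 \<le> ?E n" by (intro Bochner_Integration.integral_nonneg) auto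
    have "?E n \<le> measure_pmf.expectation p (\<lambda>d. 1)"
      using cn int by (intro integral_mono) auto
    then show "?E n \<le> 1" by simp
  qed
  have "(\<lambda>n. (1 - ?c n / real n) ^ n) \<longlonglongrightarrow> exp (- ?I)"
  proof (rule tendsto_one_minus_power_exp[OF degree_laplace_tendsto])
    show "\<bar>1 - ?c n / real n\<bar> \<le> 1" for n using E01[of n] unfolding E by (cases "n = 0") auto
  qed
  moreover have "(1 - ?c n / real n) ^ n
     = measure_pmf.expectation (deg_law n) (\<lambda>d. exp (- scaled_sum 2 n d) ^ j * exp (- scaled_sum 3 n d) ^ k)" for n
  proof -
    have "exp (- scaled_sum 2 n d) ^ j * exp (- scaled_sum 3 n d) ^ k
        = (\<Prod>i<n. exp (- cubic j k (real (d i) / \<a> (real n))))" for d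
      by (simp add: scaled_sum_def cubic_def exp_sum[symmetric] exp_of_nat_mult[symmetric] exp_add[symmetric]
          sum_negf sum.distrib sum_distrib_left sum_divide_distrib power_divide sum_subtractf)
    then have "measure_pmf.expectation (deg_law n) (\<lambda>d. exp (- scaled_sum 2 n d) ^ j * exp (- scaled_sum 3 n d) ^ k)
        = measure_pmf.expectation (deg_law n) (\<lambda>d. \<Prod>i<n. exp (- cubic j k (real (d i) / \<a> (real n))))" by simp
    also have "\<dots> = (\<Prod>i<n. ?E n)" using int by (subst expectation_prod_Pi_pmf) auto
    also have "\<dots> = (1 - ?c n / real n) ^ n" unfolding E by (cases "n = 0") auto
    finally show ?thesis by simp
  qed
  moreover have "exp (- ?I) = (\<integral>\<omega>. exp (- stable_S \<gamma> 2 \<omega>) ^ j * exp (- stable_S \<gamma> 3 \<omega>) ^ k \<partial>exp_seq_space)"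
  proof -
    let ?F = "\<lambda>x. real j * x powr (- 2 / \<gamma>) + real k * x powr (- 3 / \<gamma>)"
    have F: "1 - exp (- cubic j k (x powr (- 1 / \<gamma>))) = 1 - exp (- ?F x)" if "x \<in> {0<..}" for x
      using that by (simp only: cubic_powr_quantile greaterThan_iff)
    have "set_integrable lborel {0<..} (\<lambda>x. 1 - exp (- ?F x))"
      using set_integrable_cubic_limit[of j k]
      by (simp only: set_integrable_cong[OF refl refl F])
    moreover have "?I = (LINT x:{0<..}|lborel. 1 - exp (- ?F x))"
      by (rule set_lebesgue_integral_cong) (simp, intro allI impI, rule F)
    ultimately show ?thesis using laplace_stable_S[OF gamma_gt_1 gamma_less_2, of j k] by simp
  qed
  ultimately show ?thesis by simp
qed

text \<open>Integrating \<open>2 * y\<close> against the tail bound \<open>y powr (- gp)\<close> up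
  to \<open>e\<close> leaves the positive power \<open>2 - gp\<close> of \<open>e\<close>. So
  degrees far below the quantile contribute negligibly to the sum of squares.\<close>

lemma truncated_second_moment:
  obtains C t0 where "0 < C" "1 \<le> t0"
    "\<And>t e. t0 \<le> t \<Longrightarrow> 0 < e \<Longrightarrow> e \<le> 1 \<Longrightarrow>
       t * measure_pmf.expectation p (\<lambda>d. (real d)\<^sup>2 * indicator {..e * \<a> t} (real d)) \<le> C * e powr (2 - gp) * (\<a> t)\<^sup>2"
proof -
  obtain C t1 where C: "0 < C" "1 \<le> t1"
    "\<And>t y. t1 \<le> t \<Longrightarrow> 0 < y \<Longrightarrow> y \<le> 1 \<Longrightarrow> t * \<T> (\<a> t * y) \<le> C * y powr (- gp)"
    using tail_scaled_bound by blast
  have "\<forall>\<^sub>F t in at_top. 0 < \<a> t" using quantile_at_top by (simp add: filterlim_at_top_dense)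
  then obtain t2 where t2: "\<And>t. t \<ge> t2 \<Longrightarrow> 0 < \<a> t" by (auto simp: eventually_at_top_linorder)
  define K where "K = 2 * C / (2 - gp)"
  have K: "0 < K" using C gp_gm by (simp add: K_def)
  have "t * measure_pmf.expectation p (\<lambda>d. (real d)\<^sup>2 * indicator {..e * \<a> t} (real d)) \<le> K * e powr (2 - gp) * (\<a> t)\<^sup>2"
    if t: "max t1 t2 \<le> t" and e: "0 < e" "e \<le> 1" for t e
  proof -
    have a: "0 < \<a> t" and t0: "0 < t" using t t2 C by auto
    define f where "f d = t * ((real d / \<a> t)\<^sup>2 * indicator {..e * \<a> t} (real d))" for d :: nat
    define g where "g y = (if y < e then 2 * t * y else 0)" for y :: real
    have [measurable]: "g \<in> borel_measurable borel" unfolding g_def by measurable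
    \<comment> \<open>Only an inequality: for degrees above the truncation level \<open>f\<close>
      vanishes, whereas the layer integral does not.\<close>
    have f: "ennreal (f d) \<le> (\<integral>\<^sup>+y\<in>{0<..<real d / \<a> t}. ennreal (g y) \<partial>lborel)" for d
    proof (cases "real d \<le> e * \<a> t")
      case True
      have "ennreal (f d) = ennreal (t * (real d / \<a> t)\<^sup>2 - t * 0\<^sup>2)" using True by (simp add: f_def)
      also have "\<dots> = (\<integral>\<^sup>+y. ennreal (2 * t * y) * indicator {0..real d / \<a> t} y \<partial>lborel)"
        using a t0 by (intro nn_integral_FTC_Icc[symmetric]) (auto intro!: derivative_eq_intros)
      also have "\<dots> = (\<integral>\<^sup>+y\<in>{0<..<real d / \<a> t}. ennreal (g y) \<partial>lborel)"
      proof (rule nn_integral_cong_AE)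
        have le: "real d / \<a> t \<le> e" using True a by (simp add: field_simps)
        show "AE y in lborel. ennreal (2 * t * y) * indicator {0..real d / \<a> t} y = ennreal (g y) * indicator {0<..<real d / \<a> t} y"
          using AE_lborel_singleton[of 0] AE_lborel_singleton[of "real d / \<a> t"]
          by eventually_elim (use le in \<open>auto simp: indicator_def g_def\<close>)
      qed
      finally show ?thesis by simp
    qed (simp add: f_def)
    have "(\<integral>\<^sup>+d. ennreal (f d) \<partial>measure_pmf p) \<le> (\<integral>\<^sup>+d. (\<integral>\<^sup>+y\<in>{0<..<real d / \<a> t}. ennreal (g y) \<partial>lborel) \<partial>measure_pmf p)"
      by (intro nn_integral_mono f)
    also have "\<dots> = (\<integral>\<^sup>+y\<in>{0<..}. ennreal (g y) * emeasure (measure_pmf p) {d. y < real d / \<a> t} \<partial>lborel)"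
      using nn_integral_layer_cake[of "measure_pmf p" "\<lambda>d. real d / \<a> t" g]
      by (simp add: measure_pmf.sigma_finite_measure_axioms)
    also have "\<dots> \<le> (\<integral>\<^sup>+y. ennreal (2 * C) * (ennreal (y powr (1 - gp)) * indicator {0<..<e} y) \<partial>lborel)"
    proof (rule nn_integral_mono)
      fix y :: real
      show "ennreal (g y) * emeasure (measure_pmf p) {d. y < real d / \<a> t} * indicator {0<..} y
          \<le> ennreal (2 * C) * (ennreal (y powr (1 - gp)) * indicator {0<..<e} y)"
      proof (cases "0 < y \<and> y < e")
        case True
        have "{d. y < real d / \<a> t} = {d. \<a> t * y < real d}" using a by (auto simp: field_simps)
        then have "emeasure (measure_pmf p) {d. y < real d / \<a> t} = ennreal (\<T> (\<a> t * y))"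
          by (simp add: tail_prob_def measure_pmf.emeasure_eq_measure)
        moreover have "g y * \<T> (\<a> t * y) \<le> 2 * C * y powr (1 - gp)"
        proof -
          have "g y * \<T> (\<a> t * y) = 2 * y * (t * \<T> (\<a> t * y))" using True by (simp add: g_def)
          also have "\<dots> \<le> 2 * y * (C * y powr (- gp))"
            using True t e by (intro mult_left_mono C(3)) auto
          also have "\<dots> = 2 * C * y powr (1 - gp)" using True by (simp add: powr_diff powr_minus field_simps)
          finally show ?thesis .
        qed
        ultimately show ?thesis using True t0 C
          by (simp add: ennreal_mult[symmetric] tail_prob_nonneg g_def ennreal_leI)
      qed (auto simp: g_def indicator_def)
    qed
    also have "\<dots> = ennreal (2 * C) * ennreal (e powr (1 - gp + 1) / (1 - gp + 1))"
      using gp_gm e by (subst nn_integral_cmult) (auto simp: nn_integral_powr_0)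
    also have "\<dots> = ennreal (K * e powr (2 - gp))"
      using C gp_gm by (subst ennreal_mult[symmetric]) (auto simp: K_def field_simps)
    finally have le: "(\<integral>\<^sup>+d. ennreal (f d) \<partial>measure_pmf p) \<le> ennreal (K * e powr (2 - gp))" .
    have fnn: "0 \<le> f d" for d using t0 by (simp add: f_def)
    have "measure_pmf.expectation p f \<le> K * e powr (2 - gp)"
      using le K fnn by (subst integral_eq_nn_integral) (auto intro!: enn2real_leI)
    moreover have "measure_pmf.expectation p f
        = t * measure_pmf.expectation p (\<lambda>d. (real d)\<^sup>2 * indicator {..e * \<a> t} (real d)) / (\<a> t)\<^sup>2"
      unfolding f_def by (simp add: power_divide)
    ultimately show ?thesis using a by (simp add: field_simps)
  qed
  then show ?thesis using that[of K "max t1 t2"] K C by auto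
qed

end

section \<open>Convergence of mixed moments on the unit square\<close>

lemma (in prob_space) expectation_diff_le:
  fixes f g :: "'a \<Rightarrow> real"
  assumes "integrable M f" "integrable M g" "\<And>x. \<bar>f x - g x\<bar> \<le> e"
  shows "\<bar>expectation f - expectation g\<bar> \<le> e"
proof -
  have "\<bar>expectation f - expectation g\<bar> = \<bar>expectation (\<lambda>x. f x - g x)\<bar>"
    using assms by simp
  also have "\<dots> \<le> expectation (\<lambda>x. \<bar>f x - g x\<bar>)" by (rule integral_abs_bound)
  also have "\<dots> \<le> expectation (\<lambda>x. e)"
    using assms by (intro integral_mono) auto
  finally show ?thesis by (simp add: prob_space)
qed

text \<open>The laws may live on different spaces, so only the images in the square enter;
  compactness of the square makes every continuous function bounded on the images and uniformly
  approximable there.\<close>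

lemma polynomial_moments_converge:
  fixes P :: "nat \<Rightarrow> 'a measure" and M :: "'b measure"
    and Z :: "nat \<Rightarrow> 'a \<Rightarrow> real \<times> real" and W :: "'b \<Rightarrow> real \<times> real"
  assumes P: "\<And>n. prob_space (P n)" and M: "prob_space M"
    and Z [measurable]: "\<And>n. Z n \<in> borel_measurable (P n)" and W [measurable]: "W \<in> borel_measurable M"
    and Z01: "\<And>n x. Z n x \<in> {0..1} \<times> {0..1}" and W01: "\<And>x. W x \<in> {0..1} \<times> {0..1}"
    and mom: "\<And>j k. (\<lambda>n. \<integral>x. fst (Z n x) ^ j * snd (Z n x) ^ k \<partial>P n)
        \<longlonglongrightarrow> (\<integral>x. fst (W x) ^ j * snd (W x) ^ k \<partial>M)"
    and h: "continuous_on UNIV (h :: real \<times> real \<Rightarrow> real)"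
  shows "(\<lambda>n. \<integral>x. h (Z n x) \<partial>P n) \<longlonglongrightarrow> (\<integral>x. h (W x) \<partial>M)"
proof -
  let ?K = "{0..1} \<times> {0..1} :: (real \<times> real) set"
  define conv where "conv g \<longleftrightarrow> (\<lambda>n. \<integral>x. g (Z n x) \<partial>P n) \<longlonglongrightarrow> (\<integral>x. g (W x) \<partial>M)"
    for g :: "real \<times> real \<Rightarrow> real"
  have cpt: "compact ?K" by (intro compact_Times) auto
  have bdd: "\<exists>B. \<forall>z\<in>?K. \<bar>g z\<bar> \<le> B" if "continuous_on UNIV g" for g :: "real \<times> real \<Rightarrow> real"
  proof -
    have "compact (g ` ?K)"
      using that by (intro compact_continuous_image cpt) (rule continuous_on_subset, auto)
    then have "bounded (g ` ?K)" by (rule compact_imp_bounded)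
    then show ?thesis by (auto simp: bounded_iff)
  qed
  have intP: "integrable (P n) (\<lambda>x. g (Z n x))" if g: "continuous_on UNIV g" for g :: "real \<times> real \<Rightarrow> real" and n
  proof -
    interpret prob_space "P n" by (rule P)
    obtain B where B: "\<And>z. z \<in> ?K \<Longrightarrow> \<bar>g z\<bar> \<le> B" using bdd[OF g] by blast
    have "g \<in> borel_measurable borel" by (rule borel_measurable_continuous_onI[OF g])
    then show ?thesis
      by (intro integrable_const_bound[where B=B]) (simp_all add: B[OF Z01])
  qed
  have intM: "integrable M (\<lambda>x. g (W x))" if g: "continuous_on UNIV g" for g :: "real \<times> real \<Rightarrow> real"
  proof -
    interpret prob_space M by (rule M)
    obtain B where B: "\<And>z. z \<in> ?K \<Longrightarrow> \<bar>g z\<bar> \<le> B" using bdd[OF g] by blast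
    have "g \<in> borel_measurable borel" by (rule borel_measurable_continuous_onI[OF g])
    then show ?thesis
      by (intro integrable_const_bound[where B=B]) (simp_all add: B[OF W01])
  qed
  have conv_add: "conv (\<lambda>z. c * f z + d * g z)"
    if "conv f" "conv g" "continuous_on UNIV f" "continuous_on UNIV g" for f g c d
    using that unfolding conv_def
    by (simp add: intP intM) (intro tendsto_add tendsto_mult tendsto_const)
  have poly_cont: "continuous_on UNIV f" if "real_polynomial_function f" for f :: "real \<times> real \<Rightarrow> real"
    using that by (intro continuous_at_imp_continuous_on ballI continuous_real_polymonial_function)
  text \<open>Convergence is not preserved by products, but multiplication by a polynomial preserves
    convergence against all monomials.\<close>
  have key: "\<forall>g. continuous_on UNIV g \<longrightarrow> (\<forall>j k. conv (\<lambda>z. fst z ^ j * snd z ^ k * g z)) \<longrightarrow>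
      (\<forall>j k. conv (\<lambda>z. fst z ^ j * snd z ^ k * (g z * f z)))"
    if "real_polynomial_function f" for f
    using that
  proof (induction rule: real_polynomial_function.induct)
    case (linear f)
    interpret bounded_linear f by fact
    have f: "f z = fst z * f (1, 0) + snd z * f (0, 1)" for z
    proof -
      have "z = fst z *\<^sub>R (1, 0) + snd z *\<^sub>R (0, 1)" by (simp add: prod_eq_iff)
      then have "f z = f (fst z *\<^sub>R (1, 0) + snd z *\<^sub>R (0, 1))" by simp
      also have "\<dots> = fst z * f (1, 0) + snd z * f (0, 1)" by (simp only: add scaleR real_scaleR_def)
      finally show ?thesis .
    qed
    show ?case
    proof (intro allI impI)
      fix g :: "real \<times> real \<Rightarrow> real" and j k :: nat
      assume g: "continuous_on UNIV g" and c: "\<forall>j k. conv (\<lambda>z. fst z ^ j * snd z ^ k * g z)"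
      have "conv (\<lambda>z. f (1, 0) * (fst z ^ Suc j * snd z ^ k * g z) + f (0, 1) * (fst z ^ j * snd z ^ Suc k * g z))"
        by (intro conv_add c[rule_format] continuous_intros g)
      also have "(\<lambda>z. f (1, 0) * (fst z ^ Suc j * snd z ^ k * g z) + f (0, 1) * (fst z ^ j * snd z ^ Suc k * g z))
          = (\<lambda>z. fst z ^ j * snd z ^ k * (g z * f z))"
        by (subst (3) f) (simp add: algebra_simps)
      finally show "conv (\<lambda>z. fst z ^ j * snd z ^ k * (g z * f z))" .
    qed
  next
    case (const c)
    show ?case
    proof (intro allI impI)
      fix g :: "real \<times> real \<Rightarrow> real" and j k :: nat
      assume g: "continuous_on UNIV g" and cg: "\<forall>j k. conv (\<lambda>z. fst z ^ j * snd z ^ k * g z)"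
      have "conv (\<lambda>z. c * (fst z ^ j * snd z ^ k * g z) + 0 * (fst z ^ j * snd z ^ k * g z))"
        by (intro conv_add cg[rule_format] continuous_intros g)
      then show "conv (\<lambda>z. fst z ^ j * snd z ^ k * (g z * c))" by (simp add: mult_ac)
    qed
  next
    case (add f1 f2)
    show ?case
    proof (intro allI impI)
      fix g :: "real \<times> real \<Rightarrow> real" and j k :: nat
      assume g: "continuous_on UNIV g" and cg: "\<forall>j k. conv (\<lambda>z. fst z ^ j * snd z ^ k * g z)"
      have "conv (\<lambda>z. 1 * (fst z ^ j * snd z ^ k * (g z * f1 z)) + 1 * (fst z ^ j * snd z ^ k * (g z * f2 z)))"
        using cg g add poly_cont by (intro conv_add continuous_intros) auto
      then show "conv (\<lambda>z. fst z ^ j * snd z ^ k * (g z * (f1 z + f2 z)))" by (simp add: algebra_simps)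
    qed
  next
    case (mult f1 f2)
    show ?case
    proof (intro allI impI)
      fix g :: "real \<times> real \<Rightarrow> real" and j k :: nat
      assume g: "continuous_on UNIV g" and cg: "\<forall>j k. conv (\<lambda>z. fst z ^ j * snd z ^ k * g z)"
      have g1: "continuous_on UNIV (\<lambda>z. g z * f1 z)"
        using g poly_cont[OF mult.hyps(1)] by (intro continuous_intros)
      have "\<forall>j k. conv (\<lambda>z. fst z ^ j * snd z ^ k * (g z * f1 z))"
        using mult.IH(1) g cg by blast
      then have "conv (\<lambda>z. fst z ^ j * snd z ^ k * (g z * f1 z * f2 z))"
        using mult.IH(2) g1 by blast
      then show "conv (\<lambda>z. fst z ^ j * snd z ^ k * (g z * (f1 z * f2 z)))" by (simp add: mult_ac)
    qed
  qed
  have poly: "conv f" if f: "real_polynomial_function f" for f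
  proof -
    have "\<forall>j k. conv (\<lambda>z. fst z ^ j * snd z ^ k * (1 * f z))"
      using key[OF f, rule_format, of "\<lambda>_. 1"] mom by (auto simp: conv_def)
    then show ?thesis by (metis (no_types, lifting) ext mult_1 power_0)
  qed
  have "conv h" unfolding conv_def
  proof (rule LIMSEQ_I)
    fix e :: real assume e: "0 < e"
    have "continuous_on ?K h" using h by (rule continuous_on_subset) auto
    then obtain f where f: "real_polynomial_function f" "\<And>z. z \<in> ?K \<Longrightarrow> \<bar>h z - f z\<bar> < e / 3"
      using Stone_Weierstrass_real_polynomial_function[OF cpt, of h "e / 3"] e by auto
    obtain N where N: "\<And>n. n \<ge> N \<Longrightarrow> \<bar>(\<integral>x. f (Z n x) \<partial>P n) - (\<integral>x. f (W x) \<partial>M)\<bar> < e / 3"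
      using LIMSEQ_D[OF poly[OF f(1), unfolded conv_def], of "e / 3"] e by auto
    show "\<exists>no. \<forall>n\<ge>no. norm ((\<integral>x. h (Z n x) \<partial>P n) - (\<integral>x. h (W x) \<partial>M)) < e"
    proof (intro exI allI impI)
      fix n assume "N \<le> n"
      from N[OF this]
        prob_space.expectation_diff_le[OF P[of n] intP[OF h] intP[OF poly_cont[OF f(1)]]  f(2)[OF Z01, THEN less_imp_le]]
        prob_space.expectation_diff_le[OF M intM[OF h] intM[OF poly_cont[OF f(1)]] f(2)[OF W01, THEN less_imp_le]]
      show "norm ((\<integral>x. h (Z n x) \<partial>P n) - (\<integral>x. h (W x) \<partial>M)) < e"
        unfolding real_norm_def by linarith
    qed
  qed
  then show ?thesis by (simp add: conv_def)
qed

section \<open>Uniform perfect matchings\<close>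

text \<open>Matchings of an abstract set, which permits induction on the set and relabelling of its
  elements.\<close>

definition perfect_matchings :: "'a set \<Rightarrow> ('a \<Rightarrow> 'a) set" where
  "perfect_matchings H = {m. (\<forall>h\<in>H. m h \<in> H \<and> m h \<noteq> h \<and> m (m h) = h) \<and> (\<forall>h. h \<notin> H \<longrightarrow> m h = h)}"

lemma finite_perfect_matchings:
  assumes "finite H" shows "finite (perfect_matchings H)"
proof -
  have "(\<lambda>m. restrict m H) ` perfect_matchings H \<subseteq> H \<rightarrow>\<^sub>E H"
    by (auto simp: perfect_matchings_def)
  moreover have "finite (H \<rightarrow>\<^sub>E H)" using assms by (intro finite_PiE) auto
  ultimately have "finite ((\<lambda>m. restrict m H) ` perfect_matchings H)" by (rule finite_subset)
  moreover have "inj_on (\<lambda>m. restrict m H) (perfect_matchings H)"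
  proof (rule inj_onI)
    fix m m' assume m: "m \<in> perfect_matchings H" "m' \<in> perfect_matchings H" "restrict m H = restrict m' H"
    show "m = m'"
    proof
      fix h show "m h = m' h"
      proof (cases "h \<in> H")
        case True then show ?thesis using fun_cong[OF m(3), of h] by simp
      next
        case False then show ?thesis using m(1,2) by (simp add: perfect_matchings_def)
      qed
    qed
  qed
  ultimately show ?thesis by (rule finite_imageD)
qed

text \<open>Required because \<open>pmf_of_set\<close> is meaningful only on nonempty finite sets.
  Two elements are matched to each other, the others by induction.\<close>

lemma perfect_matchings_nonempty:
  assumes "finite H" "card H = 2 * k" shows "perfect_matchings H \<noteq> {}"
  using assms
proof (induction k arbitrary: H)
  case 0
  then have "id \<in> perfect_matchings H" by (auto simp: perfect_matchings_def)
  then show ?case by blast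
next
  case (Suc k)
  then have "card H = Suc (Suc (2 * k))" by simp
  then obtain x y where xy: "x \<in> H" "y \<in> H" "x \<noteq> y" by (auto simp: card_Suc_eq)
  have "card (H - {x, y}) = 2 * k"
    using xy Suc.prems by (subst card_Diff_subset) auto
  then obtain m where m: "m \<in> perfect_matchings (H - {x, y})" using Suc by (metis finite_Diff ex_in_conv)
  have "m(x := y, y := x) \<in> perfect_matchings H"
    unfolding perfect_matchings_def mem_Collect_eq
  proof (intro conjI ballI allI impI)
    fix h assume "h \<in> H"
    moreover have "m h \<in> H \<and> m h \<noteq> x \<and> m h \<noteq> y \<and> m h \<noteq> h \<and> m (m h) = h" if "h \<in> H - {x, y}"
      using m that by (simp add: perfect_matchings_def)
    ultimately have *: "h = x \<or> h = y \<or> (h \<noteq> x \<and> h \<noteq> y \<and> m h \<in> H \<and> m h \<noteq> x \<and> m h \<noteq> y \<and> m h \<noteq> h \<and> m (m h) = h)"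
      by blast
    show "(m(x := y, y := x)) h \<in> H" "(m(x := y, y := x)) h \<noteq> h"
      "(m(x := y, y := x)) ((m(x := y, y := x)) h) = h"
      using * xy by auto
  next
    fix h assume "h \<notin> H"
    then show "(m(x := y, y := x)) h = h" using m xy by (auto simp: perfect_matchings_def)
  qed
  then show ?case by blast
qed

lemma perfect_matchings_conjugate:
  assumes m: "m \<in> perfect_matchings H" and "a \<in> H" "b \<in> H"
  shows "Transposition.transpose a b \<circ> m \<circ> Transposition.transpose a b \<in> perfect_matchings H"
proof -
  have t: "Transposition.transpose a b h \<in> H \<longleftrightarrow> h \<in> H" for h
    using assms by (auto simp: Transposition.transpose_def)
  have inv: "Transposition.transpose a b x = h \<Longrightarrow> x = Transposition.transpose a b h" for x h
    by (metis transpose_involutory)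
  show ?thesis
    unfolding perfect_matchings_def mem_Collect_eq o_apply
  proof (intro conjI ballI allI impI)
    fix h assume "h \<in> H"
    then have h: "Transposition.transpose a b h \<in> H" by (simp add: t)
    then have m': "m (Transposition.transpose a b h) \<in> H" "m (Transposition.transpose a b h) \<noteq> Transposition.transpose a b h"
      "m (m (Transposition.transpose a b h)) = Transposition.transpose a b h"
      using m by (auto simp: perfect_matchings_def)
    show "Transposition.transpose a b (m (Transposition.transpose a b h)) \<in> H" using m' by (simp add: t)
    show "Transposition.transpose a b (m (Transposition.transpose a b h)) \<noteq> h" using m' inv by blast
    show "Transposition.transpose a b (m (Transposition.transpose a b
        (Transposition.transpose a b (m (Transposition.transpose a b h))))) = h"
      using m' by simp
  next
    fix h assume "h \<notin> H"
    then have "m (Transposition.transpose a b h) = Transposition.transpose a b h"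
      using m t[of h] by (simp add: perfect_matchings_def)
    then show "Transposition.transpose a b (m (Transposition.transpose a b h)) = h" by simp
  qed
qed

text \<open>Symmetry: conjugating by the transposition of \<open>g\<close> and \<open>g'\<close> exchanges the events
  \<open>m h = g\<close> and \<open>m h = g'\<close>.\<close>
lemma card_matchings_image_le:
  assumes H: "finite H" and Q: "Q \<subseteq> perfect_matchings H" and g: "g \<in> T" and h: "h \<notin> T" and T: "T \<subseteq> H"
    and closed: "\<And>g' m. g' \<in> T \<Longrightarrow> m \<in> Q \<Longrightarrow>
      Transposition.transpose g g' \<circ> m \<circ> Transposition.transpose g g' \<in> Q"
  shows "card T * card {m \<in> Q. m h = g} \<le> card Q"
proof -
  have finQ: "finite Q" using Q finite_perfect_matchings[OF H] by (rule finite_subset)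
  have finT: "finite T" using T H by (rule finite_subset)
  have le: "card {m \<in> Q. m h = g} \<le> card {m \<in> Q. m h = g'}" if g': "g' \<in> T" for g'
  proof (rule card_inj_on_le)
    let ?c = "\<lambda>m. Transposition.transpose g g' \<circ> m \<circ> Transposition.transpose g g'"
    show "inj_on ?c {m \<in> Q. m h = g}"
    proof (rule inj_on_inverseI[where g="?c"])
      fix m show "?c (?c m) = m" by (auto simp: fun_eq_iff)
    qed
    have "Transposition.transpose g g' h = h" using g g' h by (auto simp: Transposition.transpose_def)
    then show "?c ` {m \<in> Q. m h = g} \<subseteq> {m \<in> Q. m h = g'}" using closed[OF g'] by auto
    show "finite {m \<in> Q. m h = g'}" using finQ by simp
  qed
  have "card T * card {m \<in> Q. m h = g} = (\<Sum>g'\<in>T. card {m \<in> Q. m h = g})" by simp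
  also have "\<dots> \<le> (\<Sum>g'\<in>T. card {m \<in> Q. m h = g'})" by (intro sum_mono le)
  also have "\<dots> = card (\<Union>g'\<in>T. {m \<in> Q. m h = g'})"
    using finT finQ by (intro card_UN_disjoint[symmetric]) auto
  also have "\<dots> \<le> card Q" using finQ by (intro card_mono) auto
  finally show ?thesis .
qed

text \<open>At least four elements keep the denominator \<open>card H - 3\<close> of the two-pair
  bound positive.\<close>

locale uniform_matching =
  fixes H :: "'a set" and k :: nat
  assumes fin: "finite H" and card_even: "card H = 2 * k" and card_ge: "4 \<le> card H"
begin

abbreviation "\<M> \<equiv> pmf_of_set (perfect_matchings H)"

lemma set_matchings: "set_pmf \<M> = perfect_matchings H"
  by (intro set_pmf_of_set perfect_matchings_nonempty[OF fin card_even] finite_perfect_matchings fin)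

lemma prob_matchings: "measure_pmf.prob \<M> {m. P m} = card {m \<in> perfect_matchings H. P m} / card (perfect_matchings H)"
  by (subst measure_pmf_of_set)
    (auto simp: perfect_matchings_nonempty[OF fin card_even] finite_perfect_matchings fin intro!: arg_cong[where f=card])

lemma card_matchings_pos: "0 < card (perfect_matchings H)"
  using perfect_matchings_nonempty[OF fin card_even] finite_perfect_matchings[OF fin] by (simp add: card_gt_0_iff)

lemma card_match_one:
  assumes "h \<in> H" "g \<in> H" "h \<noteq> g"
  shows "(card H - 1) * card {m \<in> perfect_matchings H. m h = g} \<le> card (perfect_matchings H)"
proof -
  have "card (H - {h}) * card {m \<in> perfect_matchings H. m h = g} \<le> card (perfect_matchings H)"
    using assms fin by (intro card_matchings_image_le[where H=H] perfect_matchings_conjugate) auto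
  then show ?thesis using assms fin by simp
qed

lemma prob_match_one:
  assumes "h \<in> H" "g \<in> H"
  shows "measure_pmf.prob \<M> {m. m h = g} \<le> 1 / (real (card H) - 1)"
proof (cases "h = g")
  case True
  then have e: "{m \<in> perfect_matchings H. m h = g} = {}" using assms by (auto simp: perfect_matchings_def)
  show ?thesis using card_ge by (simp add: prob_matchings e)
next
  case False
  have "real ((card H - 1) * card {m \<in> perfect_matchings H. m h = g}) \<le> real (card (perfect_matchings H))"
    using card_match_one[OF assms False] by (simp only: of_nat_le_iff)
  then have "(real (card H) - 1) * real (card {m \<in> perfect_matchings H. m h = g}) \<le> real (card (perfect_matchings H))"
    using card_ge by (simp add: of_nat_diff)
  then show ?thesis using card_ge card_matchings_pos by (simp add: prob_matchings field_simps)
qed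

text \<open>The first pair is fixed, which costs \<open>1 / (card H - 1)\<close>. Conditionally on
  it, the partner of \<open>h2\<close> is still exchangeable among the remaining
  \<open>card H - 3\<close> elements.\<close>

lemma prob_match_two:
  assumes "h1 \<in> H" "g1 \<in> H" "h2 \<in> H" "g2 \<in> H" "h1 \<noteq> h2" "g1 \<noteq> h2" "g2 \<noteq> h1" "g2 \<noteq> h2"
  shows "measure_pmf.prob \<M> {m. m h1 = g1 \<and> m h2 = g2} \<le> 1 / ((real (card H) - 1) * (real (card H) - 3))"
proof (cases "h1 = g1 \<or> g1 = g2")
  case True
  have e: "{m \<in> perfect_matchings H. m h1 = g1 \<and> m h2 = g2} = {}"
  proof -
    { fix m assume m: "m \<in> perfect_matchings H" "m h1 = g1" "m h2 = g2"
      have "m (m h1) = h1" "m (m h2) = h2" "m h1 \<noteq> h1" using m assms by (auto simp: perfect_matchings_def)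
      then have False using True m assms by auto }
    then show ?thesis by blast
  qed
  show ?thesis unfolding prob_matchings e using card_ge by simp
next
  case False
  let ?Q = "{m \<in> perfect_matchings H. m h1 = g1}"
  \<comment> \<open>Transpositions of elements of this set fix \<open>h1\<close> and
    \<open>g1\<close>, so conjugation preserves the conditioning \<open>m h1 = g1\<close>.\<close>
  let ?T = "H - {h1, g1, h2}"
  have "card ?T * card {m \<in> ?Q. m h2 = g2} \<le> card ?Q"
  proof (rule card_matchings_image_le[where H=H])
    fix g' m assume g': "g' \<in> ?T" and m: "m \<in> ?Q"
    show "Transposition.transpose g2 g' \<circ> m \<circ> Transposition.transpose g2 g' \<in> ?Q"
    proof -
      have "Transposition.transpose g2 g' h1 = h1" "Transposition.transpose g2 g' g1 = g1"
        using g' assms False by (auto intro!: transpose_apply_other)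
      then show ?thesis using m g' assms(4) perfect_matchings_conjugate[of m H g2 g'] by simp
    qed
  qed (use assms False fin in auto)
  moreover have "card ?T = card H - 3" using assms False fin by (subst card_Diff_subset) auto
  ultimately have 1: "real (card H - 3) * real (card {m \<in> ?Q. m h2 = g2}) \<le> real (card ?Q)"
    by (simp only: of_nat_mult[symmetric] of_nat_le_iff)
  have "(card H - 1) * card ?Q \<le> card (perfect_matchings H)" using assms False by (intro card_match_one) auto
  then have 2: "real (card H - 1) * real (card ?Q) \<le> real (card (perfect_matchings H))"
    by (simp only: of_nat_mult[symmetric] of_nat_le_iff)
  have "real (card H - 1) * (real (card H - 3) * real (card {m \<in> ?Q. m h2 = g2})) \<le> real (card (perfect_matchings H))"
    using mult_left_mono[OF 1, of "real (card H - 1)"] 2 by linarith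
  then have "(real (card H) - 1) * (real (card H) - 3) * real (card {m \<in> ?Q. m h2 = g2}) \<le> real (card (perfect_matchings H))"
    using card_ge by (simp add: of_nat_diff mult.assoc)
  moreover have "{m \<in> ?Q. m h2 = g2} = {m \<in> perfect_matchings H. m h1 = g1 \<and> m h2 = g2}" by auto
  moreover have "0 < (real (card H) - 1) * (real (card H) - 3)" using card_ge by (intro mult_pos_pos) auto
  ultimately show ?thesis using card_matchings_pos by (simp add: prob_matchings field_simps)
qed

end

section \<open>The erased configuration model for fixed degrees\<close>

lemma cm_matchings_eq: "cm_matchings n d = perfect_matchings (half_edges n d)"
  by (simp add: cm_matchings_def perfect_matchings_def)

lemma half_edges_eq: "half_edges n d = (SIGMA i:{..<n}. {..<cm_degrees n d i})"
  by (auto simp: half_edges_def)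

lemma finite_half_edges: "finite (half_edges n d)"
  by (simp add: half_edges_eq)

lemma card_half_edges: "card (half_edges n d) = (\<Sum>i<n. cm_degrees n d i)"
  by (simp add: half_edges_eq)

lemma sum_cm_degrees:
  "(\<Sum>i<n. cm_degrees n d i) = (\<Sum>i<n. d i) + (if odd (\<Sum>i<n. d i) then 1 else 0)"
proof (cases "odd (\<Sum>i<n. d i)")
  case True
  \<comment> \<open>An odd sum is not empty, so \<open>n - 1\<close> is a genuine vertex that can
    receive the extra half-edge.\<close>
  then have "n \<noteq> 0" by (cases n) auto
  then obtain k where n: "n = Suc k" by (cases n) auto
  have "(\<Sum>i<k. (d(k := d k + 1)) i) = (\<Sum>i<k. d i)" by (intro sum.cong) auto
  then show ?thesis using True by (simp add: cm_degrees_def n)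
qed (simp add: cm_degrees_def)

lemma card_half_edges_even: "card (half_edges n d) = 2 * (card (half_edges n d) div 2)"
proof -
  have "even (card (half_edges n d))" by (auto simp: card_half_edges sum_cm_degrees)
  then show ?thesis by simp
qed

locale config_model =
  fixes n :: nat and d :: "nat \<Rightarrow> nat"
  assumes card_half_edges_ge: "4 \<le> card (half_edges n d)"
begin

abbreviation "H \<equiv> half_edges n d"
abbreviation "e \<equiv> cm_degrees n d"
definition "tot = real (card (half_edges n d))"
definition V :: "nat \<Rightarrow> (nat \<times> nat) set" where "V i = {h \<in> half_edges n d. fst h = i}"

sublocale uniform_matching "half_edges n d" "card (half_edges n d) div 2"
  by unfold_locales (rule finite_half_edges card_half_edges_even card_half_edges_ge)+

lemma tot_eq: "tot = (\<Sum>i<n. real (e i))"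
  by (simp add: tot_def card_half_edges)

lemma tot_ge: "4 \<le> tot"
  using card_half_edges_ge by (simp add: tot_def)

lemma finite_V: "finite (V i)" by (simp add: V_def finite_half_edges)

lemma V_subset: "V i \<subseteq> H" by (auto simp: V_def)

lemma card_V: "i < n \<Longrightarrow> card (V i) = e i"
proof -
  assume "i < n"
  then have "V i = Pair i ` {..<e i}" by (auto simp: V_def half_edges_def)
  then show ?thesis by (simp add: card_image inj_on_def)
qed

lemma fst_less: "h \<in> H \<Longrightarrow> fst h < n"
  by (auto simp: half_edges_def)

lemma integrable_M [simp]: "integrable (measure_pmf \<M>) (f :: _ \<Rightarrow> real)"
  by (rule integrable_measure_pmf_finite) (simp add: set_matchings finite_perfect_matchings finite_half_edges)

lemma ecm_degree_eq_card:
  "ecm_degree n d m i = card {j. j < n \<and> j \<noteq> i \<and> (\<exists>h\<in>V i. fst (m h) = j)}"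
proof -
  have "0 < cm_edges n d m i j \<longleftrightarrow> (\<exists>h\<in>V i. fst (m h) = j)" for j
    unfolding cm_edges_def V_def
    by (subst card_gt_0_iff) (auto simp: finite_half_edges)
  then have "ecm_degree n d m i = (\<Sum>j<n. if j \<noteq> i \<and> (\<exists>h\<in>V i. fst (m h) = j) then 1 else 0)"
    unfolding ecm_degree_def ecm_edges_def by (intro sum.cong) auto
  also have "\<dots> = card {j \<in> {..<n}. j \<noteq> i \<and> (\<exists>h\<in>V i. fst (m h) = j)}"
    by (subst sum.inter_filter[symmetric]) auto
  finally show ?thesis by (simp add: conj_assoc)
qed

lemma ecm_degree_le:
  assumes "i < n" shows "ecm_degree n d m i \<le> e i"
proof -
  have "ecm_degree n d m i \<le> card ((\<lambda>h. fst (m h)) ` V i)"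
    unfolding ecm_degree_eq_card by (intro card_mono finite_imageI finite_V) auto
  also have "\<dots> \<le> card (V i)" by (intro card_image_le finite_V)
  finally show ?thesis by (simp add: card_V assms)
qed

section \<open>Loss of degree through erasure\<close>

text \<open>A half-edge of \<open>i\<close> that is not bad leads to a neighbour which no other half-edge of \<open>i\<close> reaches.
  Partners of degree above \<open>\<kappa>\<close> are discarded outright, which keeps the pair count in \<open>prob_bad\<close> linear in \<open>\<kappa>\<close>.\<close>
definition bad :: "real \<Rightarrow> nat \<Rightarrow> (nat \<times> nat) \<Rightarrow> ((nat \<times> nat) \<Rightarrow> nat \<times> nat) \<Rightarrow> bool" where
  "bad \<kappa> i h m \<longleftrightarrow> fst (m h) = i \<or> \<kappa> < real (e (fst (m h))) \<or>
     (\<exists>h2\<in>V i - {h}. fst (m h2) = fst (m h) \<and> fst (m h) \<noteq> i \<and> real (e (fst (m h))) \<le> \<kappa>)"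

text \<open>Two half-edges of \<open>i\<close> with a common neighbour would make each other bad, so
  the map to the neighbour is injective on the remaining ones, and it avoids \<open>i\<close>. Each
  of them therefore contributes its own erased edge.\<close>

lemma degree_loss_le:
  assumes m: "m \<in> perfect_matchings H" and i: "i < n"
  shows "e i \<le> ecm_degree n d m i + card {h \<in> V i. bad \<kappa> i h m}"
proof -
  let ?G = "{h \<in> V i. \<not> bad \<kappa> i h m}"
  have "inj_on (\<lambda>h. fst (m h)) ?G"
    by (rule inj_onI) (auto simp: bad_def)
  then have "card ?G = card ((\<lambda>h. fst (m h)) ` ?G)" by (rule card_image[symmetric])
  also have "\<dots> \<le> ecm_degree n d m i"
    unfolding ecm_degree_eq_card
  proof (rule card_mono)
    show "(\<lambda>h. fst (m h)) ` ?G \<subseteq> {j. j < n \<and> j \<noteq> i \<and> (\<exists>h\<in>V i. fst (m h) = j)}"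
    proof
      fix j assume "j \<in> (\<lambda>h. fst (m h)) ` ?G"
      then obtain h where h: "h \<in> V i" "\<not> bad \<kappa> i h m" "j = fst (m h)" by auto
      then have "m h \<in> H" using m V_subset by (auto simp: perfect_matchings_def)
      then show "j \<in> {j. j < n \<and> j \<noteq> i \<and> (\<exists>h\<in>V i. fst (m h) = j)}"
        using h fst_less by (auto simp: bad_def)
    qed
  qed auto
  finally have "card ?G \<le> ecm_degree n d m i" .
  moreover have "card (V i) = card ?G + card {h \<in> V i. bad \<kappa> i h m}"
    using finite_V by (subst card_Un_disjoint[symmetric]) (auto intro!: arg_cong[where f=card])
  ultimately show ?thesis using i by (simp add: card_V)
qed

definition high :: "real \<Rightarrow> real" where
  "high \<kappa> = (\<Sum>i | i < n \<and> \<kappa> < real (e i). real (e i))"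

lemma card_high: "real (card {g \<in> H. \<kappa> < real (e (fst g))}) = high \<kappa>"
proof -
  have "{g \<in> H. \<kappa> < real (e (fst g))} = (SIGMA i:{i. i < n \<and> \<kappa> < real (e i)}. {..<e i})"
    by (auto simp: half_edges_def)
  then show ?thesis by (simp add: high_def)
qed

lemma prob_UN_le:
  assumes "finite I" "\<And>x. x \<in> I \<Longrightarrow> measure_pmf.prob \<M> {m. P x m} \<le> c"
  shows "measure_pmf.prob \<M> {m. \<exists>x\<in>I. P x m} \<le> real (card I) * c"
proof -
  have "{m. \<exists>x\<in>I. P x m} = (\<Union>x\<in>I. {m. P x m})" by auto
  then have "measure_pmf.prob \<M> {m. \<exists>x\<in>I. P x m} \<le> (\<Sum>x\<in>I. measure_pmf.prob \<M> {m. P x m})"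
    using assms(1) by (simp add: measure_pmf.finite_measure_subadditive_finite)
  also have "\<dots> \<le> (\<Sum>x\<in>I. c)" by (intro sum_mono assms)
  finally show ?thesis by simp
qed

text \<open>The summands account for a self-loop, for a partner at a vertex of degree above
  \<kappa>, and for a parallel edge to a vertex of degree at most \<kappa>.\<close>

definition loss_rate :: "real \<Rightarrow> real \<Rightarrow> real" where
  "loss_rate \<kappa> M = M / (tot - 1) + high \<kappa> / (tot - 1) + M * tot * \<kappa> / ((tot - 1) * (tot - 3))"

text \<open>A union bound. For a parallel edge there are at most \<open>M\<close> choices of the
  second half-edge, \<open>tot\<close> choices of the first partner, and then only \<kappa> choices
  of the second partner at the same vertex.\<close>

lemma prob_bad:
  assumes i: "i < n" and h: "h \<in> V i" and M: "real (e i) \<le> M" and \<kappa>: "0 \<le> \<kappa>"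
  shows "measure_pmf.prob \<M> {m. bad \<kappa> i h m} \<le> loss_rate \<kappa> M"
proof -
  have hH: "h \<in> H" using h V_subset by auto
  define c where "c = 1 / ((tot - 1) * (tot - 3))"
  have c0: "0 \<le> c" using tot_ge by (simp add: c_def)
  let ?A = "{m. \<exists>g\<in>V i. m h = g}"
  let ?B = "{m. \<exists>g\<in>{g \<in> H. \<kappa> < real (e (fst g))}. m h = g}"
  let ?L = "{g \<in> H. fst g \<noteq> i \<and> real (e (fst g)) \<le> \<kappa>}"
  let ?C = "{m. \<exists>h2\<in>V i - {h}. \<exists>g\<in>?L. \<exists>g2\<in>V (fst g). m h = g \<and> m h2 = g2}"
  have A: "measure_pmf.prob \<M> ?A \<le> real (card (V i)) * (1 / (tot - 1))"
    unfolding tot_def using hH V_subset by (intro prob_UN_le finite_V prob_match_one) auto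
  have B: "measure_pmf.prob \<M> ?B \<le> real (card {g \<in> H. \<kappa> < real (e (fst g))}) * (1 / (tot - 1))"
    unfolding tot_def using hH by (intro prob_UN_le prob_match_one) (auto simp: finite_half_edges)
  have C: "measure_pmf.prob \<M> ?C \<le> real (card (V i - {h})) * (real (card ?L) * (\<kappa> * c))"
  proof (intro prob_UN_le)
    fix h2 g assume h2: "h2 \<in> V i - {h}" and g: "g \<in> ?L"
    have "measure_pmf.prob \<M> {m. \<exists>g2\<in>V (fst g). m h = g \<and> m h2 = g2} \<le> real (card (V (fst g))) * c"
      unfolding c_def tot_def
    proof (intro prob_UN_le finite_V prob_match_two)
      fix g2 assume "g2 \<in> V (fst g)"
      then show "g2 \<in> H" "g2 \<noteq> h" "g2 \<noteq> h2" using g h h2 by (auto simp: V_def)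
    qed (use hH h2 g h in \<open>auto simp: V_def\<close>)
    also have "\<dots> \<le> \<kappa> * c" using g c0 fst_less by (intro mult_right_mono) (auto simp: card_V)
    finally show "measure_pmf.prob \<M> {m. \<exists>g2\<in>V (fst g). m h = g \<and> m h2 = g2} \<le> \<kappa> * c" .
  qed (auto simp: finite_V finite_half_edges)
  have "measure_pmf.prob \<M> {m. bad \<kappa> i h m} \<le> measure_pmf.prob \<M> (?A \<union> ?B \<union> ?C)"
  proof (rule measure_pmf.finite_measure_mono_AE)
    show "AE m in measure_pmf \<M>. m \<in> {m. bad \<kappa> i h m} \<longrightarrow> m \<in> ?A \<union> ?B \<union> ?C"
    proof (rule AE_pmfI, rule impI)
      fix m assume "m \<in> set_pmf \<M>" and b: "m \<in> {m. bad \<kappa> i h m}"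
      then have m: "m \<in> perfect_matchings H" by (simp add: set_matchings)
      have mH: "m h' \<in> H" if "h' \<in> H" for h' using m that by (auto simp: perfect_matchings_def)
      show "m \<in> ?A \<union> ?B \<union> ?C"
      proof (cases "fst (m h) = i \<or> \<kappa> < real (e (fst (m h)))")
        case True then show ?thesis using mH[OF hH] by (auto simp: V_def)
      next
        case False
        then obtain h2 where h2: "h2 \<in> V i - {h}" "fst (m h2) = fst (m h)"
          using b unfolding bad_def by blast
        have "m h2 \<in> V (fst (m h))" using h2 mH V_subset by (auto simp: V_def)
        moreover have "m h \<in> ?L" using False mH[OF hH] by auto
        ultimately show ?thesis using h2 by blast
      qed
    qed
  qed auto
  also have "\<dots> \<le> measure_pmf.prob \<M> ?A + measure_pmf.prob \<M> ?B + measure_pmf.prob \<M> ?C"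
    using measure_Un_le[of ?A "measure_pmf \<M>" ?B] measure_Un_le[of "?A \<union> ?B" "measure_pmf \<M>" ?C] by simp
  also have "\<dots> \<le> M / (tot - 1) + high \<kappa> / (tot - 1) + M * (tot * (\<kappa> * c))"
  proof (intro add_mono)
    show "measure_pmf.prob \<M> ?A \<le> M / (tot - 1)"
      using A M i tot_ge by (simp add: card_V) (smt (verit) divide_right_mono)
    show "measure_pmf.prob \<M> ?B \<le> high \<kappa> / (tot - 1)" using B by (simp add: card_high)
    have "real (card (V i - {h})) \<le> M"
      using M i card_mono[OF finite_V, of "V i - {h}" i] by (simp add: card_V del: card_Diff_insert)
    moreover have "real (card ?L) \<le> tot" unfolding tot_def
      using card_mono[OF finite_half_edges, of ?L] by auto
    ultimately have "real (card (V i - {h})) * (real (card ?L) * (\<kappa> * c)) \<le> M * (tot * (\<kappa> * c))"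
      using c0 \<kappa> by (intro mult_mono mult_right_mono) (auto simp: tot_def intro: order_trans)
    then show "measure_pmf.prob \<M> ?C \<le> M * (tot * (\<kappa> * c))" using C by linarith
  qed
  finally show ?thesis by (simp add: loss_rate_def c_def mult.assoc)
qed

text \<open>The weights \<open>c i\<close> will be powers of the degrees, so that one estimate
  covers the power sums of order 1, 2 and 3.\<close>

lemma expected_loss:
  assumes M: "\<And>i. i < n \<Longrightarrow> real (e i) \<le> M" and \<kappa>: "0 \<le> \<kappa>" and c: "\<And>i. i < n \<Longrightarrow> 0 \<le> c i"
  shows "measure_pmf.expectation \<M> (\<lambda>m. \<Sum>i<n. c i * (real (e i) - real (ecm_degree n d m i)))
     \<le> loss_rate \<kappa> M * (\<Sum>i<n. c i * real (e i))"
proof -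
  have "measure_pmf.expectation \<M> (\<lambda>m. \<Sum>i<n. c i * (real (e i) - real (ecm_degree n d m i)))
     \<le> measure_pmf.expectation \<M> (\<lambda>m. \<Sum>i<n. c i * (\<Sum>h\<in>V i. indicator {m. bad \<kappa> i h m} m))"
  proof (rule integral_mono_AE)
    show "AE m in measure_pmf \<M>. (\<Sum>i<n. c i * (real (e i) - real (ecm_degree n d m i)))
        \<le> (\<Sum>i<n. c i * (\<Sum>h\<in>V i. indicator {m. bad \<kappa> i h m} m))"
    proof (rule AE_pmfI, intro sum_mono mult_left_mono)
      fix m i assume "m \<in> set_pmf \<M>" and i: "i \<in> {..<n}"
      then have "m \<in> perfect_matchings H" by (simp add: set_matchings)
      from degree_loss_le[OF this, of i \<kappa>] i
      have "real (e i) - real (ecm_degree n d m i) \<le> real (card {h \<in> V i. bad \<kappa> i h m})" by simp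
      also have "\<dots> = (\<Sum>h\<in>V i. indicator {m. bad \<kappa> i h m} m)"
        by (simp add: indicator_def sum.inter_filter[symmetric] finite_V Int_def)
      finally show "real (e i) - real (ecm_degree n d m i) \<le> (\<Sum>h\<in>V i. indicator {m. bad \<kappa> i h m} m)" .
    qed (use c in auto)
  qed auto
  also have "\<dots> = (\<Sum>i<n. c i * (\<Sum>h\<in>V i. measure_pmf.prob \<M> {m. bad \<kappa> i h m}))"
    by simp
  also have "\<dots> \<le> (\<Sum>i<n. c i * (\<Sum>h\<in>V i. loss_rate \<kappa> M))"
    using c M \<kappa> by (intro sum_mono mult_left_mono prob_bad) auto
  also have "\<dots> = loss_rate \<kappa> M * (\<Sum>i<n. c i * real (e i))"
    by (simp add: card_V sum_distrib_left mult_ac)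
  finally show ?thesis .
qed

text \<open>An erased edge is present with probability at most
  \<open>min 1 (e i * e j / (tot - 1))\<close>. The bound 1 is used between two vertices of degree
  above \<open>b\<close>, the other bound for all other pairs.\<close>

lemma expected_product_sum:
  assumes b: "0 < b"
  shows "measure_pmf.expectation \<M> (\<lambda>m. \<Sum>i<n. \<Sum>j<n. real (ecm_edges n d m i j) * real (ecm_degree n d m i) * real (ecm_degree n d m j))
    \<le> (\<Sum>i<n. (real (e i))\<^sup>2)\<^sup>2 / b\<^sup>2
        + 2 / (tot - 1) * (\<Sum>i<n. (real (e i))\<^sup>2) * (\<Sum>i | i < n \<and> real (e i) \<le> b. (real (e i))\<^sup>2)"
proof -
  let ?q = "\<lambda>i j. min 1 (real (e i) * real (e j) / (tot - 1))"
  have edge: "measure_pmf.expectation \<M> (\<lambda>m. real (ecm_edges n d m i j)) \<le> ?q i j" if ij: "i < n" "j < n" for i j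
  proof -
    let ?P = "{m. \<exists>h\<in>V i. \<exists>g\<in>V j. m h = g}"
    have "measure_pmf.expectation \<M> (\<lambda>m. real (ecm_edges n d m i j)) \<le> measure_pmf.expectation \<M> (indicator ?P)"
    proof (rule integral_mono_AE)
      show "AE m in measure_pmf \<M>. real (ecm_edges n d m i j) \<le> indicator ?P m"
      proof (rule AE_pmfI)
        fix m assume "m \<in> set_pmf \<M>"
        then have m: "m \<in> perfect_matchings H" by (simp add: set_matchings)
        show "real (ecm_edges n d m i j) \<le> indicator ?P m"
        proof (cases "ecm_edges n d m i j = 0")
          case False
          then have "0 < cm_edges n d m i j" by (auto simp: ecm_edges_def split: if_splits)
          then obtain h where "h \<in> H" "fst h = i" "fst (m h) = j"
            unfolding cm_edges_def by (auto simp: card_gt_0_iff)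
          then have "h \<in> V i" "m h \<in> V j" using m by (auto simp: V_def perfect_matchings_def)
          then have "m \<in> ?P" by blast
          then show ?thesis by (simp add: ecm_edges_def)
        qed simp
      qed
    qed auto
    also have "\<dots> = measure_pmf.prob \<M> ?P" by simp
    also have "\<dots> \<le> ?q i j"
    proof (rule min.boundedI)
      have "measure_pmf.prob \<M> ?P \<le> real (card (V i)) * (real (card (V j)) * (1 / (tot - 1)))"
        unfolding tot_def using V_subset by (intro prob_UN_le finite_V prob_match_one) auto
      then show "measure_pmf.prob \<M> ?P \<le> real (e i) * real (e j) / (tot - 1)" using ij by (simp add: card_V)
    qed simp
    finally show ?thesis .
  qed
  have "measure_pmf.expectation \<M> (\<lambda>m. \<Sum>i<n. \<Sum>j<n. real (ecm_edges n d m i j) * real (ecm_degree n d m i) * real (ecm_degree n d m j))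
     \<le> measure_pmf.expectation \<M> (\<lambda>m. \<Sum>i<n. \<Sum>j<n. real (ecm_edges n d m i j) * real (e i) * real (e j))"
    by (intro integral_mono integrable_M sum_mono mult_mono) (auto simp: ecm_degree_le)
  also have "\<dots> = (\<Sum>i<n. \<Sum>j<n. measure_pmf.expectation \<M> (\<lambda>m. real (ecm_edges n d m i j)) * real (e i) * real (e j))"
    by simp
  also have "\<dots> \<le> (\<Sum>i<n. \<Sum>j<n. ?q i j * real (e i) * real (e j))"
    by (intro sum_mono mult_right_mono edge) auto
  also have "\<dots> \<le> (\<Sum>i<n. \<Sum>j<n. (real (e i))\<^sup>2 * (real (e j))\<^sup>2 / b\<^sup>2
       + 1 / (tot - 1) * ((if real (e i) \<le> b then (real (e i))\<^sup>2 else 0) * (real (e j))\<^sup>2)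
       + 1 / (tot - 1) * ((real (e i))\<^sup>2 * (if real (e j) \<le> b then (real (e j))\<^sup>2 else 0)))"
  proof (intro sum_mono)
    fix i j
    define x where "x = real (e i)"
    define y where "y = real (e j)"
    \<comment> \<open>If both degrees exceed \<open>b\<close>, then
      \<open>x * y \<le> x\<^sup>2 * y\<^sup>2 / b\<^sup>2\<close>, so the factor
      \<open>1 / tot\<close> is replaced by \<open>1 / b\<^sup>2\<close>, which is smaller for the
      \<open>b\<close> chosen later. Otherwise one of the two truncated squares is present in
      full.\<close>
    have xy: "0 \<le> x" "0 \<le> y" by (auto simp: x_def y_def)
    have l1: "0 < tot - 1" using tot_ge by simp
    have main: "min 1 (x * y / (tot - 1)) * x * y \<le> x\<^sup>2 * y\<^sup>2 / b\<^sup>2 + 1 / (tot - 1) * ((if x \<le> b then x\<^sup>2 else 0) * y\<^sup>2)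
       + 1 / (tot - 1) * (x\<^sup>2 * (if y \<le> b then y\<^sup>2 else 0))"
    proof (cases "b < x \<and> b < y")
      case True
      then have "b * b \<le> x * y" using b by (intro mult_mono) auto
      then have "1 \<le> x * y / b\<^sup>2" using b by (simp add: power2_eq_square)
      then have "x * y * 1 \<le> x * y * (x * y / b\<^sup>2)" using xy by (intro mult_left_mono) auto
      moreover have "min 1 (x * y / (tot - 1)) * (x * y) \<le> 1 * (x * y)" using xy by (intro mult_right_mono) auto
      ultimately show ?thesis using True xy by (simp add: power2_eq_square mult_ac)
    next
      case False
      have "min 1 (x * y / (tot - 1)) * (x * y) \<le> x * y / (tot - 1) * (x * y)" using xy by (intro mult_right_mono) auto
      also have "\<dots> = 1 / (tot - 1) * (x\<^sup>2 * y\<^sup>2)" by (simp add: power2_eq_square mult_ac)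
      also have "\<dots> \<le> 1 / (tot - 1) * ((if x \<le> b then x\<^sup>2 else 0) * y\<^sup>2) + 1 / (tot - 1) * (x\<^sup>2 * (if y \<le> b then y\<^sup>2 else 0))"
        using False l1 by auto
      finally have "min 1 (x * y / (tot - 1)) * (x * y) \<le> 1 / (tot - 1) * ((if x \<le> b then x\<^sup>2 else 0) * y\<^sup>2) + 1 / (tot - 1) * (x\<^sup>2 * (if y \<le> b then y\<^sup>2 else 0))" .
      moreover have "0 \<le> x\<^sup>2 * y\<^sup>2 / b\<^sup>2" by simp
      ultimately show ?thesis by (simp only: mult.assoc)
    qed
    show "?q i j * real (e i) * real (e j) \<le> (real (e i))\<^sup>2 * (real (e j))\<^sup>2 / b\<^sup>2
       + 1 / (tot - 1) * ((if real (e i) \<le> b then (real (e i))\<^sup>2 else 0) * (real (e j))\<^sup>2)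
       + 1 / (tot - 1) * ((real (e i))\<^sup>2 * (if real (e j) \<le> b then (real (e j))\<^sup>2 else 0))"
      using main unfolding x_def y_def .
  qed
  also have "\<dots> = (\<Sum>i<n. (real (e i))\<^sup>2) * (\<Sum>i<n. (real (e i))\<^sup>2) / b\<^sup>2
       + 1 / (tot - 1) * ((\<Sum>i<n. if real (e i) \<le> b then (real (e i))\<^sup>2 else 0) * (\<Sum>i<n. (real (e i))\<^sup>2))
       + 1 / (tot - 1) * ((\<Sum>i<n. (real (e i))\<^sup>2) * (\<Sum>i<n. if real (e i) \<le> b then (real (e i))\<^sup>2 else 0))"
    unfolding sum_product by (simp only: sum.distrib sum_distrib_left sum_divide_distrib)
  also have "(\<Sum>i<n. if real (e i) \<le> b then (real (e i))\<^sup>2 else 0) = (\<Sum>i | i < n \<and> real (e i) \<le> b. (real (e i))\<^sup>2)"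
    by (subst sum.inter_filter[symmetric]) (auto intro!: sum.cong)
  finally show ?thesis by (simp add: power2_eq_square mult_ac)
qed

end

section \<open>Typical degree sequences\<close>

lemma pmf_Markov:
  fixes u :: "'a \<Rightarrow> real"
  assumes "integrable (measure_pmf q) u" "\<And>x. x \<in> set_pmf q \<Longrightarrow> 0 \<le> u x" "0 < c"
  shows "measure_pmf.prob q {x. c < u x} \<le> measure_pmf.expectation q u / c"
proof -
  have "measure_pmf.prob q {x. c < u x} \<le> measure_pmf.prob q {x \<in> space (measure_pmf q). c \<le> u x}"
    by (intro measure_pmf.finite_measure_mono) auto
  also have "\<dots> \<le> measure_pmf.expectation q u / c"
    using assms by (intro integral_Markov_inequality_measure[where A="{}"]) (auto intro!: AE_pmfI)
  finally show ?thesis .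
qed

lemma measure_pmf_Un_le: "measure_pmf.prob q (A \<union> B) \<le> measure_pmf.prob q A + measure_pmf.prob q B"
  by (intro measure_Un_le) auto

lemma powr_neg_small:
  fixes g e :: real
  assumes "0 < g" "0 < e" obtains y where "0 < y" "y powr (- g) < e"
proof -
  have "((\<lambda>x::real. x powr (- g)) \<longlongrightarrow> 0) at_top"
    using assms by (intro tendsto_neg_powr filterlim_ident) auto
  then have "\<forall>\<^sub>F x in at_top. x powr (- g) < e \<and> 0 < x"
    using assms by (intro eventually_conj order_tendstoD eventually_gt_at_top) auto
  then obtain y where "0 < y" "y powr (- g) < e" by (auto simp: eventually_at_top_linorder)
  then show ?thesis using that by blast
qed

context heavy_tail
begin

definition \<mu> :: real where "\<mu> = measure_pmf.expectation p real"
abbreviation an :: "nat \<Rightarrow> real" where "an n \<equiv> \<a> (real n)"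
text \<open>\<open>Kn\<close> tends to infinity while \<open>Kn\<close> times the maximal degree is \<open>o(n)\<close>;
  \<open>bn\<close> is \<open>o(a\<^sub>n)\<close> while \<open>n = o(bn\<^sup>2)\<close>.\<close>
definition Kn :: "nat \<Rightarrow> real" where "Kn n = sqrt (real n / an n)"
definition bn :: "nat \<Rightarrow> real" where "bn n = sqrt (an n * sqrt (real n))"

lemma mean_pos: "0 < \<mu>"
proof -
  have "0 < \<T> 0" by (rule tail_pos)
  have "0 \<le> \<mu>" unfolding \<mu>_def by (intro Bochner_Integration.integral_nonneg) auto
  moreover have "\<mu> \<noteq> 0"
  proof
    assume "\<mu> = 0"
    then have "AE k in measure_pmf p. real k = 0"
      unfolding \<mu>_def by (subst (asm) integral_nonneg_eq_0_iff_AE[OF integrable_degree]) auto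
    then have "measure_pmf.prob p {k. 0 < real k} = measure_pmf.prob p {}"
      by (intro measure_pmf.finite_measure_eq_AE) (auto simp: AE_measure_pmf_iff)
    then show False using \<open>0 < \<T> 0\<close> by (simp add: tail_prob_def)
  qed
  ultimately show ?thesis by simp
qed

lemma an_at_top: "filterlim an at_top sequentially"
  by (rule filterlim_compose[OF quantile_at_top filterlim_real_sequentially])

lemma an_over_n: "(\<lambda>n. an n / real n) \<longlonglongrightarrow> 0"
  by (rule filterlim_compose[OF quantile_over_id filterlim_real_sequentially])

lemma an_sq_over_n: "filterlim (\<lambda>n. (an n)\<^sup>2 / real n) at_top sequentially"
  by (rule filterlim_compose[OF quantile_sq_over_id filterlim_real_sequentially])

lemma n_over_an_at_top: "filterlim (\<lambda>n. real n / an n) at_top sequentially"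
proof -
  have "filterlim (\<lambda>n. an n / real n) (at_right 0) sequentially"
    unfolding filterlim_at
  proof
    show "\<forall>\<^sub>F n in sequentially. an n / real n \<in> {0<..} \<and> an n / real n \<noteq> 0"
      using quantile_eventually_pos eventually_gt_at_top[of 0] by eventually_elim simp
  qed (rule an_over_n)
  from filterlim_compose[OF filterlim_inverse_at_top_right this]
  show ?thesis by (simp add: inverse_eq_divide)
qed

lemma Kn_at_top: "filterlim Kn at_top sequentially"
  unfolding Kn_def by (rule filterlim_compose[OF sqrt_at_top n_over_an_at_top])

lemma sqrt_n_over_an: "(\<lambda>n. sqrt (real n) / an n) \<longlonglongrightarrow> 0"
proof -
  have "filterlim (\<lambda>n. sqrt ((an n)\<^sup>2 / real n)) at_top sequentially"
    by (rule filterlim_compose[OF sqrt_at_top an_sq_over_n])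
  then have "filterlim (\<lambda>n. an n / sqrt (real n)) at_top sequentially"
    by (simp add: real_sqrt_divide tail_quantile_nonneg)
  from tendsto_inverse_0_at_top[OF this] show ?thesis by (simp add: inverse_eq_divide)
qed

text \<open>\<open>bn\<close> is the geometric mean of \<open>an\<close> and \<open>sqrt n\<close>,
  hence it separates these two scales.\<close>

lemma bn_over_an: "(\<lambda>n. bn n / an n) \<longlonglongrightarrow> 0"
proof -
  have "(\<lambda>n. sqrt (sqrt (real n) / an n)) \<longlonglongrightarrow> sqrt 0"
    by (intro tendsto_real_sqrt sqrt_n_over_an)
  moreover have "\<forall>\<^sub>F n in sequentially. sqrt (sqrt (real n) / an n) = bn n / an n"
    using quantile_eventually_pos
  proof eventually_elim
    case (elim n)
    have "sqrt (an n * sqrt (real n)) / an n = sqrt (an n * sqrt (real n)) / sqrt ((an n)\<^sup>2)" using elim by simp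
    also have "\<dots> = sqrt (an n * sqrt (real n) / (an n)\<^sup>2)" by (simp only: real_sqrt_divide)
    also have "an n * sqrt (real n) / (an n)\<^sup>2 = sqrt (real n) / an n" using elim by (simp add: power2_eq_square)
    finally show ?case by (simp add: bn_def)
  qed
  ultimately show ?thesis by (simp add: tendsto_cong)
qed

section \<open>Properties of the degree sequence that hold with probability tending to 1\<close>

lemma deg_law_component:
  assumes "i < n" shows "measure_pmf.prob (deg_law n) {d. P (d i)} = measure_pmf.prob p {k. P k}"
proof -
  have "measure_pmf.prob (deg_law n) {d. P (d i)} = measure_pmf.prob (map_pmf (\<lambda>d. d i) (deg_law n)) {k. P k}"
    by (simp add: vimage_def)
  also have "\<dots> = measure_pmf.prob p {k. P k}" using assms by (subst Pi_pmf_component) auto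
  finally show ?thesis .
qed

lemma deg_law_sum_Markov:
  fixes h :: "nat \<Rightarrow> real"
  assumes "integrable (measure_pmf p) h" "\<And>x. 0 \<le> h x" "0 < c"
  shows "measure_pmf.prob (deg_law n) {d. c < (\<Sum>i<n. h (d i))} \<le> real n * measure_pmf.expectation p h / c"
proof -
  have "measure_pmf.prob (deg_law n) {d. c < (\<Sum>i<n. h (d i))}
      \<le> measure_pmf.expectation (deg_law n) (\<lambda>d. \<Sum>i<n. h (d i)) / c"
    using assms by (intro pmf_Markov integrable_sum_Pi_pmf) (auto intro: sum_nonneg)
  also have "measure_pmf.expectation (deg_law n) (\<lambda>d. \<Sum>i<n. h (d i)) = real n * measure_pmf.expectation p h"
    using assms by (subst expectation_sum_Pi_pmf) auto
  finally show ?thesis .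
qed

text \<open>Convergence of the Laplace transform at \<open>1\<close> and \<open>2\<close> to that of a constant gives
  \<open>L\<^sup>2\<close> convergence of \<open>exp (- X)\<close>, so no variance (infinite here) is needed.\<close>
lemma weak_law_degrees:
  assumes \<delta>: "0 < \<delta>"
  shows "(\<lambda>n. measure_pmf.prob (deg_law n) {d. \<delta> * real n < \<bar>(\<Sum>i<n. real (d i)) - \<mu> * real n\<bar>}) \<longlonglongrightarrow> 0"
proof -
  define X where "X n d = (\<Sum>i<n. real (d i)) / real n" for n and d :: "nat \<Rightarrow> nat"
  have lap: "(\<lambda>n. measure_pmf.expectation (deg_law n) (\<lambda>d. exp (- r * X n d))) \<longlonglongrightarrow> exp (- (r * \<mu>))"
    if r: "0 < r" for r :: real
  proof -
    let ?E = "\<lambda>n. measure_pmf.expectation p (\<lambda>k. exp (- r * (real k / real n)))"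
    have int: "integrable (measure_pmf p) (\<lambda>k. exp (- r * (real k / real n)))" for n
      using r by (intro measure_pmf.integrable_const_bound[where B=1]) auto
    have E01: "0 \<le> ?E n" "?E n \<le> 1" for n
    proof -
      show "0 \<le> ?E n" by (intro Bochner_Integration.integral_nonneg) auto
      have "?E n \<le> measure_pmf.expectation p (\<lambda>d. 1)" using r int by (intro integral_mono) auto
      then show "?E n \<le> 1" by simp
    qed
    have "(\<lambda>n. measure_pmf.expectation p (\<lambda>k. real n * (1 - exp (- r * (real k / real n)))))
        \<longlonglongrightarrow> measure_pmf.expectation p (\<lambda>k. r * real k)"
    proof (rule integral_dominated_convergence[where w="\<lambda>k. r * real k"])
      show "integrable (measure_pmf p) (\<lambda>k. r * real k)" using integrable_degree by simp
      show "AE k in measure_pmf p. norm (real n * (1 - exp (- r * (real k / real n)))) \<le> r * real k" for n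
      proof (rule AE_I2)
        fix k
        have "1 - exp (- r * (real k / real n)) \<le> r * (real k / real n)"
          using exp_ge_add_one_self[of "- r * (real k / real n)"] by simp
        then have "real n * (1 - exp (- r * (real k / real n))) \<le> real n * (r * (real k / real n))"
          by (intro mult_left_mono) auto
        also have "\<dots> \<le> r * real k" using r by (cases "n = 0") auto
        finally show "norm (real n * (1 - exp (- r * (real k / real n)))) \<le> r * real k" using r by simp
      qed
      show "AE k in measure_pmf p. (\<lambda>n. real n * (1 - exp (- r * (real k / real n)))) \<longlonglongrightarrow> r * real k"
      proof (rule AE_I2)
        fix k :: nat
        define c where "c = r * real k"
        \<comment> \<open>The pointwise limit is a derivative at 0, sampled along
          \<open>1 / n\<close>.\<close>
        have "((\<lambda>x::real. exp (- c * x)) has_real_derivative - c) (at 0)"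
          by (auto intro!: derivative_eq_intros)
        then have "((\<lambda>h. (exp (- c * h) - 1) / h) \<longlongrightarrow> - c) (at 0)"
          by (simp add: has_field_derivative_iff)
        moreover have "filterlim (\<lambda>n. 1 / real n) (at 0) sequentially"
          unfolding filterlim_at using lim_1_over_n eventually_gt_at_top[of 0] by (auto elim: eventually_mono)
        ultimately have "(\<lambda>n. (exp (- c * (1 / real n)) - 1) / (1 / real n)) \<longlonglongrightarrow> - c"
          by (rule filterlim_compose)
        from tendsto_minus[OF this]
        have "(\<lambda>n. real n * (1 - exp (- c / real n))) \<longlonglongrightarrow> c" by (simp add: algebra_simps)
        then show "(\<lambda>n. real n * (1 - exp (- r * (real k / real n)))) \<longlonglongrightarrow> r * real k"
          by (simp add: c_def)
      qed
    qed auto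
    then have c: "(\<lambda>n. real n * (1 - ?E n)) \<longlonglongrightarrow> r * \<mu>"
      using int by (simp add: \<mu>_def)
    have "(\<lambda>n. (1 - real n * (1 - ?E n) / real n) ^ n) \<longlonglongrightarrow> exp (- (r * \<mu>))"
    proof (rule tendsto_one_minus_power_exp[OF c])
      show "\<bar>1 - real n * (1 - ?E n) / real n\<bar> \<le> 1" for n using E01[of n] by (cases "n = 0") auto
    qed
    moreover have "(1 - real n * (1 - ?E n) / real n) ^ n = measure_pmf.expectation (deg_law n) (\<lambda>d. exp (- r * X n d))" for n
    proof -
      have "exp (- r * X n d) = (\<Prod>i<n. exp (- r * (real (d i) / real n)))" for d
        by (simp add: X_def exp_sum[symmetric] sum_negf sum_distrib_left sum_divide_distrib)
      then have "measure_pmf.expectation (deg_law n) (\<lambda>d. exp (- r * X n d)) = (\<Prod>i<n. ?E n)"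
        using int by (simp only:) (subst expectation_prod_Pi_pmf, auto)
      then show ?thesis by (cases "n = 0") auto
    qed
    ultimately show ?thesis by simp
  qed
  define Z where "Z n d = (exp (- X n d) - exp (- \<mu>))\<^sup>2" for n d
  have X0: "0 \<le> X n d" for n d by (auto simp: X_def intro!: divide_nonneg_nonneg sum_nonneg)
  have int1: "integrable (deg_law n) (\<lambda>d. exp (- r * X n d))" if "0 < r" for n r
    using that X0 by (intro measure_pmf.integrable_const_bound[where B=1]) auto
  have Zeq: "Z n d = exp (- 2 * X n d) - 2 * exp (- \<mu>) * exp (- 1 * X n d) + exp (- \<mu>) * exp (- \<mu>)" for n d
    by (simp add: Z_def power2_eq_square algebra_simps exp_add[symmetric])
  have intZ: "integrable (deg_law n) (Z n)" for n
    unfolding Zeq using int1[of 2 n] int1[of 1 n] by simp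
  have EZ: "(\<lambda>n. measure_pmf.expectation (deg_law n) (Z n)) \<longlonglongrightarrow> 0"
  proof -
    have "measure_pmf.expectation (deg_law n) (Z n) = measure_pmf.expectation (deg_law n) (\<lambda>d. exp (- 2 * X n d))
        - 2 * exp (- \<mu>) * measure_pmf.expectation (deg_law n) (\<lambda>d. exp (- 1 * X n d)) + exp (- \<mu>) * exp (- \<mu>)" for n
      unfolding Zeq using int1[of 2 n] int1[of 1 n] by simp
    moreover have "(\<lambda>n. measure_pmf.expectation (deg_law n) (\<lambda>d. exp (- 2 * X n d))
        - 2 * exp (- \<mu>) * measure_pmf.expectation (deg_law n) (\<lambda>d. exp (- 1 * X n d)) + exp (- \<mu>) * exp (- \<mu>))
        \<longlonglongrightarrow> exp (- (2 * \<mu>)) - 2 * exp (- \<mu>) * exp (- (1 * \<mu>)) + exp (- \<mu>) * exp (- \<mu>)"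
      by (intro tendsto_intros lap) auto
    moreover have "exp (- (2 * \<mu>)) - 2 * exp (- \<mu>) * exp (- (1 * \<mu>)) + exp (- \<mu>) * exp (- \<mu>) = 0"
      by (simp add: mult.assoc exp_add[symmetric])
    ultimately show ?thesis by (simp only:)
  qed
  \<comment> \<open>The smallest change of \<open>exp (- X)\<close> that a deviation of X from \<mu>
    by at least \<delta> can produce, on either side.\<close>
  define c where "c = min (exp (- (\<mu> - \<delta>)) - exp (- \<mu>)) (exp (- \<mu>) - exp (- (\<mu> + \<delta>)))"
  have c0: "0 < c" using \<delta> by (auto simp: c_def)
  \<comment> \<open>Half of \<open>c\<^sup>2\<close> provides the strict inequality that
    \<open>pmf_Markov\<close> expects.\<close>
  have sub: "c\<^sup>2 / 2 < Z n d" if n: "0 < n" and d: "\<delta> * real n < \<bar>(\<Sum>i<n. real (d i)) - \<mu> * real n\<bar>" for n d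
  proof -
    have "X n d - \<mu> = ((\<Sum>i<n. real (d i)) - \<mu> * real n) / real n" using n by (simp add: X_def field_simps)
    then have "\<bar>X n d - \<mu>\<bar> = \<bar>(\<Sum>i<n. real (d i)) - \<mu> * real n\<bar> / real n" using n by (simp add: abs_divide)
    then have "\<delta> < \<bar>X n d - \<mu>\<bar>" using n d by (simp add: pos_less_divide_eq)
    then consider "X n d < \<mu> - \<delta>" | "\<mu> + \<delta> < X n d" by linarith
    then have "c \<le> \<bar>exp (- X n d) - exp (- \<mu>)\<bar>"
    proof cases
      case 1
      then have "exp (- (\<mu> - \<delta>)) \<le> exp (- X n d)" by simp
      then show ?thesis unfolding c_def by linarith
    next
      case 2
      then have "exp (- X n d) \<le> exp (- (\<mu> + \<delta>))" by simp
      then show ?thesis unfolding c_def by linarith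
    qed
    then have "c\<^sup>2 \<le> Z n d" unfolding Z_def using c0 by (subst power2_abs[symmetric]) (intro power_mono, auto)
    moreover have "c\<^sup>2 / 2 < c\<^sup>2" using c0 by simp
    ultimately show ?thesis by linarith
  qed
  have lim: "(\<lambda>n. measure_pmf.expectation (deg_law n) (Z n) / (c\<^sup>2 / 2)) \<longlonglongrightarrow> 0"
    using tendsto_divide[OF EZ tendsto_const[of "c\<^sup>2 / 2"]] c0 by simp
  show ?thesis
  proof (rule tendsto_sandwich[OF _ _ tendsto_const lim])
    show "\<forall>\<^sub>F n in sequentially. measure_pmf.prob (deg_law n) {d. \<delta> * real n < \<bar>(\<Sum>i<n. real (d i)) - \<mu> * real n\<bar>}
        \<le> measure_pmf.expectation (deg_law n) (Z n) / (c\<^sup>2 / 2)"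
      using eventually_gt_at_top[of 0]
    proof eventually_elim
      case (elim n)
      have "measure_pmf.prob (deg_law n) {d. \<delta> * real n < \<bar>(\<Sum>i<n. real (d i)) - \<mu> * real n\<bar>}
          \<le> measure_pmf.prob (deg_law n) {d. c\<^sup>2 / 2 < Z n d}"
        using sub[OF elim] by (intro measure_pmf.finite_measure_mono) auto
      also have "\<dots> \<le> measure_pmf.expectation (deg_law n) (Z n) / (c\<^sup>2 / 2)"
        using c0 by (intro pmf_Markov intZ) (auto simp: Z_def)
      finally show ?case .
    qed
  qed simp
qed

text \<open>The truncated mean tends to 0 by dominated convergence, with no rate: finiteness of the
  mean and \<open>Kn\<close> tending to infinity give it.\<close>

lemma high_degrees_negligible:
  assumes \<delta>: "0 < \<delta>"
  shows "(\<lambda>n. measure_pmf.prob (deg_law n)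
    {d. \<delta> * real n < (\<Sum>i<n. real (d i) * indicator {Kn n<..} (real (d i)))}) \<longlonglongrightarrow> 0"
proof -
  let ?h = "\<lambda>n k. real k * indicator {Kn n<..} (real k)"
  have int: "integrable (measure_pmf p) (?h n)" for n
    by (rule Bochner_Integration.integrable_bound[OF integrable_degree]) (auto simp: indicator_def)
  have "(\<lambda>n. measure_pmf.expectation p (?h n)) \<longlonglongrightarrow> measure_pmf.expectation p (\<lambda>_. 0)"
  proof (rule integral_dominated_convergence[where w=real])
    show "integrable (measure_pmf p) real" by (rule integrable_degree)
    show "AE k in measure_pmf p. (\<lambda>n. ?h n k) \<longlonglongrightarrow> 0"
    proof (rule AE_I2)
      fix k :: nat
      have "\<forall>\<^sub>F n in sequentially. real k < Kn n" using Kn_at_top by (simp add: filterlim_at_top_dense)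
      then have "\<forall>\<^sub>F n in sequentially. ?h n k = 0" by eventually_elim (auto simp: indicator_def)
      then show "(\<lambda>n. ?h n k) \<longlonglongrightarrow> 0" by (rule tendsto_eventually)
    qed
  qed (auto simp: indicator_def)
  then have "(\<lambda>n. measure_pmf.expectation p (?h n)) \<longlonglongrightarrow> 0" by simp
  from tendsto_divide[OF this tendsto_const[of \<delta>]]
  have lim: "(\<lambda>n. measure_pmf.expectation p (?h n) / \<delta>) \<longlonglongrightarrow> 0" using \<delta> by simp
  show ?thesis
  proof (rule tendsto_sandwich[OF _ _ tendsto_const lim])
    show "\<forall>\<^sub>F n in sequentially. measure_pmf.prob (deg_law n) {d. \<delta> * real n < (\<Sum>i<n. ?h n (d i))}
        \<le> measure_pmf.expectation p (?h n) / \<delta>"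
      using eventually_gt_at_top[of 0]
    proof eventually_elim
      case (elim n)
      then show ?case using deg_law_sum_Markov[OF int[of n], where c="\<delta> * real n" and n=n] \<delta> by (simp add: field_simps)
    qed
  qed simp
qed

text \<open>Markov's inequality with \<open>truncated_second_moment\<close> at the level
  \<open>e = bn n / an n\<close>, which tends to 0.\<close>

lemma low_squares_negligible:
  assumes \<delta>: "0 < \<delta>"
  shows "(\<lambda>n. measure_pmf.prob (deg_law n)
    {d. \<delta> * (an n)\<^sup>2 < (\<Sum>i<n. (real (d i))\<^sup>2 * indicator {..bn n} (real (d i)))}) \<longlonglongrightarrow> 0"
proof -
  obtain C t0 where C: "0 < C" "1 \<le> t0"
    "\<And>t e. t0 \<le> t \<Longrightarrow> 0 < e \<Longrightarrow> e \<le> 1 \<Longrightarrow>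
       t * measure_pmf.expectation p (\<lambda>d. (real d)\<^sup>2 * indicator {..e * \<a> t} (real d)) \<le> C * e powr (2 - gp) * (\<a> t)\<^sup>2"
    using truncated_second_moment by blast
  let ?h = "\<lambda>n k. (real k)\<^sup>2 * indicator {..bn n} (real k)"
  have int: "integrable (measure_pmf p) (?h n)" for n
  proof (rule measure_pmf.integrable_const_bound[where B="(bn n)\<^sup>2"])
    show "AE k in measure_pmf p. norm (?h n k) \<le> (bn n)\<^sup>2"
      by (intro AE_I2) (auto simp: indicator_def power_mono)
  qed auto
  have "(\<lambda>n. C * (bn n / an n) powr (2 - gp) / \<delta>) \<longlonglongrightarrow> C * 0 / \<delta>"
  proof (intro tendsto_divide tendsto_mult tendsto_const)
    show "(\<lambda>n. (bn n / an n) powr (2 - gp)) \<longlonglongrightarrow> 0"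
      using tendsto_powr'[OF bn_over_an tendsto_const[of "2 - gp"]] gp_gm
      by (auto simp: bn_def tail_quantile_nonneg)
  qed (use \<delta> in simp)
  then have lim: "(\<lambda>n. C * (bn n / an n) powr (2 - gp) / \<delta>) \<longlonglongrightarrow> 0" by simp
  have le1: "\<forall>\<^sub>F n in sequentially. bn n / an n < 1" using bn_over_an by (rule order_tendstoD) simp
  show ?thesis
  proof (rule tendsto_sandwich[OF _ _ tendsto_const lim])
    show "\<forall>\<^sub>F n in sequentially. measure_pmf.prob (deg_law n) {d. \<delta> * (an n)\<^sup>2 < (\<Sum>i<n. ?h n (d i))}
        \<le> C * (bn n / an n) powr (2 - gp) / \<delta>"
      using quantile_eventually_pos le1 eventually_ge_at_top[of "nat \<lceil>t0\<rceil>"] eventually_gt_at_top[of 0]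
    proof eventually_elim
      case (elim n)
      have t0: "t0 \<le> real n" using elim by linarith
      have b: "0 < bn n" using elim by (simp add: bn_def)
      have "real n * measure_pmf.expectation p (?h n) \<le> C * (bn n / an n) powr (2 - gp) * (an n)\<^sup>2"
        using C(3)[OF t0, of "bn n / an n"] elim b by simp
      then have "real n * measure_pmf.expectation p (?h n) / (\<delta> * (an n)\<^sup>2) \<le> C * (bn n / an n) powr (2 - gp) / \<delta>"
        using elim \<delta> by (simp add: field_simps)
      moreover have "measure_pmf.prob (deg_law n) {d. \<delta> * (an n)\<^sup>2 < (\<Sum>i<n. ?h n (d i))}
          \<le> real n * measure_pmf.expectation p (?h n) / (\<delta> * (an n)\<^sup>2)"
        using elim \<delta> by (intro deg_law_sum_Markov int) auto
      ultimately show ?case by linarith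
    qed
  qed simp
qed

text \<open>The threshold is \<open>\<delta> * Kn n * an n\<close>, which exceeds every fixed
  multiple of the quantile; a union bound then compares with the limits
  \<open>y powr (- \<gamma>)\<close> for large \<open>y\<close>.\<close>

lemma max_degree_negligible:
  assumes \<delta>: "0 < \<delta>"
  shows "(\<lambda>n. measure_pmf.prob (deg_law n) {d. \<exists>i<n. \<delta> * sqrt (real n * an n) < real (d i)}) \<longlonglongrightarrow> 0"
proof -
  have lim: "(\<lambda>n. real n * \<T> (\<delta> * sqrt (real n * an n))) \<longlonglongrightarrow> 0"
  proof (rule order_tendstoI)
    fix z :: real assume "z < 0"
    then show "\<forall>\<^sub>F n in sequentially. z < real n * \<T> (\<delta> * sqrt (real n * an n))"
      by (intro always_eventually allI) (meson less_le_trans mult_nonneg_nonneg of_nat_0_le_iff tail_prob_nonneg)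
  next
    fix z :: real assume "0 < z"
    then obtain y where y: "0 < y" "y powr (- \<gamma>) < z" using powr_neg_small[of \<gamma> z] gamma_gt_1 by auto
    have "\<forall>\<^sub>F n in sequentially. real n * \<T> (an n * y) < z"
      using filterlim_compose[OF tail_scaled[OF y(1)] filterlim_real_sequentially] y(2) by (rule order_tendstoD)
    moreover have "\<forall>\<^sub>F n in sequentially. y / \<delta> < Kn n" using Kn_at_top by (simp add: filterlim_at_top_dense)
    ultimately show "\<forall>\<^sub>F n in sequentially. real n * \<T> (\<delta> * sqrt (real n * an n)) < z"
      using quantile_eventually_pos
    proof eventually_elim
      case (elim n)
      have "sqrt (real n * an n) = sqrt (real n / an n * (an n)\<^sup>2)" using elim by (simp add: power2_eq_square)
      also have "\<dots> = Kn n * an n" unfolding Kn_def real_sqrt_mult using elim by simp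
      finally have "an n * y \<le> \<delta> * sqrt (real n * an n)" using elim \<delta> by (simp add: field_simps)
      then have "real n * \<T> (\<delta> * sqrt (real n * an n)) \<le> real n * \<T> (an n * y)"
        by (intro mult_left_mono tail_prob_antimono) auto
      then show ?case using elim by linarith
    qed
  qed
  show ?thesis
  proof (rule tendsto_sandwich[OF _ _ tendsto_const lim])
    show "\<forall>\<^sub>F n in sequentially. measure_pmf.prob (deg_law n) {d. \<exists>i<n. \<delta> * sqrt (real n * an n) < real (d i)}
        \<le> real n * \<T> (\<delta> * sqrt (real n * an n))"
    proof (intro always_eventually allI)
      fix n
      let ?x = "\<delta> * sqrt (real n * an n)"
      have "{d. \<exists>i<n. ?x < real (d i)} = (\<Union>i<n. {d. ?x < real (d i)})" by auto
      then have "measure_pmf.prob (deg_law n) {d. \<exists>i<n. ?x < real (d i)} \<le> (\<Sum>i<n. measure_pmf.prob (deg_law n) {d. ?x < real (d i)})"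
        by (simp add: measure_pmf.finite_measure_subadditive_finite)
      also have "\<dots> = (\<Sum>i<n. \<T> ?x)"
        using deg_law_component[of _ n "\<lambda>k. ?x < real k"] by (intro sum.cong) (auto simp: tail_prob_def)
      finally show "measure_pmf.prob (deg_law n) {d. \<exists>i<n. ?x < real (d i)} \<le> real n * \<T> ?x" by simp
    qed
  qed simp
qed

text \<open>Vertex \<open>n - 1\<close> is the one that may receive the parity half-edge; a single
  degree is bounded in probability, hence small compared with the quantile.\<close>

lemma last_degree_negligible:
  assumes \<delta>: "0 < \<delta>"
  shows "(\<lambda>n. measure_pmf.prob (deg_law n) {d. \<delta> * an n < real (d (n - 1))}) \<longlonglongrightarrow> 0"
proof -
  have "filterlim (\<lambda>n. \<delta> * an n) at_top sequentially"
    using \<delta> by (intro filterlim_tendsto_pos_mult_at_top[OF tendsto_const _ an_at_top])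
  from filterlim_compose[OF tail_prob_tendsto_0 this]
  have "(\<lambda>n. \<T> (\<delta> * an n)) \<longlonglongrightarrow> 0" .
  moreover have "\<forall>\<^sub>F n in sequentially. \<T> (\<delta> * an n) = measure_pmf.prob (deg_law n) {d. \<delta> * an n < real (d (n - 1))}"
    using eventually_gt_at_top[of 0]
  proof eventually_elim
    case (elim n)
    then show ?case using deg_law_component[of "n - 1" n "\<lambda>k. \<delta> * an n < real k"] by (simp add: tail_prob_def)
  qed
  ultimately show ?thesis by (simp add: tendsto_cong)
qed

text \<open>The clauses concern the total, the share of high degrees, the squares of low degrees,
  the maximum, and the vertex changed by the parity correction. The values of the scaled sums are
  left free, since their limits are random.\<close>

definition good :: "real \<Rightarrow> nat \<Rightarrow> (nat \<Rightarrow> nat) \<Rightarrow> bool" where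
  "good \<delta> n d \<longleftrightarrow> \<bar>(\<Sum>i<n. real (d i)) - \<mu> * real n\<bar> \<le> \<delta> * real n
     \<and> (\<Sum>i<n. real (d i) * indicator {Kn n<..} (real (d i))) \<le> \<delta> * real n
     \<and> (\<Sum>i<n. (real (d i))\<^sup>2 * indicator {..bn n} (real (d i))) \<le> \<delta> * (an n)\<^sup>2
     \<and> (\<forall>i<n. real (d i) \<le> \<delta> * sqrt (real n * an n))
     \<and> real (d (n - 1)) \<le> \<delta> * an n"

lemma good_whp:
  assumes \<delta>: "0 < \<delta>"
  shows "(\<lambda>n. measure_pmf.prob (deg_law n) {d. \<not> good \<delta> n d}) \<longlonglongrightarrow> 0"
proof -
  let ?P = "\<lambda>n. measure_pmf.prob (deg_law n)"
  let ?A = "\<lambda>n. {d. \<delta> * real n < \<bar>(\<Sum>i<n. real (d i)) - \<mu> * real n\<bar>}"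
  let ?B = "\<lambda>n. {d. \<delta> * real n < (\<Sum>i<n. real (d i) * indicator {Kn n<..} (real (d i)))}"
  let ?C = "\<lambda>n. {d. \<delta> * (an n)\<^sup>2 < (\<Sum>i<n. (real (d i))\<^sup>2 * indicator {..bn n} (real (d i)))}"
  let ?D = "\<lambda>n. {d. \<exists>i<n. \<delta> * sqrt (real n * an n) < real (d i)}"
  let ?E = "\<lambda>n. {d. \<delta> * an n < real (d (n - 1))}"
  have "(\<lambda>n. ?P n (?A n) + (?P n (?B n) + (?P n (?C n) + (?P n (?D n) + ?P n (?E n))))) \<longlonglongrightarrow> 0 + (0 + (0 + (0 + 0)))"
    using \<delta> by (intro tendsto_add weak_law_degrees high_degrees_negligible low_squares_negligible
        max_degree_negligible last_degree_negligible)
  then have lim: "(\<lambda>n. ?P n (?A n) + (?P n (?B n) + (?P n (?C n) + (?P n (?D n) + ?P n (?E n))))) \<longlonglongrightarrow> 0" by simp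
  show ?thesis
  proof (rule tendsto_sandwich[OF _ _ tendsto_const lim])
    show "\<forall>\<^sub>F n in sequentially. ?P n {d. \<not> good \<delta> n d}
        \<le> ?P n (?A n) + (?P n (?B n) + (?P n (?C n) + (?P n (?D n) + ?P n (?E n))))"
    proof (intro always_eventually allI)
      fix n
      have "?P n {d. \<not> good \<delta> n d} \<le> ?P n (?A n \<union> (?B n \<union> (?C n \<union> (?D n \<union> ?E n))))"
        by (intro measure_pmf.finite_measure_mono) (auto simp: good_def not_le)
      also have "\<dots> \<le> ?P n (?A n) + (?P n (?B n) + (?P n (?C n) + (?P n (?D n) + ?P n (?E n))))"
        by (intro order_trans[OF measure_pmf_Un_le] add_left_mono order_refl)
      finally show "?P n {d. \<not> good \<delta> n d} \<le> ?P n (?A n) + (?P n (?B n) + (?P n (?C n) + (?P n (?D n) + ?P n (?E n))))" .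
    qed
  qed simp
qed

end

section \<open>Erasure on typical degree sequences\<close>

text \<open>Uniform continuity on a compact set. The variables stand for the scaled power sums
  (\<open>x'\<close>, \<open>y'\<close>), the mean degree \<open>l\<close>, the scaled edge sum
  \<open>t\<close> and the vanishing factor \<open>r = an / n\<close>.\<close>

lemma limit_ratio_uniform:
  fixes \<mu> c C \<eta> :: real
  assumes pos: "0 < \<mu>" "0 < c" "0 < C" "0 < \<eta>"
  obtains \<epsilon> where "0 < \<epsilon>"
    "\<And>x y x' y' l t r. c \<le> x \<Longrightarrow> x \<le> C \<Longrightarrow> c \<le> y \<Longrightarrow> y \<le> C \<Longrightarrow> \<bar>x' - x\<bar> \<le> \<epsilon> \<Longrightarrow> \<bar>y' - y\<bar> \<le> \<epsilon> \<Longrightarrow>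
      \<bar>l - \<mu>\<bar> \<le> \<epsilon> \<Longrightarrow> \<bar>t\<bar> \<le> \<epsilon> \<Longrightarrow> \<bar>r\<bar> \<le> \<epsilon> \<Longrightarrow>
      \<bar>\<mu> * ((t - x'\<^sup>2 / l) / (y' - r * (x'\<^sup>2 / l))) - - (x\<^sup>2 / y)\<bar> \<le> \<eta>"
proof -
  define \<Psi> :: "real \<times> real \<times> real \<times> real \<times> real \<Rightarrow> real"
    where "\<Psi> = (\<lambda>(x, y, l, t, r). \<mu> * ((t - x\<^sup>2 / l) / (y - r * (x\<^sup>2 / l))))"
  \<comment> \<open>This bound on \<open>r\<close> makes the subtracted term of the denominator at
    most \<open>c / 4\<close>, while the other term is at least \<open>c / 2\<close> on
    \<open>K\<close>.\<close>
  define \<rho> where "\<rho> = c / 4 / ((C + 1)\<^sup>2 / (\<mu> / 2))"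
  have \<rho>: "0 < \<rho>" using pos by (simp add: \<rho>_def)
  define K where "K = {0..C + 1} \<times> {c / 2..C + 1} \<times> {\<mu> / 2..2 * \<mu>} \<times> {- 1..1 :: real} \<times> {- \<rho>..\<rho>}"
  have cpt: "compact K" unfolding K_def by (intro compact_Times) auto
  have nz: "snd (snd z) = (l, t, r) \<Longrightarrow> l \<noteq> 0 \<and> fst (snd z) - r * ((fst z)\<^sup>2 / l) \<noteq> 0" if "z \<in> K" for z l t r
  proof -
    assume z: "snd (snd z) = (l, t, r)"
    have b: "0 \<le> fst z" "fst z \<le> C + 1" "c / 2 \<le> fst (snd z)" "\<mu> / 2 \<le> l" "\<bar>r\<bar> \<le> \<rho>"
      using that z by (auto simp: K_def)
    have "(fst z)\<^sup>2 / l \<le> (C + 1)\<^sup>2 / (\<mu> / 2)" using b pos by (intro frac_le power_mono) auto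
    moreover have q0: "0 \<le> (fst z)\<^sup>2 / l" using b pos by simp
    ultimately have "\<bar>r\<bar> * ((fst z)\<^sup>2 / l) \<le> \<rho> * ((C + 1)\<^sup>2 / (\<mu> / 2))" using b \<rho> by (intro mult_mono) auto
    also have "\<dots> = c / 4" using pos by (simp add: \<rho>_def)
    finally have "\<bar>r * ((fst z)\<^sup>2 / l)\<bar> \<le> c / 4" by (simp only: abs_mult abs_of_nonneg[OF q0])
    then have "r * ((fst z)\<^sup>2 / l) \<le> c / 4" by linarith
    then have "fst (snd z) - r * ((fst z)\<^sup>2 / l) \<noteq> 0" using b(3) pos(2) by linarith
    then show ?thesis using b(4) pos(1) by auto
  qed
  have cont: "continuous_on K \<Psi>"
    unfolding \<Psi>_def split_beta
    using nz by (intro continuous_intros) (auto simp: prod_eq_iff)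
  have "uniformly_continuous_on K \<Psi>" by (rule compact_uniformly_continuous[OF cont cpt])
  then obtain \<theta> where \<theta>: "0 < \<theta>" "\<And>z z'. z \<in> K \<Longrightarrow> z' \<in> K \<Longrightarrow> dist z' z < \<theta> \<Longrightarrow> dist (\<Psi> z') (\<Psi> z) < \<eta>"
    unfolding uniformly_continuous_on_def using pos by metis
  \<comment> \<open>Five coordinates move by at most \<epsilon>, so the distance is at most
    \<open>5 / 6 * \<theta>\<close>. The other entries keep the perturbed point inside
    \<open>K\<close>.\<close>
  define \<epsilon> where "\<epsilon> = Min {\<theta> / 6, c / 2, 1, \<mu> / 2, \<rho>}"
  have \<epsilon>: "0 < \<epsilon>" "\<epsilon> \<le> \<theta> / 6" "\<epsilon> \<le> c / 2" "\<epsilon> \<le> 1" "\<epsilon> \<le> \<mu> / 2" "\<epsilon> \<le> \<rho>"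
    using \<theta> pos \<rho> by (auto simp: \<epsilon>_def)
  have "\<bar>\<mu> * ((t - x'\<^sup>2 / l) / (y' - r * (x'\<^sup>2 / l))) - - (x\<^sup>2 / y)\<bar> \<le> \<eta>"
    if x: "c \<le> x" "x \<le> C" "c \<le> y" "y \<le> C" and x': "\<bar>x' - x\<bar> \<le> \<epsilon>" "\<bar>y' - y\<bar> \<le> \<epsilon>"
      "\<bar>l - \<mu>\<bar> \<le> \<epsilon>" "\<bar>t\<bar> \<le> \<epsilon>" "\<bar>r\<bar> \<le> \<epsilon>" for x y x' y' l t r
  proof -
    have zK: "(x, y, \<mu>, 0, 0) \<in> K" using x pos \<rho> by (auto simp: K_def)
    have z'K: "(x', y', l, t, r) \<in> K" using x x' \<epsilon> pos by (auto simp: K_def)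
    have "dist (x', y', l, t, r) (x, y, \<mu>, 0, 0) \<le> \<bar>x' - x\<bar> + \<bar>y' - y\<bar> + \<bar>l - \<mu>\<bar> + \<bar>t\<bar> + \<bar>r\<bar>"
    proof -
      have "dist (x', y', l, t, r) (x, y, \<mu>, 0, 0) \<le> dist x' x + dist (y', l, t, r) (y, \<mu>, 0, 0)"
        unfolding dist_Pair_Pair[of x'] by (rule sqrt_sum_squares_le_sum) auto
      moreover have "dist (y', l, t, r) (y, \<mu>, 0, 0) \<le> dist y' y + dist (l, t, r) (\<mu>, 0, 0)"
        unfolding dist_Pair_Pair[of y'] by (rule sqrt_sum_squares_le_sum) auto
      moreover have "dist (l, t, r) (\<mu>, 0, 0) \<le> dist l \<mu> + dist (t, r) (0, 0)"
        unfolding dist_Pair_Pair[of l] by (rule sqrt_sum_squares_le_sum) auto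
      moreover have "dist (t, r) (0, 0) \<le> dist t 0 + dist r 0"
        unfolding dist_Pair_Pair[of t] by (rule sqrt_sum_squares_le_sum) auto
      ultimately show ?thesis by (simp add: dist_real_def)
    qed
    also have "\<dots> < \<theta>" using x' \<epsilon> \<theta>(1) by linarith
    finally have "dist (\<Psi> (x', y', l, t, r)) (\<Psi> (x, y, \<mu>, 0, 0)) < \<eta>" by (rule \<theta>(2)[OF zK z'K])
    then show ?thesis using pos by (simp add: \<Psi>_def dist_real_def)
  qed
  then show ?thesis using that \<epsilon>(1) by blast
qed

lemma cm_degrees_ge: "d i \<le> cm_degrees n d i"
  and cm_degrees_le: "cm_degrees n d i \<le> d i + (if i = n - 1 then 1 else 0)"
  by (auto simp: cm_degrees_def)

text \<open>The parity correction alters a single summand, so passing from corrected to original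
  degrees costs one constant.\<close>

lemma sum_cm_degrees_le:
  fixes f g :: "nat \<Rightarrow> real"
  assumes "0 < n" "\<And>i. i < n \<Longrightarrow> f (cm_degrees n d i) \<le> g (d i) + (if i = n - 1 then c else 0)"
  shows "(\<Sum>i<n. f (cm_degrees n d i)) \<le> (\<Sum>i<n. g (d i)) + c"
proof -
  have "(\<Sum>i<n. f (cm_degrees n d i)) \<le> (\<Sum>i<n. g (d i) + (if i = n - 1 then c else 0))"
    by (intro sum_mono assms) auto
  also have "\<dots> = (\<Sum>i<n. g (d i)) + c" using assms(1) by (simp add: sum.distrib)
  finally show ?thesis .
qed

text \<open>One fixed \<open>n\<close> and one fixed typical sequence, so that the estimates are
  explicit and uniform in \<open>d\<close>; the largeness assumptions are discharged by
  \<open>eventually_large\<close>.\<close>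

locale typical_degrees = heavy_tail +
  fixes \<delta> :: real and n :: nat and d :: "nat \<Rightarrow> nat"
  assumes \<delta>: "0 < \<delta>" "\<delta> \<le> 1" "\<delta> \<le> \<mu> / 4"
    and good: "good \<delta> n d"
    and large: "1 \<le> an n" "1 \<le> \<delta> * an n" "an n \<le> real n" "sqrt (real n) + 1 \<le> \<delta> * real n" "16 \<le> \<mu> * real n"
      "0 < bn n" "2 * bn n + 1 \<le> \<delta> * (an n)\<^sup>2" "real n \<le> \<delta> * (bn n)\<^sup>2"
begin

lemma n_pos: "0 < real n" "0 < n"
  using large by (auto intro!: gr0I)

lemma degree_sum_bounds:
  "\<bar>(\<Sum>i<n. real (d i)) - \<mu> * real n\<bar> \<le> \<delta> * real n"
  "(\<Sum>i<n. real (cm_degrees n d i)) \<le> (\<Sum>i<n. real (d i)) + 1"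
  "(\<Sum>i<n. real (d i)) \<le> (\<Sum>i<n. real (cm_degrees n d i))"
proof -
  show "\<bar>(\<Sum>i<n. real (d i)) - \<mu> * real n\<bar> \<le> \<delta> * real n" using good by (simp add: good_def)
  show "(\<Sum>i<n. real (cm_degrees n d i)) \<le> (\<Sum>i<n. real (d i)) + 1"
  proof (rule sum_cm_degrees_le[OF n_pos(2)])
    fix i show "real (cm_degrees n d i) \<le> real (d i) + (if i = n - 1 then 1 else 0)"
      using cm_degrees_le[of n d i] by (auto split: if_splits)
  qed
  show "(\<Sum>i<n. real (d i)) \<le> (\<Sum>i<n. real (cm_degrees n d i))"
    by (intro sum_mono) (simp add: cm_degrees_ge)
qed

lemma degree_sum_lower: "3 / 4 * (\<mu> * real n) \<le> (\<Sum>i<n. real (cm_degrees n d i))"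
proof -
  have "\<delta> * real n \<le> \<mu> / 4 * real n" using \<delta> by (intro mult_right_mono) auto
  also have "\<dots> = (\<mu> * real n) / 4" by simp
  finally show ?thesis using degree_sum_bounds by linarith
qed

sublocale config_model n d
proof
  have "12 \<le> 3 / 4 * (\<mu> * real n)" using large(5) by linarith
  then have "12 \<le> real (card (half_edges n d))"
    using degree_sum_lower unfolding card_half_edges of_nat_sum by linarith
  then show "4 \<le> card (half_edges n d)" by simp
qed

lemma tot_bounds: "\<mu> * real n / 2 \<le> tot - 1" "tot / 2 \<le> tot - 3" "12 \<le> tot"
  "\<mu> * real n - \<delta> * real n \<le> tot" "tot \<le> \<mu> * real n + 2 * \<delta> * real n"
proof -
  have l: "3 / 4 * (\<mu> * real n) \<le> tot" using degree_sum_lower by (simp add: tot_eq)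
  show "\<mu> * real n / 2 \<le> tot - 1" using l large(5) by linarith
  show "12 \<le> tot" using l large(5) by linarith
  then show "tot / 2 \<le> tot - 3" by simp
  show "\<mu> * real n - \<delta> * real n \<le> tot" using degree_sum_bounds unfolding tot_eq by linarith
  have "1 \<le> \<delta> * real n" using large by (smt (verit) real_sqrt_ge_zero of_nat_0_le_iff)
  then show "tot \<le> \<mu> * real n + 2 * \<delta> * real n"
    using degree_sum_bounds unfolding tot_eq mult.assoc by linarith
qed

text \<open>The summand 1 here and in \<open>kap\<close> absorbs the parity half-edge.\<close>

definition "Md = \<delta> * sqrt (real n * an n) + 1"
definition "kap = Kn n + 1"

lemma e_le_Md: "i < n \<Longrightarrow> real (e i) \<le> Md"
proof -
  assume "i < n"
  then have "real (d i) \<le> \<delta> * sqrt (real n * an n)" using good by (simp add: good_def)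
  moreover have "real (e i) \<le> real (d i) + 1" using cm_degrees_le[of n d i] by (auto split: if_splits)
  ultimately show ?thesis by (simp add: Md_def)
qed

lemma high_le: "high kap \<le> \<delta> * real n + 1"
proof -
  have "high kap = (\<Sum>i<n. if kap < real (e i) then real (e i) else 0)"
    unfolding high_def by (subst sum.inter_filter[symmetric]) (auto intro!: sum.cong)
  also have "\<dots> = (\<Sum>i<n. real (e i) * indicator {kap<..} (real (e i)))"
    by (intro sum.cong) (auto simp: indicator_def)
  also have "\<dots> \<le> (\<Sum>i<n. real (d i) * indicator {Kn n<..} (real (d i))) + 1"
  proof (rule sum_cm_degrees_le[OF n_pos(2)])
    fix i
    show "real (e i) * indicator {kap<..} (real (e i)) \<le> real (d i) * indicator {Kn n<..} (real (d i)) + (if i = n - 1 then 1 else 0)"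
      using cm_degrees_le[of n d i] by (auto simp: indicator_def kap_def split: if_splits)
  qed
  also have "\<dots> \<le> \<delta> * real n + 1" using good by (simp add: good_def)
  finally show ?thesis .
qed

text \<open>The truncation level was chosen so that
  \<open>sqrt (real n * an n) * Kn n = real n\<close>; hence \<open>Md * kap\<close> is at most
  \<open>3 * \<delta> * n\<close>. The three terms contribute 4, 4 and 12 times
  \<open>\<delta> / \<mu>\<close>.\<close>

lemma loss_rate_le: "loss_rate kap Md \<le> 20 * \<delta> / \<mu>"
proof -
  have n0: "0 < \<mu> * real n" using mean_pos n_pos by simp
  have \<mu>n: "0 < \<mu> * real n / 2" using n0 by simp
  have dn: "1 \<le> \<delta> * real n" using large by (smt (verit) real_sqrt_ge_zero of_nat_0_le_iff)
  have sq: "sqrt (real n * an n) \<le> real n"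
  proof -
    have "sqrt (real n * an n) \<le> sqrt (real n * real n)" using large by (intro real_sqrt_le_mono mult_left_mono) auto
    then show ?thesis by simp
  qed
  have M0: "0 \<le> Md" using \<delta> large by (auto simp: Md_def)
  have M1: "Md \<le> 2 * \<delta> * real n"
    unfolding Md_def using mult_left_mono[OF sq, of \<delta>] \<delta>(1) dn by linarith
  have Mk: "Md * kap \<le> 3 * \<delta> * real n"
  proof -
    have 1: "sqrt (real n * an n) * Kn n = real n"
    proof -
      have "sqrt (real n * an n) * Kn n = sqrt (real n * an n * (real n / an n))" by (simp only: Kn_def real_sqrt_mult)
      also have "real n * an n * (real n / an n) = (real n)\<^sup>2" using large by (simp add: power2_eq_square)
      finally show ?thesis by simp
    qed
    have 2: "Kn n \<le> sqrt (real n)" unfolding Kn_def using large by (intro real_sqrt_le_mono) (simp add: field_simps)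
    have "Md * kap = \<delta> * (sqrt (real n * an n) * Kn n) + \<delta> * sqrt (real n * an n) + Kn n + 1"
      by (simp add: Md_def kap_def algebra_simps)
    also have "\<dots> \<le> \<delta> * real n + \<delta> * real n + sqrt (real n) + 1"
      unfolding 1 using mult_left_mono[OF sq, of \<delta>] \<delta>(1) 2 by linarith
    also have "\<dots> \<le> 3 * \<delta> * real n" using large by simp
    finally show ?thesis .
  qed
  have t1: "Md / (tot - 1) \<le> 2 * \<delta> * real n / (\<mu> * real n / 2)"
    using M1 M0 tot_bounds \<mu>n by (intro frac_le) auto
  have h0: "0 \<le> high kap" unfolding high_def by (intro sum_nonneg) auto
  have t2: "high kap / (tot - 1) \<le> 2 * \<delta> * real n / (\<mu> * real n / 2)"
    using high_le dn tot_bounds \<mu>n h0 by (intro frac_le) auto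
  have k0: "0 \<le> kap" using large by (simp add: kap_def Kn_def)
  have t3: "Md * tot * kap / ((tot - 1) * (tot - 3)) \<le> 3 * \<delta> * real n / (\<mu> * real n / 4)"
  proof -
    have "Md * tot * kap / ((tot - 1) * (tot - 3)) = Md * kap * (tot / ((tot - 1) * (tot - 3)))" by simp
    also have "\<dots> \<le> Md * kap * (tot / ((tot - 1) * (tot / 2)))"
      using M0 k0 tot_bounds by (intro mult_left_mono divide_left_mono) auto
    also have "\<dots> = Md * kap / ((tot - 1) / 2)" using tot_bounds by simp
    also have "\<dots> \<le> 3 * \<delta> * real n / (\<mu> * real n / 4)"
    proof (rule frac_le)
      show "0 \<le> 3 * \<delta> * real n" using \<delta> by simp
      show "Md * kap \<le> 3 * \<delta> * real n" by (rule Mk)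
      show "0 < \<mu> * real n / 4" using n0 by simp
      show "\<mu> * real n / 4 \<le> (tot - 1) / 2" using divide_right_mono[OF tot_bounds(1), of 2] by (simp only: divide_divide_eq_left) simp
    qed
    finally show ?thesis .
  qed
  have "loss_rate kap Md \<le> 2 * \<delta> * real n / (\<mu> * real n / 2) + 2 * \<delta> * real n / (\<mu> * real n / 2) + 3 * \<delta> * real n / (\<mu> * real n / 4)"
    unfolding loss_rate_def by (intro add_mono t1 t2 t3)
  also have "\<dots> = 20 * \<delta> / \<mu>" using n_pos mean_pos by (simp add: field_simps)
  finally show ?thesis .
qed

section \<open>Power sums of the degrees before and after erasure\<close>

definition "t q = (\<Sum>i<n. real (e i) ^ q)"
definition "hs q m = (\<Sum>i<n. real (ecm_degree n d m i) ^ q)"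

lemma last_le: "real (d (n - 1)) \<le> \<delta> * an n"
  using good by (simp add: good_def)

lemma t_ge: "scaled_sum q n d * an n ^ q \<le> t q"
proof -
  have "scaled_sum q n d * an n ^ q = (\<Sum>i<n. real (d i) ^ q)" using large by (simp add: scaled_sum_def)
  also have "\<dots> \<le> t q" unfolding t_def by (intro sum_mono power_mono) (auto simp: cm_degrees_ge)
  finally show ?thesis .
qed

text \<open>Adding a half-edge changes one square by \<open>2 * d + 1\<close>. The constant 3
  collects these terms, using that \<open>d\<close> is at most, and 1 at most,
  \<open>\<delta> * an\<close>.\<close>

lemma t2_le: "t 2 \<le> (scaled_sum 2 n d + 3 * \<delta>) * an n ^ 2"
proof -
  have "t 2 \<le> (\<Sum>i<n. real (d i) ^ 2) + (2 * (\<delta> * an n) + 1)"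
    unfolding t_def
  proof (rule sum_cm_degrees_le[OF n_pos(2)])
    fix i
    show "real (e i) ^ 2 \<le> real (d i) ^ 2 + (if i = n - 1 then 2 * (\<delta> * an n) + 1 else 0)"
    proof (cases "i = n - 1")
      case True
      have "real (e i) \<le> real (d i) + 1" using cm_degrees_le[of n d i] by (auto split: if_splits)
      then have "real (e i) ^ 2 \<le> (real (d i) + 1) ^ 2" by (intro power_mono) auto
      also have "\<dots> = real (d i) ^ 2 + 2 * real (d i) + 1" by (simp add: power2_eq_square algebra_simps)
      finally show ?thesis using True last_le by simp
    next
      case False
      then have "e i = d i" by (auto simp: cm_degrees_def)
      then show ?thesis using False by simp
    qed
  qed
  moreover have "2 * (\<delta> * an n) + 1 \<le> 3 * \<delta> * an n ^ 2"
  proof -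
    have "\<delta> * an n * 1 \<le> \<delta> * an n * an n" using large \<delta> by (intro mult_left_mono) auto
    then show ?thesis using large by (simp add: power2_eq_square)
  qed
  moreover have "scaled_sum 2 n d * an n ^ 2 = (\<Sum>i<n. real (d i) ^ 2)" using large by (simp add: scaled_sum_def)
  ultimately show ?thesis by (simp add: algebra_simps)
qed

text \<open>Adding a half-edge changes one cube by \<open>3 * x\<^sup>2 + 3 * x + 1\<close>; each
  monomial is at most \<open>\<delta> * an ^ 3\<close>, which gives 7 = 3 + 3 + 1.\<close>

lemma t3_le: "t 3 \<le> (scaled_sum 3 n d + 7 * \<delta>) * an n ^ 3"
proof -
  have "t 3 \<le> (\<Sum>i<n. real (d i) ^ 3) + 7 * (\<delta> * an n ^ 3)"
    unfolding t_def
  proof (rule sum_cm_degrees_le[OF n_pos(2)])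
    fix i
    show "real (e i) ^ 3 \<le> real (d i) ^ 3 + (if i = n - 1 then 7 * (\<delta> * an n ^ 3) else 0)"
    proof (cases "i = n - 1")
      case True
      define x where "x = real (d i)"
      have x: "0 \<le> x" "x \<le> \<delta> * an n" using True last_le by (auto simp: x_def)
      have "real (e i) \<le> x + 1" using cm_degrees_le[of n d i] by (auto simp: x_def split: if_splits)
      then have "real (e i) ^ 3 \<le> (x + 1) ^ 3" by (intro power_mono) auto
      also have "\<dots> = x ^ 3 + (3 * x\<^sup>2 + 3 * x + 1)" by (simp add: power2_eq_square power3_eq_cube algebra_simps)
      also have "\<dots> \<le> x ^ 3 + 7 * (\<delta> * an n ^ 3)"
      proof -
        have a2: "an n \<le> an n ^ 3" "(an n)\<^sup>2 \<le> an n ^ 3" using large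
          by (auto intro: power_increasing[of 1 3, simplified] power_increasing[of 2 3])
        have "x\<^sup>2 \<le> (\<delta> * an n)\<^sup>2" using x by (intro power_mono) auto
        also have "\<dots> = \<delta> * (\<delta> * (an n)\<^sup>2)" by (simp add: power2_eq_square)
        also have "\<dots> \<le> \<delta> * (1 * an n ^ 3)" using \<delta> a2 by (intro mult_left_mono mult_mono) auto
        finally have 1: "x\<^sup>2 \<le> \<delta> * an n ^ 3" by simp
        have 2: "\<delta> * an n \<le> \<delta> * an n ^ 3" using \<delta> a2 by (intro mult_left_mono) auto
        show ?thesis using 1 2 x large by simp
      qed
      finally show ?thesis using True by (simp add: x_def)
    next
      case False
      then have "e i = d i" by (auto simp: cm_degrees_def)
      then show ?thesis using False by simp
    qed
  qed
  moreover have "scaled_sum 3 n d * an n ^ 3 = (\<Sum>i<n. real (d i) ^ 3)" using large by (simp add: scaled_sum_def)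
  ultimately show ?thesis by (simp add: algebra_simps)
qed

text \<open>The parity correction only raises degrees, so a corrected degree below \<open>bn\<close>
  comes from an original one below \<open>bn\<close>. The one altered square grows by at most
  \<open>2 * bn n + 1\<close>.\<close>

lemma low_le: "(\<Sum>i | i < n \<and> real (e i) \<le> bn n. (real (e i))\<^sup>2) \<le> 2 * \<delta> * (an n)\<^sup>2"
proof -
  have "(\<Sum>i | i < n \<and> real (e i) \<le> bn n. (real (e i))\<^sup>2) = (\<Sum>i<n. if real (e i) \<le> bn n then (real (e i))\<^sup>2 else 0)"
    by (subst sum.inter_filter[symmetric]) (auto intro!: sum.cong)
  also have "\<dots> = (\<Sum>i<n. (real (e i))\<^sup>2 * indicator {..bn n} (real (e i)))"
    by (intro sum.cong) (auto simp: indicator_def)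
  also have "\<dots> \<le> (\<Sum>i<n. (real (d i))\<^sup>2 * indicator {..bn n} (real (d i))) + (2 * bn n + 1)"
  proof (rule sum_cm_degrees_le[OF n_pos(2)])
    fix i
    show "(real (e i))\<^sup>2 * indicator {..bn n} (real (e i))
        \<le> (real (d i))\<^sup>2 * indicator {..bn n} (real (d i)) + (if i = n - 1 then 2 * bn n + 1 else 0)"
    proof (cases "real (e i) \<le> bn n")
      case True
      have de: "real (d i) \<le> real (e i)" by (simp add: cm_degrees_ge)
      show ?thesis
      proof (cases "i = n - 1")
        case i: True
        have "real (e i) \<le> real (d i) + 1" using cm_degrees_le[of n d i] by (auto split: if_splits)
        then have "real (e i) ^ 2 \<le> (real (d i) + 1) ^ 2" by (intro power_mono) auto
        also have "\<dots> = real (d i) ^ 2 + 2 * real (d i) + 1" by (simp add: power2_eq_square algebra_simps)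
        finally show ?thesis using True de i by (simp add: indicator_def)
      next
        case False
        then have "e i = d i" by (auto simp: cm_degrees_def)
        then show ?thesis using False by simp
      qed
    next
      case False then show ?thesis using large by (simp add: indicator_def)
    qed
  qed
  also have "\<dots> \<le> \<delta> * (an n)\<^sup>2 + \<delta> * (an n)\<^sup>2" using good large by (intro add_mono) (auto simp: good_def)
  finally show ?thesis by simp
qed

section \<open>The edge sum and the loss in the power sums\<close>

definition "prodsum m = (\<Sum>i<n. \<Sum>j<n. real (ecm_edges n d m i j) * real (ecm_degree n d m i) * real (ecm_degree n d m j))"

lemma prodsum_nonneg: "0 \<le> prodsum m"
  unfolding prodsum_def by (intro sum_nonneg) auto

text \<open>\<open>expected_product_sum\<close> at the level \<open>bn\<close>: pairs of hubs are
  controlled by \<open>n \<le> \<delta> * bn ^ 2\<close>, pairs with a low degree by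
  \<open>low_le\<close>. The shift \<open>C + 3\<close> comes from \<open>t2_le\<close> and
  \<open>\<delta> \<le> 1\<close>.\<close>

lemma expected_prodsum:
  assumes C: "scaled_sum 2 n d \<le> C"
  shows "measure_pmf.expectation \<M> prodsum \<le> \<delta> * ((C + 3)\<^sup>2 + 8 * (C + 3) / \<mu>) * (an n ^ 4 / real n)"
proof -
  let ?B = "\<Sum>i | i < n \<and> real (e i) \<le> bn n. (real (e i))\<^sup>2"
  have t2: "t 2 \<le> (C + 3) * an n ^ 2"
    using t2_le C \<delta> by (elim order_trans) (intro mult_right_mono, auto)
  have t0: "0 \<le> t 2" unfolding t_def by (intro sum_nonneg) auto
  have C0: "0 \<le> C + 3" using t0 t2 large by (smt (verit) mult_neg_pos zero_less_power)
  have n0: "0 < \<mu> * real n" using mean_pos n_pos by simp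
  have "measure_pmf.expectation \<M> prodsum \<le> (t 2)\<^sup>2 / (bn n)\<^sup>2 + 2 / (tot - 1) * t 2 * ?B"
    unfolding prodsum_def t_def using expected_product_sum[OF large(6)] .
  also have "\<dots> \<le> (t 2)\<^sup>2 * (\<delta> / real n) + 2 / (\<mu> * real n / 2) * t 2 * (2 * \<delta> * (an n)\<^sup>2)"
  proof (intro add_mono)
    have "1 / (bn n)\<^sup>2 \<le> \<delta> / real n" using large n_pos by (simp add: field_simps)
    then have "(t 2)\<^sup>2 * (1 / (bn n)\<^sup>2) \<le> (t 2)\<^sup>2 * (\<delta> / real n)" by (intro mult_left_mono) auto
    then show "(t 2)\<^sup>2 / (bn n)\<^sup>2 \<le> (t 2)\<^sup>2 * (\<delta> / real n)" by simp
    show "2 / (tot - 1) * t 2 * ?B \<le> 2 / (\<mu> * real n / 2) * t 2 * (2 * \<delta> * (an n)\<^sup>2)"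
      using low_le t0 tot_bounds n0 by (intro mult_mono divide_left_mono mult_nonneg_nonneg) (auto intro: sum_nonneg)
  qed
  also have "\<dots> \<le> ((C + 3) * an n ^ 2)\<^sup>2 * (\<delta> / real n) + 2 / (\<mu> * real n / 2) * ((C + 3) * an n ^ 2) * (2 * \<delta> * (an n)\<^sup>2)"
    using t2 t0 n0 \<delta> by (intro add_mono mult_right_mono mult_left_mono power_mono) auto
  also have "\<dots> = \<delta> * ((C + 3)\<^sup>2 + 8 * (C + 3) / \<mu>) * (an n ^ 4 / real n)"
  proof -
    have "an n ^ 4 = (an n)\<^sup>2 * (an n)\<^sup>2" by (simp add: power2_eq_square power4_eq_xxxx)
    then show ?thesis using n_pos mean_pos by (simp add: field_simps power2_eq_square)
  qed
  finally show ?thesis .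
qed

text \<open>Markov's inequality at the level \<open>w\<close>, the square root of \<delta>, balances
  the size of the loss against its probability. The factor 3 comes from
  \<open>x ^ q - y ^ q \<le> q * x ^ (q - 1) * (x - y)\<close> with
  \<open>q \<le> 3\<close>.\<close>

lemma prob_loss:
  assumes q: "1 \<le> q" "q \<le> 3" and tq: "0 < t q" and w: "0 < w" "w\<^sup>2 = \<delta>"
  shows "measure_pmf.prob \<M> {m. 3 * w * t q < t q - hs q m} \<le> 20 * w / \<mu>"
proof -
  define W where "W m = (\<Sum>i<n. real (e i) ^ (q - 1) * (real (e i) - real (ecm_degree n d m i)))" for m
  have k0: "0 \<le> kap" using large by (simp add: kap_def Kn_def)
  have eq: "real (e i) ^ (q - 1) * real (e i) = real (e i) ^ q" for i
    using q by (metis One_nat_def Suc_pred' le_eq_less_or_eq less_one mult.commute power_Suc zero_less_iff_neq_zero not_one_le_zero)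
  have "measure_pmf.expectation \<M> W \<le> loss_rate kap Md * (\<Sum>i<n. real (e i) ^ (q - 1) * real (e i))"
    unfolding W_def by (intro expected_loss e_le_Md k0) auto
  also have "\<dots> = loss_rate kap Md * t q" by (simp only: eq t_def)
  also have "\<dots> \<le> 20 * \<delta> / \<mu> * t q" using loss_rate_le tq by (intro mult_right_mono) auto
  finally have EW: "measure_pmf.expectation \<M> W \<le> 20 * \<delta> / \<mu> * t q" .
  have loss: "t q - hs q m \<le> 3 * W m" for m
  proof -
    have "t q - hs q m = (\<Sum>i<n. real (e i) ^ q - real (ecm_degree n d m i) ^ q)"
      by (simp add: t_def hs_def sum_subtractf)
    also have "\<dots> \<le> (\<Sum>i<n. 3 * (real (e i) ^ (q - 1) * (real (e i) - real (ecm_degree n d m i))))"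
    proof (intro sum_mono)
      fix i assume "i \<in> {..<n}"
      define x where "x = real (e i)"
      define y where "y = real (ecm_degree n d m i)"
      have xy: "0 \<le> y" "y \<le> x" using ecm_degree_le[of i m] \<open>i \<in> {..<n}\<close> by (auto simp: x_def y_def)
      have "x ^ q - y ^ q \<le> 3 * (x ^ (q - 1) * (x - y))"
      proof -
        consider "q = 1" | "q = 2" | "q = 3" using q by linarith
        then show ?thesis
        proof cases
          case 1 then show ?thesis using xy by simp
        next
          case 2
          have "x ^ 2 - y ^ 2 = (x + y) * (x - y)" by (simp add: power2_eq_square algebra_simps)
          also have "\<dots> \<le> (3 * x) * (x - y)" using xy by (intro mult_right_mono) auto
          finally show ?thesis using 2 by simp
        next
          case 3
          have "x ^ 3 - y ^ 3 = (x\<^sup>2 + x * y + y\<^sup>2) * (x - y)" by (simp add: power2_eq_square power3_eq_cube algebra_simps)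
          also have "\<dots> \<le> (3 * x\<^sup>2) * (x - y)"
          proof (intro mult_right_mono)
            have "x * y \<le> x * x" "y\<^sup>2 \<le> x\<^sup>2" using xy by (auto intro: mult_left_mono power_mono)
            then show "x\<^sup>2 + x * y + y\<^sup>2 \<le> 3 * x\<^sup>2" by (simp add: power2_eq_square)
          qed (use xy in auto)
          finally show ?thesis using 3 by simp
        qed
      qed
      then show "real (e i) ^ q - real (ecm_degree n d m i) ^ q \<le> 3 * (real (e i) ^ (q - 1) * (real (e i) - real (ecm_degree n d m i)))"
        by (simp add: x_def y_def)
    qed
    also have "\<dots> = 3 * W m" by (simp add: W_def sum_distrib_left)
    finally show ?thesis .
  qed
  have "measure_pmf.prob \<M> {m. 3 * w * t q < t q - hs q m} \<le> measure_pmf.prob \<M> {m. w * t q < W m}"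
  proof (intro measure_pmf.finite_measure_mono)
    show "{m. 3 * w * t q < t q - hs q m} \<subseteq> {m. w * t q < W m}"
    proof
      fix m assume "m \<in> {m. 3 * w * t q < t q - hs q m}"
      then have "3 * (w * t q) < 3 * W m" using loss[of m] by simp
      then show "m \<in> {m. w * t q < W m}" by simp
    qed
  qed auto
  also have "\<dots> \<le> measure_pmf.expectation \<M> W / (w * t q)"
  proof (rule pmf_Markov)
    show "0 \<le> W m" for m unfolding W_def
      using ecm_degree_le by (intro sum_nonneg mult_nonneg_nonneg) auto
  qed (use w tq in auto)
  also have "\<dots> \<le> 20 * \<delta> / \<mu> * t q / (w * t q)" using EW w tq by (intro divide_right_mono) auto
  also have "\<dots> = 20 * w / \<mu>" using w tq mean_pos by (simp add: power2_eq_square[symmetric] field_simps)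
  finally show ?thesis .
qed

end

definition (in heavy_tail) scaled_pearson :: "nat \<Rightarrow> (nat \<Rightarrow> nat) \<Rightarrow> ((nat \<times> nat) \<Rightarrow> (nat \<times> nat)) \<Rightarrow> real" where
  "scaled_pearson n d m = \<mu> * (real n / an n) * ecm_pearson n d m"

definition (in heavy_tail) limit_ratio :: "nat \<Rightarrow> (nat \<Rightarrow> nat) \<Rightarrow> real" where
  "limit_ratio n d = - ((scaled_sum 2 n d)\<^sup>2 / scaled_sum 3 n d)"

context typical_degrees
begin

text \<open>Numerator and denominator are divided by their orders \<open>an ^ 4 / n\<close> and
  \<open>an ^ 3\<close>, whose quotient cancels the factor \<open>n / an\<close>. In the denominator
  \<open>q\<close> keeps the coefficient \<open>an / n\<close>, which vanishes in the limit.\<close>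

lemma scaled_pearson_eq:
  assumes l: "0 < hs 1 m"
  defines "q \<equiv> (hs 2 m / an n ^ 2)\<^sup>2 / (hs 1 m / real n)"
  shows "scaled_pearson n d m = \<mu> * ((prodsum m / (an n ^ 4 / real n) - q) / (hs 3 m / an n ^ 3 - an n / real n * q))"
proof -
  have a: "0 < an n" using large by simp
  have s: "(hs 2 m)\<^sup>2 / hs 1 m = an n ^ 4 / real n * q"
    using a n_pos l by (simp add: q_def power2_eq_square power4_eq_xxxx field_simps)
  have "ecm_pearson n d m = (prodsum m - (hs 2 m)\<^sup>2 / hs 1 m) / (hs 3 m - (hs 2 m)\<^sup>2 / hs 1 m)"
    by (simp add: ecm_pearson_def pearson_def hs_def prodsum_def Let_def)
  also have "prodsum m - (hs 2 m)\<^sup>2 / hs 1 m = an n ^ 4 / real n * (prodsum m / (an n ^ 4 / real n) - q)"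
    unfolding s using a n_pos by (simp add: right_diff_distrib)
  also have "hs 3 m - (hs 2 m)\<^sup>2 / hs 1 m = an n ^ 3 * (hs 3 m / an n ^ 3 - an n / real n * q)"
    unfolding s using a n_pos by (simp add: right_diff_distrib power4_eq_xxxx power3_eq_cube)
  finally have "scaled_pearson n d m = \<mu> * (real n / an n) * ((an n ^ 4 / real n) / an n ^ 3
      * ((prodsum m / (an n ^ 4 / real n) - q) / (hs 3 m / an n ^ 3 - an n / real n * q)))"
    unfolding scaled_pearson_def by (simp only: times_divide_times_eq)
  also have "\<dots> = (real n / an n * ((an n ^ 4 / real n) / an n ^ 3)) *
      (\<mu> * ((prodsum m / (an n ^ 4 / real n) - q) / (hs 3 m / an n ^ 3 - an n / real n * q)))"
    by (simp only: mult_ac)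
  also have "real n / an n * ((an n ^ 4 / real n) / an n ^ 3) = 1"
    using a n_pos by (simp add: power4_eq_xxxx power3_eq_cube)
  finally show ?thesis by simp
qed

lemma hs_le: "hs q m \<le> t q"
  unfolding hs_def t_def by (intro sum_mono power_mono) (auto simp: ecm_degree_le)

lemma t_1: "t 1 = tot" "t (Suc 0) = tot"
  by (simp_all add: t_def tot_eq)

text \<open>Outside four events (a large loss in one of three power sums, or a large edge sum) every
  argument of the limiting function is within \<epsilon> of its target; each event has probability
  of order \<open>w\<close>.\<close>

lemma prob_far_le:
  assumes c: "0 < c" and X: "c \<le> scaled_sum 2 n d" "scaled_sum 2 n d \<le> C" and Y: "c \<le> scaled_sum 3 n d" "scaled_sum 3 n d \<le> C"
    and w: "0 < w" "w\<^sup>2 = \<delta>" "w \<le> 1 / 6"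
    and \<epsilon>: "w * (3 * C + 28) \<le> \<epsilon>" "w * (3 * \<mu> + 8) \<le> \<epsilon>" "w \<le> \<epsilon>" "an n / real n \<le> \<epsilon>"
    and unif: "\<And>x y x' y' l t r. c \<le> x \<Longrightarrow> x \<le> C \<Longrightarrow> c \<le> y \<Longrightarrow> y \<le> C \<Longrightarrow> \<bar>x' - x\<bar> \<le> \<epsilon> \<Longrightarrow> \<bar>y' - y\<bar> \<le> \<epsilon> \<Longrightarrow>
      \<bar>l - \<mu>\<bar> \<le> \<epsilon> \<Longrightarrow> \<bar>t\<bar> \<le> \<epsilon> \<Longrightarrow> \<bar>r\<bar> \<le> \<epsilon> \<Longrightarrow>
      \<bar>\<mu> * ((t - x'\<^sup>2 / l) / (y' - r * (x'\<^sup>2 / l))) - - (x\<^sup>2 / y)\<bar> \<le> \<eta>"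
  shows "measure_pmf.prob \<M> {m. \<eta> < \<bar>scaled_pearson n d m - limit_ratio n d\<bar>}
      \<le> w * (60 / \<mu> + ((C + 3)\<^sup>2 + 8 * (C + 3) / \<mu>))"
proof -
  have a: "0 < an n" using large by simp
  have \<delta>w: "\<delta> \<le> w" using w by (simp add: power2_eq_square[symmetric]) (smt (verit) mult_left_le power2_eq_square w)
  have t_pos: "0 < t 1" "0 < t 2" "0 < t 3"
  proof -
    show "0 < t 1" using tot_bounds by (simp add: t_1)
    have "0 < c * an n ^ 2" "0 < c * an n ^ 3" using c a by auto
    moreover have "c * an n ^ 2 \<le> scaled_sum 2 n d * an n ^ 2" "c * an n ^ 3 \<le> scaled_sum 3 n d * an n ^ 3"
      using X Y a by (auto intro!: mult_right_mono)
    ultimately show "0 < t 2" "0 < t 3" using t_ge[of 2] t_ge[of 3] by linarith+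
  qed
  let ?B = "\<lambda>q. {m. 3 * w * t q < t q - hs q m}"
  let ?T = "{m. w * (an n ^ 4 / real n) < prodsum m}"
  have an4: "0 < an n ^ 4 / real n" using a n_pos by simp
  have PT: "measure_pmf.prob \<M> ?T \<le> w * ((C + 3)\<^sup>2 + 8 * (C + 3) / \<mu>)"
  proof -
    have "measure_pmf.prob \<M> ?T \<le> measure_pmf.expectation \<M> prodsum / (w * (an n ^ 4 / real n))"
      by (intro pmf_Markov mult_pos_pos w an4 prodsum_nonneg integrable_M)
    also have "\<dots> \<le> \<delta> * ((C + 3)\<^sup>2 + 8 * (C + 3) / \<mu>) * (an n ^ 4 / real n) / (w * (an n ^ 4 / real n))"
      by (intro divide_right_mono expected_prodsum X mult_nonneg_nonneg less_imp_le[OF w(1)] less_imp_le[OF an4])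
    also have "\<dots> = \<delta> / w * ((C + 3)\<^sup>2 + 8 * (C + 3) / \<mu>)" using a n_pos w by simp
    also have "\<delta> / w = w" using w by (simp add: power2_eq_square[symmetric] w(2)[symmetric]) (simp add: power2_eq_square)
    finally show ?thesis .
  qed
  have sub: "\<bar>scaled_pearson n d m - limit_ratio n d\<bar> \<le> \<eta>"
    if m: "m \<notin> ?B 1" "m \<notin> ?B 2" "m \<notin> ?B 3" "m \<notin> ?T" for m
  proof -
    have b: "t q - 3 * w * t q \<le> hs q m" if "m \<notin> ?B q" for q using that by auto
    \<comment> \<open>\<open>w \<le> 1 / 6\<close> means that at least half of each power sum
      survives, so the erased graph still has edges.\<close>
    have wt: "3 * w * t q \<le> t q / 2" if "0 < t q" for q
      using w that by simp
    have hs1: "0 < hs 1 m" using b[OF m(1)] wt[OF t_pos(1)] t_pos(1) by linarith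
    have x: "\<bar>hs 2 m / an n ^ 2 - scaled_sum 2 n d\<bar> \<le> \<epsilon>"
    proof -
      have a2: "0 < an n ^ 2" using a by simp
      have "hs 2 m \<le> (scaled_sum 2 n d + 3 * \<delta>) * an n ^ 2" using hs_le[of 2 m] t2_le by linarith
      then have 1: "hs 2 m / an n ^ 2 \<le> scaled_sum 2 n d + 3 * \<delta>" using a2 by (simp add: pos_divide_le_eq)
      have "t 2 \<le> (C + 3) * an n ^ 2" using t2_le X \<delta> a2 by (elim order_trans) (intro mult_right_mono, auto)
      then have "3 * w * t 2 \<le> 3 * w * ((C + 3) * an n ^ 2)" using w by (intro mult_left_mono) auto
      then have "(scaled_sum 2 n d - 3 * w * (C + 3)) * an n ^ 2 \<le> hs 2 m"
        using b[OF m(2)] t_ge[of 2] by (simp add: algebra_simps)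
      then have 2: "scaled_sum 2 n d - 3 * w * (C + 3) \<le> hs 2 m / an n ^ 2" using a2 by (simp add: pos_le_divide_eq)
      have C0: "0 \<le> C * w" using c X w by simp
      \<comment> \<open>The first bound on \<epsilon> has the constant \<open>3 * C + 28\<close> to
        cover both this case and the cubic one, where \<open>3 * (C + 7)\<close> and 7
        occur.\<close>
      have "3 * \<delta> \<le> \<epsilon>" "3 * w * (C + 3) \<le> \<epsilon>" using \<epsilon>(1) \<delta>w w(1) C0 by (auto simp: algebra_simps)
      then show ?thesis using 1 2 by (simp add: abs_le_iff)
    qed
    have y: "\<bar>hs 3 m / an n ^ 3 - scaled_sum 3 n d\<bar> \<le> \<epsilon>"
    proof -
      have a2: "0 < an n ^ 3" using a by simp
      have "hs 3 m \<le> (scaled_sum 3 n d + 7 * \<delta>) * an n ^ 3" using hs_le[of 3 m] t3_le by linarith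
      then have 1: "hs 3 m / an n ^ 3 \<le> scaled_sum 3 n d + 7 * \<delta>" using a2 by (simp add: pos_divide_le_eq)
      have "t 3 \<le> (C + 7) * an n ^ 3" using t3_le Y \<delta> a2 by (elim order_trans) (intro mult_right_mono, auto)
      then have "3 * w * t 3 \<le> 3 * w * ((C + 7) * an n ^ 3)" using w by (intro mult_left_mono) auto
      then have "(scaled_sum 3 n d - 3 * w * (C + 7)) * an n ^ 3 \<le> hs 3 m"
        using b[OF m(3)] t_ge[of 3] by (simp add: algebra_simps)
      then have 2: "scaled_sum 3 n d - 3 * w * (C + 7) \<le> hs 3 m / an n ^ 3" using a2 by (simp add: pos_le_divide_eq)
      have C0: "0 \<le> C * w" using c X w by simp
      have "7 * \<delta> \<le> \<epsilon>" "3 * w * (C + 7) \<le> \<epsilon>" using \<epsilon>(1) \<delta>w w(1) C0 by (auto simp: algebra_simps)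
      then show ?thesis using 1 2 by (simp add: abs_le_iff)
    qed
    have l: "\<bar>hs 1 m / real n - \<mu>\<bar> \<le> \<epsilon>"
    proof -
      have "hs 1 m \<le> (\<mu> + 2 * \<delta>) * real n" using hs_le[of 1 m] tot_bounds by (simp add: t_1 algebra_simps)
      then have 1: "hs 1 m / real n \<le> \<mu> + 2 * \<delta>" using n_pos by (simp add: pos_divide_le_eq)
      have "tot \<le> (\<mu> + 2) * real n"
      proof -
        have "2 * \<delta> * real n \<le> 2 * 1 * real n" using \<delta> by (intro mult_right_mono mult_left_mono) auto
        then show ?thesis using tot_bounds(5) by (simp add: algebra_simps)
      qed
      then have "3 * w * tot \<le> 3 * w * ((\<mu> + 2) * real n)" using w by (intro mult_left_mono) auto
      then have "(\<mu> - \<delta> - 3 * w * (\<mu> + 2)) * real n \<le> hs 1 m"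
        using b[OF m(1)] tot_bounds(4) by (simp add: t_1 algebra_simps)
      then have 2: "\<mu> - \<delta> - 3 * w * (\<mu> + 2) \<le> hs 1 m / real n" using n_pos by (simp add: pos_le_divide_eq)
      have m0: "0 \<le> \<mu> * w" using mean_pos w by simp
      have "2 * \<delta> \<le> \<epsilon>" "\<delta> + 3 * w * (\<mu> + 2) \<le> \<epsilon>" using \<epsilon>(2) \<delta>w w(1) m0 by (auto simp: algebra_simps)
      then show ?thesis using 1 2 by (simp add: abs_le_iff)
    qed
    have "prodsum m / (an n ^ 4 / real n) \<le> w" using m(4) by (simp only: pos_divide_le_eq[OF an4] mem_Collect_eq not_less)
    moreover have "0 \<le> prodsum m / (an n ^ 4 / real n)" using prodsum_nonneg[of m] an4 by (intro divide_nonneg_nonneg) auto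
    ultimately have t: "\<bar>prodsum m / (an n ^ 4 / real n)\<bar> \<le> \<epsilon>" using \<epsilon>(3) by linarith
    have r: "\<bar>an n / real n\<bar> \<le> \<epsilon>" using \<epsilon>(4) a by simp
    show ?thesis
      unfolding scaled_pearson_eq[OF hs1] limit_ratio_def by (rule unif[OF X Y x y l t r])
  qed
  have "measure_pmf.prob \<M> {m. \<eta> < \<bar>scaled_pearson n d m - limit_ratio n d\<bar>}
     \<le> measure_pmf.prob \<M> (?B 1 \<union> (?B 2 \<union> (?B 3 \<union> ?T)))"
  proof (intro measure_pmf.finite_measure_mono)
    show "{m. \<eta> < \<bar>scaled_pearson n d m - limit_ratio n d\<bar>} \<subseteq> ?B 1 \<union> (?B 2 \<union> (?B 3 \<union> ?T))"
    proof (rule subsetI, rule ccontr)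
      fix m assume m: "m \<in> {m. \<eta> < \<bar>scaled_pearson n d m - limit_ratio n d\<bar>}"
        and "m \<notin> ?B 1 \<union> (?B 2 \<union> (?B 3 \<union> ?T))"
      then have "m \<notin> ?B 1" "m \<notin> ?B 2" "m \<notin> ?B 3" "m \<notin> ?T" by (simp_all only: Un_iff de_Morgan_disj not_False_eq_True)
      from sub[OF this] m show False by simp
    qed
  qed auto
  also have "\<dots> \<le> measure_pmf.prob \<M> (?B 1) + (measure_pmf.prob \<M> (?B 2) + (measure_pmf.prob \<M> (?B 3) + measure_pmf.prob \<M> ?T))"
    by (intro order_trans[OF measure_pmf_Un_le] add_left_mono order_refl)
  also have "\<dots> \<le> 20 * w / \<mu> + (20 * w / \<mu> + (20 * w / \<mu> + w * ((C + 3)\<^sup>2 + 8 * (C + 3) / \<mu>)))"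
    using t_pos w(1,2) by (intro add_mono PT prob_loss) auto
  also have "\<dots> = w * (60 / \<mu> + ((C + 3)\<^sup>2 + 8 * (C + 3) / \<mu>))" by (simp add: algebra_simps)
  finally show ?thesis .
qed

end

context heavy_tail
begin

section \<open>From a single typical sequence to large \<open>n\<close>\<close>

lemma eventually_large:
  assumes \<delta>: "0 < \<delta>" and \<epsilon>: "0 < \<epsilon>"
  shows "\<forall>\<^sub>F n in sequentially. 1 \<le> an n \<and> 1 \<le> \<delta> * an n \<and> an n \<le> real n \<and> sqrt (real n) + 1 \<le> \<delta> * real n \<and> 16 \<le> \<mu> * real n \<and>
      0 < bn n \<and> 2 * bn n + 1 \<le> \<delta> * (an n)\<^sup>2 \<and> real n \<le> \<delta> * (bn n)\<^sup>2 \<and> an n / real n \<le> \<epsilon>"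
proof -
  have sq: "filterlim (\<lambda>n. sqrt (real n)) at_top sequentially"
    by (rule filterlim_compose[OF sqrt_at_top filterlim_real_sequentially])
  have "\<forall>\<^sub>F n in sequentially. max 1 (3 / \<delta>) \<le> an n" using an_at_top unfolding filterlim_at_top by blast
  moreover have "\<forall>\<^sub>F n in sequentially. an n / real n < min 1 \<epsilon>" using \<epsilon> by (intro order_tendstoD[OF an_over_n]) auto
  moreover have "\<forall>\<^sub>F n in sequentially. max 1 (2 / \<delta>) \<le> sqrt (real n)" using sq unfolding filterlim_at_top by blast
  moreover have "\<forall>\<^sub>F n in sequentially. 16 / \<mu> \<le> real n" using filterlim_real_sequentially unfolding filterlim_at_top by blast
  moreover have "\<forall>\<^sub>F n in sequentially. bn n / an n < 1" by (intro order_tendstoD[OF bn_over_an]) auto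
  moreover have "\<forall>\<^sub>F n in sequentially. sqrt (real n) / an n < \<delta>" using \<delta> by (intro order_tendstoD[OF sqrt_n_over_an]) auto
  ultimately show ?thesis
  proof eventually_elim
    case (elim n)
    have a: "1 \<le> an n" "3 \<le> \<delta> * an n" using elim \<delta> by (auto simp: field_simps)
    have s: "1 \<le> sqrt (real n)" "2 \<le> \<delta> * sqrt (real n)" using elim \<delta> by (auto simp: field_simps)
    have n: "0 < real n" using s by (cases "n = 0") auto
    have ss: "sqrt (real n) * sqrt (real n) = real n" by simp
    have 1: "an n \<le> real n" "an n / real n \<le> \<epsilon>" using elim(2) n by (auto simp: field_simps)
    have "2 * sqrt (real n) \<le> \<delta> * sqrt (real n) * sqrt (real n)" using s by (intro mult_right_mono) auto
    then have 2: "sqrt (real n) + 1 \<le> \<delta> * real n" using s(1) unfolding mult.assoc ss by linarith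
    have 3: "16 \<le> \<mu> * real n" using elim(4) mean_pos by (simp add: field_simps)
    have b: "0 < bn n" using a n by (simp add: bn_def)
    have ba: "bn n \<le> an n" using elim(5) a by (simp add: field_simps)
    have "3 * an n \<le> \<delta> * an n * an n" using a by (intro mult_right_mono) auto
    then have 4: "2 * bn n + 1 \<le> \<delta> * (an n)\<^sup>2" using ba a(1) unfolding power2_eq_square mult.assoc by linarith
    have b2: "(bn n)\<^sup>2 = an n * sqrt (real n)" using a n by (simp add: bn_def)
    have "sqrt (real n) \<le> \<delta> * an n" using elim(6) a by (simp add: pos_divide_less_eq)
    then have "sqrt (real n) * sqrt (real n) \<le> \<delta> * an n * sqrt (real n)" by (intro mult_right_mono) auto
    then have 5: "real n \<le> \<delta> * (bn n)\<^sup>2" unfolding ss b2 by (simp add: mult.assoc)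
    show ?case using a 1 2 3 b 4 5 by auto
  qed
qed

lemma scaled_pearson_close:
  assumes pos: "0 < c" "0 < C" "0 < \<eta>" "0 < \<zeta>"
  obtains \<delta> where "0 < \<delta>"
    "\<forall>\<^sub>F n in sequentially. \<forall>d. good \<delta> n d \<longrightarrow> scaled_sum 2 n d \<in> {c..C} \<longrightarrow> scaled_sum 3 n d \<in> {c..C} \<longrightarrow>
       measure_pmf.prob (pmf_of_set (cm_matchings n d)) {m. \<eta> < \<bar>scaled_pearson n d m - limit_ratio n d\<bar>} \<le> \<zeta>"
proof -
  obtain \<epsilon> where \<epsilon>: "0 < \<epsilon>" and unif:
    "\<And>x y x' y' l t r. c \<le> x \<Longrightarrow> x \<le> C \<Longrightarrow> c \<le> y \<Longrightarrow> y \<le> C \<Longrightarrow> \<bar>x' - x\<bar> \<le> \<epsilon> \<Longrightarrow> \<bar>y' - y\<bar> \<le> \<epsilon> \<Longrightarrow>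
      \<bar>l - \<mu>\<bar> \<le> \<epsilon> \<Longrightarrow> \<bar>t\<bar> \<le> \<epsilon> \<Longrightarrow> \<bar>r\<bar> \<le> \<epsilon> \<Longrightarrow>
      \<bar>\<mu> * ((t - x'\<^sup>2 / l) / (y' - r * (x'\<^sup>2 / l))) - - (x\<^sup>2 / y)\<bar> \<le> \<eta>"
    using limit_ratio_uniform[OF mean_pos pos(1-3)] by blast
  define D where "D = 60 / \<mu> + ((C + 3)\<^sup>2 + 8 * (C + 3) / \<mu>)"
  have D: "0 < D" using pos mean_pos by (auto simp: D_def intro!: add_pos_pos)
  \<comment> \<open>One upper bound on \<open>w\<close> for each requirement of
    \<open>prob_far_le\<close> and of the locale; the last entry turns the final probability bound
    into \<zeta>.\<close>
  define A where "A = {1 / 6, \<mu> / 4, \<epsilon> / (3 * C + 28), \<epsilon> / (3 * \<mu> + 8), \<epsilon>, \<zeta> / D}"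
  define w where "w = Min A"
  have wA: "w \<le> x" if "x \<in> A" for x using that by (auto simp: w_def A_def intro!: Min_le)
  have "0 < x" if "x \<in> A" for x using that pos mean_pos \<epsilon> D by (auto simp: A_def intro!: divide_pos_pos add_pos_pos)
  then have w0: "0 < w" unfolding w_def by (subst Min_gr_iff) (auto simp: A_def)
  have w: "0 < w" "w \<le> 1 / 6" "w \<le> \<mu> / 4" "w \<le> \<epsilon> / (3 * C + 28)" "w \<le> \<epsilon> / (3 * \<mu> + 8)" "w \<le> \<epsilon>" "w \<le> \<zeta> / D"
    by (rule w0) (rule wA, simp add: A_def)+
  have w': "w * (3 * C + 28) \<le> \<epsilon>" "w * (3 * \<mu> + 8) \<le> \<epsilon>" "w * D \<le> \<zeta>"
    using w pos mean_pos D by (auto simp: pos_le_divide_eq)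
  define \<delta> where "\<delta> = w\<^sup>2"
  \<comment> \<open>As \<open>w \<le> 1\<close>, the bounds placed on \<open>w\<close> pass to its
    square \<delta>.\<close>
  have ww: "w * w \<le> w * 1" using w by (intro mult_left_mono) auto
  have \<delta>: "0 < \<delta>" "\<delta> \<le> 1" "\<delta> \<le> \<mu> / 4"
    unfolding \<delta>_def power2_eq_square using w ww mult_pos_pos[OF w(1) w(1)] by linarith+
  have "\<forall>\<^sub>F n in sequentially. \<forall>d. good \<delta> n d \<longrightarrow> scaled_sum 2 n d \<in> {c..C} \<longrightarrow> scaled_sum 3 n d \<in> {c..C} \<longrightarrow>
       measure_pmf.prob (pmf_of_set (cm_matchings n d)) {m. \<eta> < \<bar>scaled_pearson n d m - limit_ratio n d\<bar>} \<le> \<zeta>"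
    using eventually_large[OF \<delta>(1) \<epsilon>]
  proof eventually_elim
    case (elim n)
    show ?case
    proof (intro allI impI)
      fix d assume d: "good \<delta> n d" "scaled_sum 2 n d \<in> {c..C}" "scaled_sum 3 n d \<in> {c..C}"
      interpret typical_degrees p L \<gamma> \<delta> n d
        using \<delta> d(1) elim by unfold_locales auto
      have "measure_pmf.prob \<M> {m. \<eta> < \<bar>scaled_pearson n d m - limit_ratio n d\<bar>} \<le> w * D"
        unfolding D_def
        by (rule prob_far_le[OF pos(1) _ _ _ _ w(1) _ w(2) w'(1,2) w(6) _ unif]) (use d elim in \<open>auto simp: \<delta>_def\<close>)
      then show "measure_pmf.prob (pmf_of_set (cm_matchings n d)) {m. \<eta> < \<bar>scaled_pearson n d m - limit_ratio n d\<bar>} \<le> \<zeta>"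
        using w'(3) by (simp add: cm_matchings_eq)
    qed
  qed
  then show ?thesis using that \<delta>(1) by blast
qed

end

section \<open>Convergence in distribution\<close>

lemma prob_bind_pmf_le:
  assumes "\<And>x. x \<in> set_pmf q \<Longrightarrow> G x \<Longrightarrow> measure_pmf.prob (K x) A \<le> \<zeta>" and \<zeta>: "0 \<le> \<zeta>"
  shows "measure_pmf.prob (bind_pmf q K) A \<le> measure_pmf.prob q {x. \<not> G x} + \<zeta>"
proof -
  have "emeasure (bind_pmf q K) A = (\<integral>\<^sup>+x. emeasure (K x) A \<partial>measure_pmf q)"
    by (rule emeasure_bind_pmf)
  also have "\<dots> \<le> (\<integral>\<^sup>+x. indicator {x. \<not> G x} x + ennreal \<zeta> \<partial>measure_pmf q)"
  proof (rule nn_integral_mono_AE, rule AE_pmfI)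
    fix x assume x: "x \<in> set_pmf q"
    show "emeasure (K x) A \<le> indicator {x. \<not> G x} x + ennreal \<zeta>"
    proof (cases "G x")
      case True
      then show ?thesis using assms(1)[OF x] by (simp add: measure_pmf.emeasure_eq_measure ennreal_leI)
    next
      case False
      have "emeasure (K x) A \<le> 1" by (rule measure_pmf.measure_le_1)
      then show ?thesis using False by (simp add: add_increasing2)
    qed
  qed
  also have "\<dots> = ennreal (measure_pmf.prob q {x. \<not> G x} + \<zeta>)"
    using \<zeta> by (subst nn_integral_add) (auto simp: measure_pmf.emeasure_eq_measure)
  finally show ?thesis
    using \<zeta> by (simp add: measure_pmf.emeasure_eq_measure del: ennreal_plus)
qed

text \<open>For positive \<alpha> a continuous bump, equal to 1 between \<open>2 * \<alpha>\<close>
  and \<open>1 - 2 * \<alpha>\<close>. Applied to \<open>exp (- X)\<close> it cuts off both large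
  and small values of \<open>X\<close>.\<close>

definition trapezoid :: "real \<Rightarrow> real \<Rightarrow> real" where
  "trapezoid \<alpha> u = max 0 (min 1 (min ((u - \<alpha>) / \<alpha>) ((1 - \<alpha> - u) / \<alpha>)))"

lemma trapezoid_bounds: "0 \<le> trapezoid \<alpha> u" "trapezoid \<alpha> u \<le> 1"
  by (auto simp: trapezoid_def)

lemma trapezoid_support:
  assumes "0 < \<alpha>" "trapezoid \<alpha> u \<noteq> 0" shows "u \<in> {\<alpha><..<1 - \<alpha>}"
  using assms by (auto simp: trapezoid_def max_def min_def field_simps split: if_splits)

lemma measurable_trapezoid [measurable]: "trapezoid \<alpha> \<in> borel_measurable borel"
  unfolding trapezoid_def[abs_def] by measurable

lemma continuous_trapezoid: "0 < \<alpha> \<Longrightarrow> continuous_on UNIV (trapezoid \<alpha>)"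
  unfolding trapezoid_def[abs_def] by (intro continuous_intros) auto

lemma trapezoid_tendsto_1:
  assumes "0 < u" "u < 1"
  shows "(\<lambda>k. trapezoid (1 / real (k + 3)) u) \<longlonglongrightarrow> 1"
proof -
  have lim: "(\<lambda>k. 1 / real (k + 3)) \<longlonglongrightarrow> 0" using LIMSEQ_ignore_initial_segment[OF lim_1_over_n, of 3] by simp
  have "\<forall>\<^sub>F k in sequentially. 1 / real (k + 3) < min (u / 2) ((1 - u) / 2)"
    using assms by (intro order_tendstoD[OF lim]) auto
  then have "\<forall>\<^sub>F k in sequentially. trapezoid (1 / real (k + 3)) u = 1"
  proof eventually_elim
    case (elim k)
    define \<alpha> where "\<alpha> = 1 / real (k + 3)"
    have \<alpha>: "0 < \<alpha>" "\<alpha> < u / 2" "\<alpha> < (1 - u) / 2" using elim by (auto simp: \<alpha>_def)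
    then have "1 \<le> (u - \<alpha>) / \<alpha>" "1 \<le> (1 - \<alpha> - u) / \<alpha>" by (auto simp: field_simps)
    then show ?case unfolding \<alpha>_def[symmetric] by (simp add: trapezoid_def)
  qed
  then show ?thesis by (rule tendsto_eventually)
qed

lemma cts_step_bounds: "a < b \<Longrightarrow> 0 \<le> cts_step a b x" "a < b \<Longrightarrow> cts_step a b x \<le> 1"
  by (auto simp: cts_step_def field_simps)

text \<open>Almost surely only: \<open>suminf\<close> is informative where the series converges, and
  there all its terms are positive.\<close>

lemma stable_S_pos: "AE \<omega> in exp_seq_space. 0 < stable_S \<gamma> q \<omega>" if "0 < \<gamma>" "\<gamma> < real q"
proof -
  have "1 < real q / \<gamma>" using that by simp
  from AE_summable_Gamma_powr[OF this] show ?thesis using AE_Gamma_seq_pos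
  proof eventually_elim
    case (elim \<omega>)
    have "summable (\<lambda>i. Gamma_seq \<omega> i powr (- real q / \<gamma>))" using elim by simp
    then show ?case unfolding stable_S_def using elim(2)
      by (intro suminf_pos) (simp_all add: order_less_imp_not_eq2)
  qed
qed

context heavy_tail
begin

text \<open>Keeps the degrees beside the matching, so that the coefficient can be compared with
  functions of the degrees on one space.\<close>

definition joint_law :: "nat \<Rightarrow> ((nat \<Rightarrow> nat) \<times> ((nat \<times> nat) \<Rightarrow> (nat \<times> nat))) pmf" where
  "joint_law n = deg_law n \<bind> (\<lambda>d. map_pmf (Pair d) (pmf_of_set (cm_matchings n d)))"

lemma ecm_law_eq: "ecm_law p n G = map_pmf (\<lambda>(d, m). G d m) (joint_law n)"
  by (simp add: ecm_law_def joint_law_def map_bind_pmf pmf.map_comp o_def)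

lemma joint_law_fst: "map_pmf fst (joint_law n) = deg_law n"
  by (simp add: joint_law_def map_bind_pmf pmf.map_comp o_def bind_return_pmf')

lemma expectation_joint_fst:
  "measure_pmf.expectation (joint_law n) (\<lambda>z. h (fst z)) = measure_pmf.expectation (deg_law n) (h :: _ \<Rightarrow> real)"
  unfolding joint_law_fst[symmetric] by simp

definition limit_var :: "(nat \<Rightarrow> real) \<Rightarrow> real" where
  "limit_var \<omega> = - ((stable_S \<gamma> 2 \<omega>)\<^sup>2 / stable_S \<gamma> 3 \<omega>)"

lemma measurable_stable_S [measurable]: "stable_S \<gamma> q \<in> borel_measurable exp_seq_space"
  unfolding stable_S_def[abs_def] by measurable

text \<open>The \<open>max 0\<close> makes the limit variable lie in the unit square everywhere; by
  \<open>stable_S_pos\<close> it alters nothing almost surely.\<close>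

lemma scaled_sums_converge:
  assumes "continuous_on UNIV (h :: real \<times> real \<Rightarrow> real)"
  shows "(\<lambda>n. measure_pmf.expectation (deg_law n) (\<lambda>d. h (exp (- scaled_sum 2 n d), exp (- scaled_sum 3 n d))))
    \<longlonglongrightarrow> (\<integral>\<omega>. h (exp (- max 0 (stable_S \<gamma> 2 \<omega>)), exp (- max 0 (stable_S \<gamma> 3 \<omega>))) \<partial>exp_seq_space)"
proof (rule polynomial_moments_converge[where Z="\<lambda>n d. (exp (- scaled_sum 2 n d), exp (- scaled_sum 3 n d))"
      and W="\<lambda>\<omega>. (exp (- max 0 (stable_S \<gamma> 2 \<omega>)), exp (- max 0 (stable_S \<gamma> 3 \<omega>)))"])
  show "prob_space (measure_pmf (deg_law n))" for n by (rule measure_pmf.prob_space_axioms)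
  show "prob_space exp_seq_space" by (rule prob_space_exp_seq)
  have nn: "0 \<le> scaled_sum q n d" for q n d
    unfolding scaled_sum_def by (intro divide_nonneg_nonneg sum_nonneg zero_le_power tail_quantile_nonneg) auto
  show "(exp (- scaled_sum 2 n d), exp (- scaled_sum 3 n d)) \<in> {0..1} \<times> {0..1}" for n d
    using nn by auto
  show "(exp (- max 0 (stable_S \<gamma> 2 \<omega>)), exp (- max 0 (stable_S \<gamma> 3 \<omega>))) \<in> {0..1} \<times> {0..1}" for \<omega>
    by auto
  fix j k
  have "(\<integral>\<omega>. exp (- stable_S \<gamma> 2 \<omega>) ^ j * exp (- stable_S \<gamma> 3 \<omega>) ^ k \<partial>exp_seq_space)
     = (\<integral>\<omega>. exp (- max 0 (stable_S \<gamma> 2 \<omega>)) ^ j * exp (- max 0 (stable_S \<gamma> 3 \<omega>)) ^ k \<partial>exp_seq_space)"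
  proof (rule integral_cong_AE)
    show "AE \<omega> in exp_seq_space. exp (- stable_S \<gamma> 2 \<omega>) ^ j * exp (- stable_S \<gamma> 3 \<omega>) ^ k
        = exp (- max 0 (stable_S \<gamma> 2 \<omega>)) ^ j * exp (- max 0 (stable_S \<gamma> 3 \<omega>)) ^ k"
      using stable_S_pos[of \<gamma> 2] stable_S_pos[of \<gamma> 3] gamma_gt_1 gamma_less_2 by auto
  qed measurable
  then show "(\<lambda>n. \<integral>d. fst (exp (- scaled_sum 2 n d), exp (- scaled_sum 3 n d)) ^ j * snd (exp (- scaled_sum 2 n d), exp (- scaled_sum 3 n d)) ^ k \<partial>measure_pmf (deg_law n))
     \<longlonglongrightarrow> (\<integral>\<omega>. fst (exp (- max 0 (stable_S \<gamma> 2 \<omega>)), exp (- max 0 (stable_S \<gamma> 3 \<omega>))) ^ j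
         * snd (exp (- max 0 (stable_S \<gamma> 2 \<omega>)), exp (- max 0 (stable_S \<gamma> 3 \<omega>))) ^ k \<partial>exp_seq_space)"
    using scaled_sum_laplace_tendsto[of j k] by simp
qed (use assms in auto)

text \<open>Both limit sums are positive and finite almost surely, so no mass of the limit sits on
  the boundary of the square.\<close>

lemma cutoff_tendsto_1:
  "(\<lambda>k. \<integral>\<omega>. trapezoid (1 / real (k + 3)) (exp (- max 0 (stable_S \<gamma> 2 \<omega>)))
      * trapezoid (1 / real (k + 3)) (exp (- max 0 (stable_S \<gamma> 3 \<omega>))) \<partial>exp_seq_space) \<longlonglongrightarrow> 1"
proof -
  interpret S: prob_space exp_seq_space by (rule prob_space_exp_seq)
  let ?f = "\<lambda>k \<omega>. trapezoid (1 / real (k + 3)) (exp (- max 0 (stable_S \<gamma> 2 \<omega>)))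
      * trapezoid (1 / real (k + 3)) (exp (- max 0 (stable_S \<gamma> 3 \<omega>)))"
  have "(\<lambda>k. \<integral>\<omega>. ?f k \<omega> \<partial>exp_seq_space) \<longlonglongrightarrow> (\<integral>\<omega>. 1 \<partial>exp_seq_space)"
  proof (rule integral_dominated_convergence[where w="\<lambda>_. 1"])
    show "AE \<omega> in exp_seq_space. (\<lambda>k. ?f k \<omega>) \<longlonglongrightarrow> 1"
    proof -
      have "AE \<omega> in exp_seq_space. 0 < stable_S \<gamma> 2 \<omega>" "AE \<omega> in exp_seq_space. 0 < stable_S \<gamma> 3 \<omega>"
        using gamma_gt_1 gamma_less_2 by (auto intro!: stable_S_pos)
      then show ?thesis
      proof eventually_elim
        case (elim \<omega>)
        have "(\<lambda>k. ?f k \<omega>) \<longlonglongrightarrow> 1 * 1" using elim by (intro tendsto_mult trapezoid_tendsto_1) auto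
        then show ?case by simp
      qed
    qed
    show "AE \<omega> in exp_seq_space. norm (?f k \<omega>) \<le> 1" for k
      using trapezoid_bounds by (auto simp: abs_mult intro!: mult_le_one)
  qed auto
  then show ?thesis by (simp add: S.prob_space)
qed

text \<open>Three comparisons are chained: the coefficient with the ratio of the scaled sums, that
  ratio with its limit through the continuous function \<open>h\<close>, and \<open>h\<close> in the
  limit with the true limit variable. The first and the last cost the mass outside the
  cutoff.\<close>

lemma scaled_pearson_test_function:
  assumes ab: "a < b"
  shows "(\<lambda>n. measure_pmf.expectation (joint_law n) (\<lambda>(d, m). cts_step a b (scaled_pearson n d m)))
     \<longlonglongrightarrow> (\<integral>\<omega>. cts_step a b (limit_var \<omega>) \<partial>exp_seq_space)"
proof (rule LIMSEQ_I)
  interpret S: prob_space exp_seq_space by (rule prob_space_exp_seq)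
  fix e :: real assume e: "0 < e"
  \<comment> \<open>The three comparisons cost \<open>4 * \<zeta>\<close>, less than \<zeta>, and at
    most \<zeta>; a seventh share makes the total strictly less than \<open>e\<close>.\<close>
  define \<zeta> where "\<zeta> = e / 7"
  have \<zeta>: "0 < \<zeta>" using e by (simp add: \<zeta>_def)
  let ?f = "cts_step a b"
  let ?U = "\<lambda>\<omega>. exp (- max 0 (stable_S \<gamma> 2 \<omega>))"
  let ?V = "\<lambda>\<omega>. exp (- max 0 (stable_S \<gamma> 3 \<omega>))"
  let ?Un = "\<lambda>n d. exp (- scaled_sum 2 n d)"
  let ?Vn = "\<lambda>n d. exp (- scaled_sum 3 n d)"
  have f_uc: "uniformly_continuous_on UNIV ?f" by (rule cts_step_uniformly_continuous[OF ab])
  have f_cont: "continuous_on UNIV ?f" by (rule uniformly_continuous_imp_continuous[OF f_uc])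
  have f_meas [measurable]: "?f \<in> borel_measurable borel" by (rule borel_measurable_continuous_onI[OF f_cont])
  have f01: "0 \<le> ?f x" "?f x \<le> 1" for x using cts_step_bounds[OF ab] by auto
  have fdiff: "\<bar>?f x - ?f y\<bar> \<le> 1" for x y using f01[of x] f01[of y] by linarith
  obtain \<eta>' where \<eta>': "0 < \<eta>'" "\<And>x y. dist y x < \<eta>' \<Longrightarrow> dist (?f y) (?f x) < \<zeta>"
    using f_uc \<zeta> unfolding uniformly_continuous_on_def by (metis UNIV_I)
  define \<eta> where "\<eta> = \<eta>' / 2"
  have \<eta>: "0 < \<eta>" "\<And>x y. \<bar>y - x\<bar> \<le> \<eta> \<Longrightarrow> \<bar>?f y - ?f x\<bar> \<le> \<zeta>"
    using \<eta>' by (auto simp: \<eta>_def dist_real_def intro!: less_imp_le)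
  have "\<forall>\<^sub>F k in sequentially. 1 - \<zeta> < (\<integral>\<omega>. trapezoid (1 / real (k + 3)) (?U \<omega>) * trapezoid (1 / real (k + 3)) (?V \<omega>) \<partial>exp_seq_space)"
    using \<zeta> by (intro order_tendstoD(1)[OF cutoff_tendsto_1]) auto
  then obtain k where k: "1 - \<zeta> < (\<integral>\<omega>. trapezoid (1 / real (k + 3)) (?U \<omega>) * trapezoid (1 / real (k + 3)) (?V \<omega>) \<partial>exp_seq_space)"
    by (auto simp: eventually_sequentially)
  define \<alpha> where "\<alpha> = 1 / real (k + 3)"
  \<comment> \<open>The offset 3 keeps \<alpha> below \<open>1 - \<alpha>\<close>, so the clamping
    interval is a proper subinterval of the unit interval.\<close>
  have \<alpha>: "0 < \<alpha>" "\<alpha> \<le> 1 / 3" by (auto simp: \<alpha>_def field_simps)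
  define cut where "cut z = trapezoid \<alpha> (fst z) * trapezoid \<alpha> (snd z)" for z
  have cut01: "0 \<le> cut z" "cut z \<le> 1" for z using trapezoid_bounds by (auto simp: cut_def intro!: mult_le_one)
  have cut_cont: "continuous_on UNIV cut"
    unfolding cut_def
    by (intro continuous_on_mult continuous_on_compose2[OF continuous_trapezoid[OF \<alpha>(1)]]
        continuous_on_fst continuous_on_snd continuous_on_id) auto
  have Ecut: "1 - \<zeta> < (\<integral>\<omega>. cut (?U \<omega>, ?V \<omega>) \<partial>exp_seq_space)" using k by (simp add: cut_def \<alpha>_def)
  text \<open>Clamping the coordinates makes the ratio a continuous function of \<open>(exp (- X), exp (- Y))\<close>.\<close>
  define cl where "cl u = max \<alpha> (min (1 - \<alpha>) u)" for u
  have cl: "\<alpha> \<le> cl u" "cl u \<le> 1 - \<alpha>" for u using \<alpha> by (auto simp: cl_def)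
  define h where "h z = ?f (- ((ln (cl (fst z)))\<^sup>2 / (- ln (cl (snd z)))))" for z
  have h_cont: "continuous_on UNIV h"
  proof -
    have "ln (cl u) \<noteq> 0" "cl u \<noteq> 0" for u
    proof -
      have "0 < cl u" "cl u < 1" using cl[of u] \<alpha> by linarith+
      then show "ln (cl u) \<noteq> 0" "cl u \<noteq> 0" by auto
    qed
    then have "continuous_on UNIV (\<lambda>z. - ((ln (cl (fst z)))\<^sup>2 / (- ln (cl (snd (z :: real \<times> real))))))"
      unfolding cl_def by (intro continuous_intros) auto
    then show ?thesis unfolding h_def by (intro continuous_on_compose2[OF f_cont]) auto
  qed
  have h01: "0 \<le> h z" "h z \<le> 1" for z by (auto simp: h_def f01)
  have h_eq: "h (exp (- x), exp (- y)) = ?f (- (x\<^sup>2 / y))" if "cut (exp (- x), exp (- y)) \<noteq> 0" for x y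
  proof -
    have "exp (- x) \<in> {\<alpha><..<1 - \<alpha>}" "exp (- y) \<in> {\<alpha><..<1 - \<alpha>}"
      using that \<alpha> by (auto simp: cut_def dest: trapezoid_support[OF \<alpha>(1)] simp del: greaterThanLessThan_iff)
    then show ?thesis by (simp add: h_def cl_def)
  qed
  have box: "x \<in> {- ln (1 - \<alpha>)..- ln \<alpha>} \<and> y \<in> {- ln (1 - \<alpha>)..- ln \<alpha>}" if "cut (exp (- x), exp (- y)) \<noteq> 0" for x y
  proof -
    have "exp (- x) \<in> {\<alpha><..<1 - \<alpha>}" "exp (- y) \<in> {\<alpha><..<1 - \<alpha>}"
      using that \<alpha> by (auto simp: cut_def dest: trapezoid_support[OF \<alpha>(1)] simp del: greaterThanLessThan_iff)
    then have "ln \<alpha> \<le> ln (exp (- x))" "ln (exp (- x)) \<le> ln (1 - \<alpha>)" "ln \<alpha> \<le> ln (exp (- y))" "ln (exp (- y)) \<le> ln (1 - \<alpha>)"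
      using \<alpha> by (auto simp del: ln_exp intro!: ln_mono)
    then show ?thesis by auto
  qed
  have cC: "0 < - ln (1 - \<alpha>)" "0 < - ln \<alpha>" using \<alpha> by (auto intro!: ln_less_zero)
  obtain \<delta> where \<delta>: "0 < \<delta>" and close:
    "\<forall>\<^sub>F n in sequentially. \<forall>d. good \<delta> n d \<longrightarrow> scaled_sum 2 n d \<in> {- ln (1 - \<alpha>)..- ln \<alpha>} \<longrightarrow> scaled_sum 3 n d \<in> {- ln (1 - \<alpha>)..- ln \<alpha>} \<longrightarrow>
       measure_pmf.prob (pmf_of_set (cm_matchings n d)) {m. \<eta> < \<bar>scaled_pearson n d m - limit_ratio n d\<bar>} \<le> \<zeta>"
    using scaled_pearson_close[OF cC \<eta>(1) \<zeta>] by blast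
  have cutn: "\<forall>\<^sub>F n in sequentially. 1 - \<zeta> < measure_pmf.expectation (deg_law n) (\<lambda>d. cut (?Un n d, ?Vn n d))"
    by (rule order_tendstoD(1)[OF scaled_sums_converge[OF cut_cont] Ecut])
  have hn: "\<forall>\<^sub>F n in sequentially. dist (measure_pmf.expectation (deg_law n) (\<lambda>d. h (?Un n d, ?Vn n d)))
      (\<integral>\<omega>. h (?U \<omega>, ?V \<omega>) \<partial>exp_seq_space) < \<zeta>"
    by (rule tendstoD[OF scaled_sums_converge[OF h_cont] \<zeta>])
  have gn: "\<forall>\<^sub>F n in sequentially. measure_pmf.prob (deg_law n) {d. \<not> good \<delta> n d} < \<zeta>"
    by (rule order_tendstoD(2)[OF good_whp[OF \<delta>] \<zeta>])
  have hU: "(\<lambda>\<omega>. h (?U \<omega>, ?V \<omega>)) \<in> borel_measurable exp_seq_space"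
    using borel_measurable_continuous_onI[OF h_cont] by measurable
  have cutU: "(\<lambda>\<omega>. cut (?U \<omega>, ?V \<omega>)) \<in> borel_measurable exp_seq_space"
    using borel_measurable_continuous_onI[OF cut_cont] by measurable
  have limit: "\<bar>(\<integral>\<omega>. h (?U \<omega>, ?V \<omega>) \<partial>exp_seq_space) - (\<integral>\<omega>. ?f (limit_var \<omega>) \<partial>exp_seq_space)\<bar> \<le> \<zeta>"
  proof -
    have i1: "integrable exp_seq_space (\<lambda>\<omega>. h (?U \<omega>, ?V \<omega>))"
      by (rule S.integrable_const_bound[where B=1]) (auto simp: h01 hU)
    have i2: "integrable exp_seq_space (\<lambda>\<omega>. ?f (limit_var \<omega>))"
      unfolding limit_var_def by (rule S.integrable_const_bound[where B=1]) (auto simp: f01)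
    have i3: "integrable exp_seq_space (\<lambda>\<omega>. cut (?U \<omega>, ?V \<omega>))"
      by (rule S.integrable_const_bound[where B=1]) (auto simp: cut01 cutU)
    have "\<bar>(\<integral>\<omega>. h (?U \<omega>, ?V \<omega>) \<partial>exp_seq_space) - (\<integral>\<omega>. ?f (limit_var \<omega>) \<partial>exp_seq_space)\<bar>
        = \<bar>\<integral>\<omega>. h (?U \<omega>, ?V \<omega>) - ?f (limit_var \<omega>) \<partial>exp_seq_space\<bar>" using i1 i2 by simp
    also have "\<dots> \<le> (\<integral>\<omega>. \<bar>h (?U \<omega>, ?V \<omega>) - ?f (limit_var \<omega>)\<bar> \<partial>exp_seq_space)" by (rule integral_abs_bound)
    also have "\<dots> \<le> (\<integral>\<omega>. 1 - cut (?U \<omega>, ?V \<omega>) \<partial>exp_seq_space)"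
    proof (rule integral_mono_AE)
      have "AE \<omega> in exp_seq_space. 0 < stable_S \<gamma> 2 \<omega>" "AE \<omega> in exp_seq_space. 0 < stable_S \<gamma> 3 \<omega>"
        using gamma_gt_1 gamma_less_2 by (auto intro!: stable_S_pos)
      then show "AE \<omega> in exp_seq_space. \<bar>h (?U \<omega>, ?V \<omega>) - ?f (limit_var \<omega>)\<bar> \<le> 1 - cut (?U \<omega>, ?V \<omega>)"
      proof eventually_elim
        case (elim \<omega>)
        show ?case
        proof (cases "cut (?U \<omega>, ?V \<omega>) = 0")
          case True then show ?thesis using fdiff by (simp add: h_def)
        next
          case False
          then have "h (?U \<omega>, ?V \<omega>) = ?f (limit_var \<omega>)" using h_eq elim by (simp add: limit_var_def)
          then show ?thesis using cut01 by simp
        qed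
      qed
    qed (use i1 i2 i3 in auto)
    also have "\<dots> = 1 - (\<integral>\<omega>. cut (?U \<omega>, ?V \<omega>) \<partial>exp_seq_space)" using i3 by (simp add: S.prob_space)
    finally show ?thesis using Ecut by linarith
  qed
  have "\<forall>\<^sub>F n in sequentially. norm (measure_pmf.expectation (joint_law n) (\<lambda>(d, m). ?f (scaled_pearson n d m))
      - (\<integral>\<omega>. ?f (limit_var \<omega>) \<partial>exp_seq_space)) < e"
    using close cutn hn gn
  proof eventually_elim
    case (elim n)
    let ?J = "joint_law n"
    \<comment> \<open>Only degree sequences inside the cutoff are counted, since
      \<open>scaled_pearson_close\<close> applies to these; the others are paid for by
      \<open>1 - cut\<close>.\<close>
    define A where "A = {z. cut (?Un n (fst z), ?Vn n (fst z)) \<noteq> 0 \<and> \<eta> < \<bar>scaled_pearson n (fst z) (snd z) - limit_ratio n (fst z)\<bar>}"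
    have PA: "measure_pmf.prob ?J A \<le> 2 * \<zeta>"
    proof -
      have "measure_pmf.prob ?J A \<le> measure_pmf.prob (deg_law n) {d. \<not> good \<delta> n d} + \<zeta>"
        unfolding joint_law_def
      proof (rule prob_bind_pmf_le)
        fix d assume g: "good \<delta> n d"
        show "measure_pmf.prob (map_pmf (Pair d) (pmf_of_set (cm_matchings n d))) A \<le> \<zeta>"
        proof (cases "cut (?Un n d, ?Vn n d) = 0")
          case True
          then show ?thesis using \<zeta> by (simp add: A_def vimage_def)
        next
          case False
          then have "Pair d -` A = {m. \<eta> < \<bar>scaled_pearson n d m - limit_ratio n d\<bar>}" by (auto simp: A_def)
          then show ?thesis using elim(1) g box[OF False] by simp
        qed
      qed (use \<zeta> in simp)
      then show ?thesis using elim(4) by linarith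
    qed
    have int: "integrable (measure_pmf ?J) g" if "\<And>z. \<bar>g z\<bar> \<le> 1" for g :: "_ \<Rightarrow> real"
      using that by (intro measure_pmf.integrable_const_bound[where B=1]) auto
    have i1: "integrable (measure_pmf ?J) (\<lambda>z. ?f (scaled_pearson n (fst z) (snd z)))" by (rule int) (simp add: f01)
    have i2: "integrable (measure_pmf ?J) (\<lambda>z. h (?Un n (fst z), ?Vn n (fst z)))" by (rule int) (simp add: h01)
    have i3: "integrable (measure_pmf ?J) (\<lambda>z. cut (?Un n (fst z), ?Vn n (fst z)))" by (rule int) (simp add: cut01)
    have i4: "integrable (measure_pmf ?J) (indicator A :: _ \<Rightarrow> real)" by (rule int) (simp add: indicator_def)
    have "\<bar>measure_pmf.expectation ?J (\<lambda>z. ?f (scaled_pearson n (fst z) (snd z)))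
        - measure_pmf.expectation ?J (\<lambda>z. h (?Un n (fst z), ?Vn n (fst z)))\<bar>
        = \<bar>measure_pmf.expectation ?J (\<lambda>z. ?f (scaled_pearson n (fst z) (snd z)) - h (?Un n (fst z), ?Vn n (fst z)))\<bar>"
      using i1 i2 by simp
    also have "\<dots> \<le> measure_pmf.expectation ?J (\<lambda>z. \<bar>?f (scaled_pearson n (fst z) (snd z)) - h (?Un n (fst z), ?Vn n (fst z))\<bar>)"
      by (rule integral_abs_bound)
    \<comment> \<open>Uniform continuity gives \<zeta> when the cutoff is nonzero and the
      coefficient is close; in the other cases the difference is at most 1, covered by one of the
      last two terms.\<close>
    also have "\<dots> \<le> measure_pmf.expectation ?J (\<lambda>z. \<zeta> + (1 - cut (?Un n (fst z), ?Vn n (fst z))) + indicator A z)"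
    proof (rule integral_mono)
      fix z
      let ?l = "\<bar>?f (scaled_pearson n (fst z) (snd z)) - h (?Un n (fst z), ?Vn n (fst z))\<bar>"
      have l1: "?l \<le> 1" unfolding h_def by (rule fdiff)
      show "?l \<le> \<zeta> + (1 - cut (?Un n (fst z), ?Vn n (fst z))) + indicator A z"
      proof (cases "cut (?Un n (fst z), ?Vn n (fst z)) = 0 \<or> z \<in> A")
        case True
        then show ?thesis using l1 \<zeta> cut01(2)[of "(?Un n (fst z), ?Vn n (fst z))"] by (auto simp: indicator_def)
      next
        case False
        then have "\<bar>scaled_pearson n (fst z) (snd z) - limit_ratio n (fst z)\<bar> \<le> \<eta>" by (auto simp: A_def not_less)
        then have "\<bar>?f (scaled_pearson n (fst z) (snd z)) - ?f (limit_ratio n (fst z))\<bar> \<le> \<zeta>" by (rule \<eta>(2))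
        moreover have "h (?Un n (fst z), ?Vn n (fst z)) = ?f (limit_ratio n (fst z))"
          unfolding limit_ratio_def using False by (intro h_eq) auto
        ultimately show ?thesis using cut01(2)[of "(?Un n (fst z), ?Vn n (fst z))"] by (simp add: indicator_def)
      qed
    qed (use i1 i2 i3 i4 in auto)
    also have "\<dots> = \<zeta> + (1 - measure_pmf.expectation ?J (\<lambda>z. cut (?Un n (fst z), ?Vn n (fst z)))) + measure_pmf.prob ?J A"
      using i3 i4 by simp
    also have "\<dots> \<le> 4 * \<zeta>"
      using PA elim(2) expectation_joint_fst[of n "\<lambda>d. cut (?Un n d, ?Vn n d)"] by simp
    finally have "\<bar>measure_pmf.expectation ?J (\<lambda>z. ?f (scaled_pearson n (fst z) (snd z)))
        - measure_pmf.expectation (deg_law n) (\<lambda>d. h (?Un n d, ?Vn n d))\<bar> \<le> 4 * \<zeta>"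
      using expectation_joint_fst[of n "\<lambda>d. h (?Un n d, ?Vn n d)"] by simp
    moreover have "(\<lambda>(d, m). ?f (scaled_pearson n d m)) = (\<lambda>z. ?f (scaled_pearson n (fst z) (snd z)))"
      by (simp add: case_prod_unfold)
    ultimately show ?case
      using limit elim(3) e unfolding dist_real_def real_norm_def \<zeta>_def by (simp only:)
  qed
  then show "\<exists>no. \<forall>n\<ge>no. norm (measure_pmf.expectation (joint_law n) (\<lambda>(d, m). ?f (scaled_pearson n d m))
      - (\<integral>\<omega>. ?f (limit_var \<omega>) \<partial>exp_seq_space)) < e"
    by (simp add: eventually_sequentially)
qed

end

text \<open>In a \<open>pmf\<close> every set is measurable, whereas the convergence criterion is
  about Borel measures on the line. The image under the identity changes the sigma-algebra but not
  the distribution function.\<close>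

lemma weak_conv_m_pmf:
  fixes q :: "nat \<Rightarrow> real pmf"
  assumes M: "real_distribution M"
    and conv: "\<And>a b. a < b \<Longrightarrow> (\<lambda>n. measure_pmf.expectation (q n) (cts_step a b)) \<longlonglongrightarrow> integral\<^sup>L M (cts_step a b)"
  shows "weak_conv_m (\<lambda>n. measure_pmf (q n)) M"
proof -
  let ?D = "\<lambda>n. distr (measure_pmf (q n)) borel (\<lambda>x. x)"
  have D: "real_distribution (?D n)" for n
    by (rule prob_space.real_distribution_distr[OF measure_pmf.prob_space_axioms]) simp
  have "weak_conv_m ?D M"
  proof (rule integral_cts_step_conv_imp_weak_conv[OF D M])
    fix a b :: real assume ab: "a < b"
    have "cts_step a b \<in> borel_measurable borel"
      by (intro borel_measurable_continuous_onI uniformly_continuous_imp_continuous cts_step_uniformly_continuous ab)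
    then show "(\<lambda>n. integral\<^sup>L (?D n) (cts_step a b)) \<longlonglongrightarrow> integral\<^sup>L M (cts_step a b)"
      using conv[OF ab] by (simp add: integral_distr)
  qed
  moreover have "cdf (?D n) = cdf (measure_pmf (q n))" for n
    by (auto simp: cdf_def measure_distr fun_eq_iff)
  ultimately show ?thesis by (simp add: weak_conv_m_def)
qed

theorem theorem1p2:
  fixes p :: "nat pmf" and L :: "real \<Rightarrow> real" and \<gamma> :: real
  assumes "1 < \<gamma>" and "\<gamma> < 2"
    and "slowly_varying L"
    and "\<forall>t>0. measure_pmf.prob p {k. real k > t} = L t * t powr (- \<gamma>)"
  shows "\<exists>L1. slowly_varying L1 \<and>
     weak_conv_m
       (\<lambda>n. measure_pmf (ecm_law p n (\<lambda>d m.
          measure_pmf.expectation p real * L1 (real n) * real n powr (1 - 1 / \<gamma>) * ecm_pearson n d m)))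
       (distr exp_seq_space borel
          (\<lambda>\<omega>. - ((stable_S \<gamma> 2 \<omega>)\<^sup>2 / stable_S \<gamma> 3 \<omega>)))"
proof -
  interpret heavy_tail p L \<gamma>
    using assms by unfold_locales (auto simp: tail_prob_def)
  interpret S: prob_space exp_seq_space by (rule prob_space_exp_seq)
  let ?L1 = "\<lambda>t. t powr (1 / \<gamma>) / \<a> t"
  let ?M = "distr exp_seq_space borel limit_var"
  have lv [measurable]: "limit_var \<in> borel_measurable exp_seq_space"
    unfolding limit_var_def[abs_def] by measurable
  have "measure_pmf.expectation p real * ?L1 (real n) * real n powr (1 - 1 / \<gamma>) * ecm_pearson n d m
      = scaled_pearson n d m" for n d m
  \<comment> \<open>For positive \<open>n\<close> the two powers of \<open>n\<close> combine to
    \<open>n\<close>; at 0 both sides vanish.\<close>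
  proof (cases "n = 0")
    case False
    then have "?L1 (real n) * real n powr (1 - 1 / \<gamma>) = real n / an n"
      by (simp add: powr_add[symmetric])
    then show ?thesis by (simp only: scaled_pearson_def \<mu>_def mult.assoc)
  qed (simp add: scaled_pearson_def)
  then have law: "ecm_law p n (\<lambda>d m. measure_pmf.expectation p real * ?L1 (real n) * real n powr (1 - 1 / \<gamma>) * ecm_pearson n d m)
      = map_pmf (\<lambda>(d, m). scaled_pearson n d m) (joint_law n)" for n
    by (simp only: ecm_law_eq)
  have "weak_conv_m (\<lambda>n. measure_pmf (map_pmf (\<lambda>(d, m). scaled_pearson n d m) (joint_law n))) ?M"
  proof (rule weak_conv_m_pmf)
    show "real_distribution ?M" by (rule S.real_distribution_distr) (rule lv)
    fix a b :: real assume ab: "a < b"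
    have "cts_step a b \<in> borel_measurable borel"
      by (intro borel_measurable_continuous_onI uniformly_continuous_imp_continuous cts_step_uniformly_continuous ab)
    then show "(\<lambda>n. measure_pmf.expectation (map_pmf (\<lambda>(d, m). scaled_pearson n d m) (joint_law n)) (cts_step a b))
        \<longlonglongrightarrow> integral\<^sup>L ?M (cts_step a b)"
      using scaled_pearson_test_function[OF ab] by (simp add: integral_distr case_prod_unfold)
  qed
  then have "weak_conv_m (\<lambda>n. measure_pmf (ecm_law p n (\<lambda>d m. measure_pmf.expectation p real * ?L1 (real n)
      * real n powr (1 - 1 / \<gamma>) * ecm_pearson n d m)))
      (distr exp_seq_space borel (\<lambda>\<omega>. - ((stable_S \<gamma> 2 \<omega>)\<^sup>2 / stable_S \<gamma> 3 \<omega>)))"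
    unfolding law limit_var_def[abs_def] .
  then show ?thesis using slowly_varying_normalizer by blast
qed

end
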